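(* Let $\mu,\nu\in\{-,0,+\}$ and $\tau\in\mathbb{R}$. There exists a right coaction $\gamma:B_{\mu\nu}^{\tau}\to B_{\mu\nu}^{\tau}\otimes\mathrm{Pol}_q(\mu)$ such that \[\gamma(X)=-q\mu X^*\otimes b_\mu^2-q(1+q^2)\mu Z\otimes b_\mu a_\mu+X\otimes a_\mu^2+q\tau\,1\otimes b_\mu a_\mu,\] \[\gamma(Z)=X^*\otimes a_\mu^*b_\mu+Z\otimes(1-(1+q^2)\mu b_\mu^*b_\mu)+X\otimes b_\mu^*a_\mu+\tau\,1\otimes b_\mu^*b_\mu,\] \[\gamma(X^* )=X^*\otimes(a_\mu^* )^2-q(1+q^2)\mu Z\otimes a_\mu^*b_\mu^*-q\mu X\otimes(b_\mu^* )^2+q\tau\,1\otimes a_\mu^*b_\mu^*,\] and such that, for any $x\in U_q(\mu)$ and $y\in B_{\mu\nu}^\tau$, $x\rhd y=(\iota\otimes\langle\,\cdot\,,x\rangle)\gamma(y)$.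
   Context: Fix a real number $0<q<1$ and put $\lambda=(q-q^{-1})^{-1}<0$. The symbols $-,0,+$ stand for the real numbers $-1,0,1$; $\iota$ is the identity map. For $\mu,\nu\in\mathbb{R}$, $U_q(\mu,\nu)$ is the universal unital algebra over $\mathbb{C}$ generated by $K,K^{-1},E,F$ (written $K_{\mu\nu}$, $E_{\mu\nu}$, etc. when indices matter) with relations $K^{-1}K=1=KK^{-1}$, $KE=qEK$, $KF=q^{-1}FK$, $[E,F]=\lambda(\mu K^2-\nu K^{-2})$, with $^*$-structure determined by $K^*=K$, $E^*=F$. For $\mu,\upsilon,\nu\in\mathbb{R}$, $\Delta_{\mu\nu}^{\upsilon}:U_q(\mu,\nu)\to U_q(\mu,\upsilon)\otimes U_q(\upsilon,\nu)$ is the unital $^*$-homomorphism with $\Delta_{\mu\nu}^{\upsilon}(E_{\mu\nu})=E_{\mu\upsilon}\otimes K_{\upsilon\nu}+K_{\mu\upsilon}^{-1}\otimes E_{\upsilon\nu}$, $\Delta_{\mu\nu}^{\upsilon}(K_{\mu\nu})=K_{\mu\upsilon}\otimes K_{\upsilon\nu}$; write $\Delta_{\mu\nu}^\upsilon(x)=x_{(1)\mu\upsilon}\otimes x_{(2)\upsilon\nu}$. $U_q(\mu):=U_q(\mu,\mu)$ is a Hopf $^*$-algebra with comultiplication $\Delta_{\mu\mu}^\mu$. $S_{\mu\nu}:U_q(\mu,\nu)\to U_q(\nu,\mu)$ is the unital bijective anti-homomorphism with $S_{\mu\nu}(E_{\mu\nu})=-qE_{\nu\mu}$, $S_{\mu\nu}(F_{\mu\nu})=-q^{-1}F_{\nu\mu}$,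 $S_{\mu\nu}(K_{\mu\nu})=K_{\nu\mu}^{-1}$. The left Miyashita-Ulbrich action of $U_q(\mu)$ on $U_q(\mu,\nu)$ is $x\rhd y=x_{(1)\mu\nu}\,y\,S_{\nu\mu}(x_{(2)\nu\mu})$. Let $C_{\mu\nu}=EF+\lambda^2(q^{-1}\mu K^2+q\nu K^{-2})$, a central self-adjoint element of $U_q(\mu,\nu)$, and $A_{\mu\nu}^\tau=U_q(\mu,\nu)/(C_{\mu\nu}-\tau q^{-1}\lambda^2 1)$ with quotient map $\pi_\tau$; $U_q(\mu)$ acts on $A_{\mu\nu}^\tau$ by $x\rhd\pi_\tau(y)=\pi_\tau(x\rhd y)$. $B_{\mu\nu}^\tau$ is the unital sub-$^*$-algebra of $A_{\mu\nu}^\tau$ generated by $\pi_\tau(K_{\mu\nu}^2)$ and $\pi_\tau(K_{\mu\nu}E_{\mu\nu})$; it is invariant under this action. Put $X=q^{1/2}(q^{-1}-q)\pi_\tau(F_{\mu\nu}K_{\mu\nu})$ and $Z=\pi_\tau(K_{\mu\nu}^2)$. $\mathrm{Pol}(SL_q(2,\mathbb{C}))$ is the unital algebra generated by $a,b,c,d$ with relations $ab=qba$, $ac=qca$, $bd=qdb$, $cd=qdc$, $bc=cb$, $da-q^{-1}cb=1$, $ad-qbc=1$; it is a Hopf algebra with $\Delta(a)=a\otimes a+c\otimes b$, $\Delta(b)=b\otimes a+d\otimes b$, $\Delta(c)=a\otimes c+c\otimes d$, $\Delta(d)=b\otimes c+d\otimes d$. $\mathrm{Pol}_q(+)$ is this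 Hopf algebra with $^*$-structure $a^*=d$, $b^*=-q^{-1}c$, generators denoted $a_+,b_+$. $\mathrm{Pol}_q(-)$ is this Hopf algebra with $^*$-structure $a^*=d$, $b^*=q^{-1}c$, generators denoted $a_-,b_-$. $\mathrm{Pol}_q(0)$ is the universal unital $^*$-algebra generated by $a_0,b_0$ with $a_0^*a_0=1=a_0a_0^*$, $a_0b_0=qb_0a_0$, $a_0^*b_0=q^{-1}b_0a_0^*$, $b_0b_0^*=b_0^*b_0$, a Hopf $^*$-algebra with $\Delta_0(a_0)=a_0\otimes a_0$, $\Delta_0(b_0)=b_0\otimes a_0+a_0^*\otimes b_0$. $\langle\cdot,\cdot\rangle$ is the unique non-degenerate Hopf $^*$-algebra pairing between $U_q(\mu)$ and $\mathrm{Pol}_q(\mu)$ with $\langle K,a\rangle=q^{-1/2}$, $\langle K,a^*\rangle=q^{1/2}$, $\langle E,b\rangle=1$, $\langle F,-qb^*\rangle=1$ and all other pairings between generators zero; $\langle\cdot,x\rangle$ denotes the functional on $\mathrm{Pol}_q(\mu)$ given by pairing with $x\in U_q(\mu)$. A pairing of Hopf $^*$-algebras $H,L$ is a bilinear map with $\langle\Delta_H(x),y\otimes z\rangle=\langle x,yz\rangle$, $\langle x\otimes y,\Delta_L(z)\rangle=\langle xy,z\rangle$, $\langle x^*,y\rangle=\overline{\langle x,S(y)^*\rangle}$, $\langle x,y^*\rangle=\overline{\langle S(x)^*,y\rangle}$. A right coaction of a Hopf $^*$-algebra $(P,\Delta)$ on a unital $^*$-algebra $B$ is a right comodule $^*$-algebra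 structure: a unital $^*$-homomorphism $\gamma:B\to B\otimes P$ with $(\gamma\otimes\iota)\gamma=(\iota\otimes\Delta)\gamma$ and $(\iota\otimes\varepsilon)\gamma=\iota$. *)

theory Defs
  imports Complex_Main "HOL-Library.Poly_Mapping" "HOL-Algebra.QuotRing"
    "HOL-Algebra.Module" "HOL-Algebra.Subrings"
begin

section \<open>Complex unital $*$-algebras\<close>

text \<open>
  The locale \<^locale>\<open>algebra\<close> of the library is restricted to commutative algebras, so only its
  record type is used here; the scalars are the complex numbers.
\<close>

record 'a star_alg = "(complex, 'a) module" +
  star :: "'a \<Rightarrow> 'a"

record 'a hopf_star_alg = "'a star_alg" +
  comul :: "'a \<Rightarrow> (('a \<times> 'a) \<Rightarrow>\<^sub>0 complex) set"
  counit :: "'a \<Rightarrow> complex"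
  antipode :: "'a \<Rightarrow> 'a"

definition complex_alg :: "(complex, complex) module" where
  "complex_alg = \<lparr>carrier = UNIV, mult = (*), one = 1, zero = 0, add = (+), smult = (*)\<rparr>"

definition opp_alg :: "(complex, 'a, 'm) module_scheme \<Rightarrow> (complex, 'a, 'm) module_scheme" where
  "opp_alg A = A\<lparr>mult := \<lambda>x y. y \<otimes>\<^bsub>A\<^esub> x\<rparr>"

definition conj_alg :: "(complex, 'a, 'm) module_scheme \<Rightarrow> (complex, 'a, 'm) module_scheme" where
  "conj_alg A = A\<lparr>smult := \<lambda>c x. cnj c \<odot>\<^bsub>A\<^esub> x\<rparr>"

definition star_alg_hom ::
    "('a, 'm) star_alg_scheme \<Rightarrow> ('b, 'n) star_alg_scheme \<Rightarrow> ('a \<Rightarrow> 'b) \<Rightarrow> bool" where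
  "star_alg_hom A B f \<longleftrightarrow> f \<in> ring_hom A B \<and>
     (\<forall>c. \<forall>x \<in> carrier A. f (c \<odot>\<^bsub>A\<^esub> x) = c \<odot>\<^bsub>B\<^esub> f x) \<and>
     (\<forall>x \<in> carrier A. f (star A x) = star B (f x))"

definition star_subalg :: "('a, 'm) star_alg_scheme \<Rightarrow> 'a set \<Rightarrow> bool" where
  "star_subalg A S \<longleftrightarrow> subring S A \<and>
     (\<forall>c. \<forall>x \<in> S. c \<odot>\<^bsub>A\<^esub> x \<in> S) \<and> (\<forall>x \<in> S. star A x \<in> S)"

definition generated_star_subalg ::
    "('a, 'm) star_alg_scheme \<Rightarrow> 'a set \<Rightarrow> ('a, 'm) star_alg_scheme" where
  "generated_star_subalg A G = A\<lparr>carrier := \<Inter>{S. star_subalg A S \<and> G \<subseteq> S}\<rparr>"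

text \<open>
  Quotient by a two-sided ideal, on the set of cosets; the star is meaningful for $*$-invariant
  ideals.  Ideals of unital algebras are automatically complex subspaces.  The union in the scalar
  multiplication is needed because zero times a coset, taken elementwise, is not a coset.
\<close>

definition quot_alg :: "('a, 'm) star_alg_scheme \<Rightarrow> 'a set \<Rightarrow> 'a set star_alg" where
  "quot_alg A I =
     \<lparr>carrier = carrier (A Quot I), mult = mult (A Quot I), one = one (A Quot I),
      zero = zero (A Quot I), add = add (A Quot I),
      smult = (\<lambda>c S. \<Union>x\<in>S. I +>\<^bsub>A\<^esub> (c \<odot>\<^bsub>A\<^esub> x)),
      star = (\<lambda>S. \<Union>x\<in>S. I +>\<^bsub>A\<^esub> star A x)\<rparr>"


section \<open>Algebras given by generators and relations\<close>

datatype 'g free_monoid = FM (letters: "'g list")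

instantiation free_monoid :: (type) monoid_add
begin

definition zero_free_monoid :: "'a free_monoid" where
  "0 = FM []"

definition plus_free_monoid :: "'a free_monoid \<Rightarrow> 'a free_monoid \<Rightarrow> 'a free_monoid" where
  "u + v = FM (letters u @ letters v)"

instance
  by standard (simp_all add: zero_free_monoid_def plus_free_monoid_def)

end

text \<open>
  The type of noncommutative polynomials; its product in the class \<^class>\<open>ring_1\<close> is the
  convolution product with respect to concatenation of words.
\<close>

type_synonym 'g free_alg = "'g free_monoid \<Rightarrow>\<^sub>0 complex"

definition gen :: "'g \<Rightarrow> 'g free_alg" where
  "gen g = Poly_Mapping.single (FM [g]) 1"

definition cst :: "real \<Rightarrow> 'g free_alg" where
  "cst r = Poly_Mapping.single 0 (complex_of_real r)"

definition free_algebra :: "(complex, 'g free_alg) module" where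
  "free_algebra = \<lparr>carrier = UNIV, mult = (*), one = 1, zero = 0, add = (+),
     smult = (\<lambda>c. Poly_Mapping.map ((*) c))\<rparr>"

text \<open>The unital homomorphism from the free algebra extending an assignment \<open>v\<close> of the generators.\<close>

definition free_eval ::
    "(complex, 'a, 'm) module_scheme \<Rightarrow> ('g \<Rightarrow> 'a) \<Rightarrow> 'g free_alg \<Rightarrow> 'a" where
  "free_eval A v f = (\<Oplus>\<^bsub>A\<^esub>w\<in>Poly_Mapping.keys f.
     Poly_Mapping.lookup f w \<odot>\<^bsub>A\<^esub> foldr (\<lambda>g x. v g \<otimes>\<^bsub>A\<^esub> x) (letters w) \<one>\<^bsub>A\<^esub>)"

text \<open>
  The free algebra with the antilinear antimultiplicative involution that extends \<open>s\<close>,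
  then its quotient by the two-sided ideal generated by \<open>R\<close>, with projection \<open>pcls s R\<close>.
\<close>

definition free_star_alg :: "('g \<Rightarrow> 'g free_alg) \<Rightarrow> 'g free_alg star_alg" where
  "free_star_alg s = module.extend free_algebra
     (star_alg.fields (free_eval (conj_alg (opp_alg free_algebra)) s))"

definition presented :: "('g \<Rightarrow> 'g free_alg) \<Rightarrow> 'g free_alg set \<Rightarrow> 'g free_alg set star_alg" where
  "presented s R = quot_alg (free_star_alg s) (Idl\<^bsub>free_star_alg s\<^esub> R)"

definition pcls ::
    "('g \<Rightarrow> 'g free_alg) \<Rightarrow> 'g free_alg set \<Rightarrow> 'g free_alg \<Rightarrow> 'g free_alg set" where
  "pcls s R f = (Idl\<^bsub>free_star_alg s\<^esub> R) +>\<^bsub>free_star_alg s\<^esub> f"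

text \<open>
  The unital homomorphism from a presented algebra to \<open>A\<close> with values \<open>v\<close> on the generators,
  assuming that \<open>v\<close> respects the relations.  An antihomomorphism is a homomorphism to the opposite
  algebra.
\<close>

definition pres_lift ::
    "(complex, 'a, 'm) module_scheme \<Rightarrow> ('g \<Rightarrow> 'a) \<Rightarrow> 'g free_alg set \<Rightarrow> 'a" where
  "pres_lift A v S = the_elem (free_eval A v ` S)"


section \<open>Tensor products\<close>

text \<open>
  \<open>tensor A B\<close> is the vector space with basis \<open>carrier A \<times> carrier B\<close> modulo the bilinearity
  relations.  The former carries the componentwise product and star, i.e. it is the $*$-algebra of
  the multiplicative monoid \<open>carrier A \<times> carrier B\<close>; the linear span of the bilinearity relations is
  a two-sided $*$-ideal of it, so it coincides with the ideal generated by these relations.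
\<close>

definition pre_tensor ::
    "('a, 'm) star_alg_scheme \<Rightarrow> ('b, 'n) star_alg_scheme \<Rightarrow> (('a \<times> 'b) \<Rightarrow>\<^sub>0 complex) star_alg" where
  "pre_tensor A B =
     \<lparr>carrier = {f. Poly_Mapping.keys f \<subseteq> carrier A \<times> carrier B},
      mult = (\<lambda>f g. \<Sum>x\<in>Poly_Mapping.keys f. \<Sum>y\<in>Poly_Mapping.keys g.
        Poly_Mapping.single (fst x \<otimes>\<^bsub>A\<^esub> fst y, snd x \<otimes>\<^bsub>B\<^esub> snd y)
          (Poly_Mapping.lookup f x * Poly_Mapping.lookup g y)),
      one = Poly_Mapping.single (\<one>\<^bsub>A\<^esub>, \<one>\<^bsub>B\<^esub>) 1,
      zero = 0,
      add = (+),
      smult = (\<lambda>c. Poly_Mapping.map ((*) c)),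
      star = (\<lambda>f. \<Sum>x\<in>Poly_Mapping.keys f.
        Poly_Mapping.single (star A (fst x), star B (snd x)) (cnj (Poly_Mapping.lookup f x)))\<rparr>"

definition bilin_rels ::
    "('a, 'm) star_alg_scheme \<Rightarrow> ('b, 'n) star_alg_scheme \<Rightarrow> (('a \<times> 'b) \<Rightarrow>\<^sub>0 complex) set" where
  "bilin_rels A B = (let s = Poly_Mapping.single in
     {s (x \<oplus>\<^bsub>A\<^esub> x', y) 1 - s (x, y) 1 - s (x', y) 1 | x x' y.
        x \<in> carrier A \<and> x' \<in> carrier A \<and> y \<in> carrier B} \<union>
     {s (x, y \<oplus>\<^bsub>B\<^esub> y') 1 - s (x, y) 1 - s (x, y') 1 | x y y'.
        x \<in> carrier A \<and> y \<in> carrier B \<and> y' \<in> carrier B} \<union>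
     {s (c \<odot>\<^bsub>A\<^esub> x, y) 1 - s (x, y) c | c x y. x \<in> carrier A \<and> y \<in> carrier B} \<union>
     {s (x, c \<odot>\<^bsub>B\<^esub> y) 1 - s (x, y) c | c x y. x \<in> carrier A \<and> y \<in> carrier B})"

definition tensor ::
    "('a, 'm) star_alg_scheme \<Rightarrow> ('b, 'n) star_alg_scheme \<Rightarrow>
     (('a \<times> 'b) \<Rightarrow>\<^sub>0 complex) set star_alg" where
  "tensor A B = quot_alg (pre_tensor A B) (Idl\<^bsub>pre_tensor A B\<^esub> (bilin_rels A B))"

definition tens ::
    "('a, 'm) star_alg_scheme \<Rightarrow> ('b, 'n) star_alg_scheme \<Rightarrow> 'a \<Rightarrow> 'b \<Rightarrow>
     (('a \<times> 'b) \<Rightarrow>\<^sub>0 complex) set" where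
  "tens A B x y =
     (Idl\<^bsub>pre_tensor A B\<^esub> (bilin_rels A B)) +>\<^bsub>pre_tensor A B\<^esub> Poly_Mapping.single (x, y) 1"

text \<open>The linear map on a tensor product induced by a bilinear map \<open>\<phi>\<close> with values in \<open>V\<close>.\<close>

definition tensor_lift ::
    "(complex, 'c, 'm) module_scheme \<Rightarrow> ('a \<Rightarrow> 'b \<Rightarrow> 'c) \<Rightarrow> (('a \<times> 'b) \<Rightarrow>\<^sub>0 complex) set \<Rightarrow> 'c" where
  "tensor_lift V \<phi> T = the_elem ((\<lambda>f. \<Oplus>\<^bsub>V\<^esub>p\<in>Poly_Mapping.keys f.
     Poly_Mapping.lookup f p \<odot>\<^bsub>V\<^esub> \<phi> (fst p) (snd p)) ` T)"

text \<open>\<open>tensor_map C D f g\<close> is $f \otimes g$ with values in $C \otimes D$.\<close>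

definition tensor_map ::
    "('c, 'm) star_alg_scheme \<Rightarrow> ('d, 'n) star_alg_scheme \<Rightarrow> ('a \<Rightarrow> 'c) \<Rightarrow> ('b \<Rightarrow> 'd) \<Rightarrow>
     (('a \<times> 'b) \<Rightarrow>\<^sub>0 complex) set \<Rightarrow> (('c \<times> 'd) \<Rightarrow>\<^sub>0 complex) set" where
  "tensor_map C D f g = tensor_lift (tensor C D) (\<lambda>x y. tens C D (f x) (g y))"

text \<open>The canonical isomorphism $(A \otimes B) \otimes C \to A \otimes (B \otimes C)$.\<close>

definition tensor_assoc ::
    "('a, 'm) star_alg_scheme \<Rightarrow> ('b, 'n) star_alg_scheme \<Rightarrow> ('c, 'k) star_alg_scheme \<Rightarrow>
     (((('a \<times> 'b) \<Rightarrow>\<^sub>0 complex) set \<times> 'c) \<Rightarrow>\<^sub>0 complex) set \<Rightarrow>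
     (('a \<times> (('b \<times> 'c) \<Rightarrow>\<^sub>0 complex) set) \<Rightarrow>\<^sub>0 complex) set" where
  "tensor_assoc A B C =
     (let T = tensor A (tensor B C) in
      tensor_lift T (\<lambda>t z. tensor_lift T (\<lambda>x y. tens A (tensor B C) x (tens B C y z)) t))"

text \<open>$\iota \otimes \omega : B \otimes P \to B \otimes \mathbb{C} = B$ for a linear functional $\omega$ on $P$.\<close>

definition slice ::
    "('b, 'm) star_alg_scheme \<Rightarrow> ('p \<Rightarrow> complex) \<Rightarrow> (('b \<times> 'p) \<Rightarrow>\<^sub>0 complex) set \<Rightarrow> 'b" where
  "slice B \<omega> = tensor_lift B (\<lambda>y p. \<omega> p \<odot>\<^bsub>B\<^esub> y)"


section \<open>Coactions and pairings\<close>

definition right_coaction ::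
    "('b, 'm) star_alg_scheme \<Rightarrow> ('p, 'n) hopf_star_alg_scheme \<Rightarrow>
     ('b \<Rightarrow> (('b \<times> 'p) \<Rightarrow>\<^sub>0 complex) set) \<Rightarrow> bool" where
  "right_coaction B P \<gamma> \<longleftrightarrow>
     star_alg_hom B (tensor B P) \<gamma> \<and>
     (\<forall>y \<in> carrier B.
        tensor_assoc B P P (tensor_map (tensor B P) P \<gamma> (\<lambda>p. p) (\<gamma> y)) =
        tensor_map B (tensor P P) (\<lambda>b. b) (comul P) (\<gamma> y)) \<and>
     (\<forall>y \<in> carrier B. slice B (counit P) (\<gamma> y) = y)"

definition hopf_star_pairing ::
    "('h, 'm) hopf_star_alg_scheme \<Rightarrow> ('l, 'n) hopf_star_alg_scheme \<Rightarrow>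
     ('h \<Rightarrow> 'l \<Rightarrow> complex) \<Rightarrow> bool" where
  "hopf_star_pairing H L P \<longleftrightarrow>
     (\<forall>x \<in> carrier H. \<forall>x' \<in> carrier H. \<forall>y \<in> carrier L. P (x \<oplus>\<^bsub>H\<^esub> x') y = P x y + P x' y) \<and>
     (\<forall>x \<in> carrier H. \<forall>y \<in> carrier L. \<forall>y' \<in> carrier L. P x (y \<oplus>\<^bsub>L\<^esub> y') = P x y + P x y') \<and>
     (\<forall>c. \<forall>x \<in> carrier H. \<forall>y \<in> carrier L. P (c \<odot>\<^bsub>H\<^esub> x) y = c * P x y) \<and>
     (\<forall>c. \<forall>x \<in> carrier H. \<forall>y \<in> carrier L. P x (c \<odot>\<^bsub>L\<^esub> y) = c * P x y) \<and>
     (\<forall>x \<in> carrier H. \<forall>y \<in> carrier L. \<forall>z \<in> carrier L.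
        tensor_lift complex_alg (\<lambda>u v. P u y * P v z) (comul H x) = P x (y \<otimes>\<^bsub>L\<^esub> z)) \<and>
     (\<forall>x \<in> carrier H. \<forall>y \<in> carrier H. \<forall>z \<in> carrier L.
        tensor_lift complex_alg (\<lambda>u v. P x u * P y v) (comul L z) = P (x \<otimes>\<^bsub>H\<^esub> y) z) \<and>
     (\<forall>x \<in> carrier H. \<forall>y \<in> carrier L. P (star H x) y = cnj (P x (star L (antipode L y)))) \<and>
     (\<forall>x \<in> carrier H. \<forall>y \<in> carrier L. P x (star L y) = cnj (P (star H (antipode H x)) y))"

definition nondegenerate_pairing ::
    "('h, 'm) hopf_star_alg_scheme \<Rightarrow> ('l, 'n) hopf_star_alg_scheme \<Rightarrow>
     ('h \<Rightarrow> 'l \<Rightarrow> complex) \<Rightarrow> bool" where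
  "nondegenerate_pairing H L P \<longleftrightarrow>
     (\<forall>x \<in> carrier H. (\<forall>y \<in> carrier L. P x y = 0) \<longrightarrow> x = \<zero>\<^bsub>H\<^esub>) \<and>
     (\<forall>y \<in> carrier L. (\<forall>x \<in> carrier H. P x y = 0) \<longrightarrow> y = \<zero>\<^bsub>L\<^esub>)"


section \<open>The algebras $U_q(\mu,\nu)$\<close>

definition lam :: "real \<Rightarrow> real" where
  "lam q = 1 / (q - 1 / q)"

datatype ugen = GK | GKi | GE | GF

type_synonym U = "ugen free_alg set"

fun u_star :: "ugen \<Rightarrow> ugen free_alg" where
  "u_star GK = gen GK"
| "u_star GKi = gen GKi"
| "u_star GE = gen GF"
| "u_star GF = gen GE"

definition u_rels :: "real \<Rightarrow> real \<Rightarrow> real \<Rightarrow> ugen free_alg set" where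
  "u_rels q \<mu> \<nu> = (let K = gen GK; Ki = gen GKi; E = gen GE; F = gen GF in
     {Ki * K - 1, K * Ki - 1,
      K * E - cst q * E * K,
      K * F - cst (1 / q) * F * K,
      E * F - F * E - cst (lam q) * (cst \<mu> * K * K - cst \<nu> * Ki * Ki)})"

definition U_alg :: "real \<Rightarrow> real \<Rightarrow> real \<Rightarrow> U star_alg" where
  "U_alg q \<mu> \<nu> = presented u_star (u_rels q \<mu> \<nu>)"

definition U_gen :: "real \<Rightarrow> real \<Rightarrow> real \<Rightarrow> ugen \<Rightarrow> U" where
  "U_gen q \<mu> \<nu> g = pcls u_star (u_rels q \<mu> \<nu>) (gen g)"

text \<open>
  $\Delta_{\mu\nu}^{\upsilon}$.  The value on $F = E^*$ is the star of the value on $E$, as it is a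
  $*$-homomorphism.
\<close>

definition U_comul ::
    "real \<Rightarrow> real \<Rightarrow> real \<Rightarrow> real \<Rightarrow> U \<Rightarrow> ((U \<times> U) \<Rightarrow>\<^sub>0 complex) set" where
  "U_comul q \<mu> \<upsilon> \<nu> =
     (let A = U_alg q \<mu> \<upsilon>; B = U_alg q \<upsilon> \<nu>; T = tensor A B; t = tens A B;
          x = U_gen q \<mu> \<upsilon>; y = U_gen q \<upsilon> \<nu>;
          \<Delta>E = t (x GE) (y GK) \<oplus>\<^bsub>T\<^esub> t (x GKi) (y GE) in
      pres_lift T (\<lambda>g. case g of
          GK \<Rightarrow> t (x GK) (y GK)
        | GKi \<Rightarrow> t (x GKi) (y GKi)
        | GE \<Rightarrow> \<Delta>E
        | GF \<Rightarrow> star T \<Delta>E))"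

text \<open>$S_{\mu\nu} : U_q(\mu,\nu) \to U_q(\nu,\mu)$.\<close>

definition U_antipode :: "real \<Rightarrow> real \<Rightarrow> real \<Rightarrow> U \<Rightarrow> U" where
  "U_antipode q \<mu> \<nu> =
     (let A = U_alg q \<nu> \<mu>; x = U_gen q \<nu> \<mu> in
      pres_lift (opp_alg A) (\<lambda>g. case g of
          GK \<Rightarrow> x GKi
        | GKi \<Rightarrow> x GK
        | GE \<Rightarrow> complex_of_real (- q) \<odot>\<^bsub>A\<^esub> x GE
        | GF \<Rightarrow> complex_of_real (- 1 / q) \<odot>\<^bsub>A\<^esub> x GF))"

definition U_counit :: "U \<Rightarrow> complex" where
  "U_counit = pres_lift complex_alg (\<lambda>g. case g of GK \<Rightarrow> 1 | GKi \<Rightarrow> 1 | GE \<Rightarrow> 0 | GF \<Rightarrow> 0)"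

definition U_hopf :: "real \<Rightarrow> real \<Rightarrow> U hopf_star_alg" where
  "U_hopf q \<mu> = star_alg.extend (U_alg q \<mu> \<mu>)
     (hopf_star_alg.fields (U_comul q \<mu> \<mu> \<mu>) U_counit (U_antipode q \<mu> \<mu>))"

text \<open>The left Miyashita-Ulbrich action of $U_q(\mu)$ on $U_q(\mu,\nu)$.\<close>

definition MU_action :: "real \<Rightarrow> real \<Rightarrow> real \<Rightarrow> U \<Rightarrow> U \<Rightarrow> U" where
  "MU_action q \<mu> \<nu> x y =
     (let A = U_alg q \<mu> \<nu> in
      tensor_lift A (\<lambda>u v. u \<otimes>\<^bsub>A\<^esub> y \<otimes>\<^bsub>A\<^esub> U_antipode q \<nu> \<mu> v) (U_comul q \<mu> \<nu> \<mu> x))"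


section \<open>The algebras $A_{\mu\nu}^{\tau}$ and $B_{\mu\nu}^{\tau}$\<close>

definition casimir :: "real \<Rightarrow> real \<Rightarrow> real \<Rightarrow> U" where
  "casimir q \<mu> \<nu> =
     (let A = U_alg q \<mu> \<nu>; K = U_gen q \<mu> \<nu> GK; Ki = U_gen q \<mu> \<nu> GKi;
          E = U_gen q \<mu> \<nu> GE; F = U_gen q \<mu> \<nu> GF in
      E \<otimes>\<^bsub>A\<^esub> F \<oplus>\<^bsub>A\<^esub> complex_of_real ((lam q)\<^sup>2) \<odot>\<^bsub>A\<^esub>
        (complex_of_real (\<mu> / q) \<odot>\<^bsub>A\<^esub> (K \<otimes>\<^bsub>A\<^esub> K) \<oplus>\<^bsub>A\<^esub>
         complex_of_real (q * \<nu>) \<odot>\<^bsub>A\<^esub> (Ki \<otimes>\<^bsub>A\<^esub> Ki)))"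

definition A_ideal :: "real \<Rightarrow> real \<Rightarrow> real \<Rightarrow> real \<Rightarrow> U set" where
  "A_ideal q \<mu> \<nu> \<tau> =
     (let A = U_alg q \<mu> \<nu> in
      Idl\<^bsub>A\<^esub> {casimir q \<mu> \<nu> \<ominus>\<^bsub>A\<^esub> complex_of_real (\<tau> / q * (lam q)\<^sup>2) \<odot>\<^bsub>A\<^esub> \<one>\<^bsub>A\<^esub>})"

definition A_alg :: "real \<Rightarrow> real \<Rightarrow> real \<Rightarrow> real \<Rightarrow> U set star_alg" where
  "A_alg q \<mu> \<nu> \<tau> = quot_alg (U_alg q \<mu> \<nu>) (A_ideal q \<mu> \<nu> \<tau>)"

definition A_proj :: "real \<Rightarrow> real \<Rightarrow> real \<Rightarrow> real \<Rightarrow> U \<Rightarrow> U set" where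
  "A_proj q \<mu> \<nu> \<tau> y = A_ideal q \<mu> \<nu> \<tau> +>\<^bsub>U_alg q \<mu> \<nu>\<^esub> y"

text \<open>The action of $U_q(\mu)$ on $A_{\mu\nu}^{\tau}$ with $x \rhd \pi_\tau(y) = \pi_\tau(x \rhd y)$.\<close>

definition A_action :: "real \<Rightarrow> real \<Rightarrow> real \<Rightarrow> real \<Rightarrow> U \<Rightarrow> U set \<Rightarrow> U set" where
  "A_action q \<mu> \<nu> \<tau> x S = the_elem ((\<lambda>y. A_proj q \<mu> \<nu> \<tau> (MU_action q \<mu> \<nu> x y)) ` S)"

definition B_Z :: "real \<Rightarrow> real \<Rightarrow> real \<Rightarrow> real \<Rightarrow> U set" where
  "B_Z q \<mu> \<nu> \<tau> = A_proj q \<mu> \<nu> \<tau> (U_gen q \<mu> \<nu> GK \<otimes>\<^bsub>U_alg q \<mu> \<nu>\<^esub> U_gen q \<mu> \<nu> GK)"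

definition B_X :: "real \<Rightarrow> real \<Rightarrow> real \<Rightarrow> real \<Rightarrow> U set" where
  "B_X q \<mu> \<nu> \<tau> = complex_of_real (sqrt q * (1 / q - q)) \<odot>\<^bsub>A_alg q \<mu> \<nu> \<tau>\<^esub>
     A_proj q \<mu> \<nu> \<tau> (U_gen q \<mu> \<nu> GF \<otimes>\<^bsub>U_alg q \<mu> \<nu>\<^esub> U_gen q \<mu> \<nu> GK)"

definition B_alg :: "real \<Rightarrow> real \<Rightarrow> real \<Rightarrow> real \<Rightarrow> U set star_alg" where
  "B_alg q \<mu> \<nu> \<tau> = generated_star_subalg (A_alg q \<mu> \<nu> \<tau>)
     {B_Z q \<mu> \<nu> \<tau>,
      A_proj q \<mu> \<nu> \<tau> (U_gen q \<mu> \<nu> GK \<otimes>\<^bsub>U_alg q \<mu> \<nu>\<^esub> U_gen q \<mu> \<nu> GE)}"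


section \<open>The Hopf $*$-algebras $\mathrm{Pol}_q(\mu)$ for $\mu \in \{-1, 0, 1\}$\<close>

text \<open>
  All three are presented on the same four letters.  For $\mu = \pm 1$ these are the generators
  $a, b, c, d$ of $\mathrm{Pol}(SL_q(2,\mathbb{C}))$ with $a^* = d$ and $b^* = -q^{-1}\mu c$, hence
  $c^* = -q\mu b$.  For $\mu = 0$ the letters \<open>Pc\<close> and \<open>Pd\<close> stand for $b_0^*$ and $a_0^*$.
\<close>

datatype pgen = Pa | Pb | Pc | Pd

type_synonym P = "pgen free_alg set"

fun pol_star :: "real \<Rightarrow> real \<Rightarrow> pgen \<Rightarrow> pgen free_alg" where
  "pol_star q \<mu> Pa = gen Pd"
| "pol_star q \<mu> Pd = gen Pa"
| "pol_star q \<mu> Pb = (if \<mu> = 0 then gen Pc else cst (- \<mu> / q) * gen Pc)"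
| "pol_star q \<mu> Pc = (if \<mu> = 0 then gen Pb else cst (- q * \<mu>) * gen Pb)"

definition SL_rels :: "real \<Rightarrow> pgen free_alg set" where
  "SL_rels q = (let a = gen Pa; b = gen Pb; c = gen Pc; d = gen Pd in
     {a * b - cst q * b * a, a * c - cst q * c * a, b * d - cst q * d * b,
      c * d - cst q * d * c, b * c - c * b,
      d * a - cst (1 / q) * c * b - 1, a * d - cst q * b * c - 1})"

definition Pol0_rels :: "real \<Rightarrow> pgen free_alg set" where
  "Pol0_rels q = (let a = gen Pa; b = gen Pb; bs = gen Pc; as = gen Pd in
     {as * a - 1, a * as - 1, a * b - cst q * b * a, as * b - cst (1 / q) * b * as,
      b * bs - bs * b})"

text \<open>
  The relations of a universal $*$-algebra are imposed together with their adjoints; for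
  $\mu = \pm 1$ the ideal generated by the relations is already $*$-invariant.
\<close>

definition pol_rels :: "real \<Rightarrow> real \<Rightarrow> pgen free_alg set" where
  "pol_rels q \<mu> =
     (if \<mu> = 0 then Pol0_rels q \<union> star (free_star_alg (pol_star q \<mu>)) ` Pol0_rels q
      else SL_rels q)"

definition pol_alg :: "real \<Rightarrow> real \<Rightarrow> P star_alg" where
  "pol_alg q \<mu> = presented (pol_star q \<mu>) (pol_rels q \<mu>)"

definition pol_gen :: "real \<Rightarrow> real \<Rightarrow> pgen \<Rightarrow> P" where
  "pol_gen q \<mu> g = pcls (pol_star q \<mu>) (pol_rels q \<mu>) (gen g)"

definition pol_comul :: "real \<Rightarrow> real \<Rightarrow> P \<Rightarrow> ((P \<times> P) \<Rightarrow>\<^sub>0 complex) set" where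
  "pol_comul q \<mu> =
     (let A = pol_alg q \<mu>; T = tensor A A; t = tens A A; x = pol_gen q \<mu>;
          a = x Pa; b = x Pb; c = x Pc; d = x Pd in
      if \<mu> = 0 then
        pres_lift T (\<lambda>g. case g of
            Pa \<Rightarrow> t a a
          | Pb \<Rightarrow> t b a \<oplus>\<^bsub>T\<^esub> t (star A a) b
          | Pc \<Rightarrow> star T (t b a \<oplus>\<^bsub>T\<^esub> t (star A a) b)
          | Pd \<Rightarrow> star T (t a a))
      else
        pres_lift T (\<lambda>g. case g of
            Pa \<Rightarrow> t a a \<oplus>\<^bsub>T\<^esub> t c b
          | Pb \<Rightarrow> t b a \<oplus>\<^bsub>T\<^esub> t d b
          | Pc \<Rightarrow> t a c \<oplus>\<^bsub>T\<^esub> t c d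
          | Pd \<Rightarrow> t b c \<oplus>\<^bsub>T\<^esub> t d d))"

text \<open>
  Counit and antipode are determined by the comultiplication.  For instance
  $S(b)a + S(d)b = \varepsilon(b) = 0$ with $S(d) = a$ gives $S(b)a = -ab = -qba$.  In all three
  cases $S(a) = d$, $S(d) = a$, $S(b) = -qb$, $S(c) = -q^{-1}c$, where for $\mu = 0$ the letters
  $c, d$ are $b_0^*, a_0^*$.
\<close>

definition pol_counit :: "P \<Rightarrow> complex" where
  "pol_counit = pres_lift complex_alg (\<lambda>g. case g of Pa \<Rightarrow> 1 | Pb \<Rightarrow> 0 | Pc \<Rightarrow> 0 | Pd \<Rightarrow> 1)"

definition pol_antipode :: "real \<Rightarrow> real \<Rightarrow> P \<Rightarrow> P" where
  "pol_antipode q \<mu> =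
     (let A = pol_alg q \<mu>; x = pol_gen q \<mu> in
      pres_lift (opp_alg A) (\<lambda>g. case g of
          Pa \<Rightarrow> x Pd
        | Pb \<Rightarrow> complex_of_real (- q) \<odot>\<^bsub>A\<^esub> x Pb
        | Pc \<Rightarrow> complex_of_real (- 1 / q) \<odot>\<^bsub>A\<^esub> x Pc
        | Pd \<Rightarrow> x Pa))"

definition Pol_hopf :: "real \<Rightarrow> real \<Rightarrow> P hopf_star_alg" where
  "Pol_hopf q \<mu> = star_alg.extend (pol_alg q \<mu>)
     (hopf_star_alg.fields (pol_comul q \<mu>) pol_counit (pol_antipode q \<mu>))"

text \<open>
  The characterizing properties of the pairing $\langle\cdot,\cdot\rangle$ between $U_q(\mu)$ and
  $\mathrm{Pol}_q(\mu)$.  The generators meant here are $K, E, F$ and $a, a^*, b, b^*$; the values at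
  $K^{-1}$ follow, e.g. $\langle K^{-1}, a\rangle = q^{1/2}$.
\<close>

definition U_Pol_pairing :: "real \<Rightarrow> real \<Rightarrow> (U \<Rightarrow> P \<Rightarrow> complex) \<Rightarrow> bool" where
  "U_Pol_pairing q \<mu> pair \<longleftrightarrow>
     (let H = U_hopf q \<mu>; L = Pol_hopf q \<mu>;
          K = U_gen q \<mu> \<mu> GK; E = U_gen q \<mu> \<mu> GE; F = U_gen q \<mu> \<mu> GF;
          a = pol_gen q \<mu> Pa; b = pol_gen q \<mu> Pb; as = star L a; bs = star L b in
      hopf_star_pairing H L pair \<and> nondegenerate_pairing H L pair \<and>
      pair K a = complex_of_real (1 / sqrt q) \<and> pair K as = complex_of_real (sqrt q) \<and>
      pair K b = 0 \<and> pair K bs = 0 \<and>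
      pair E a = 0 \<and> pair E as = 0 \<and> pair E b = 1 \<and> pair E bs = 0 \<and>
      pair F a = 0 \<and> pair F as = 0 \<and> pair F b = 0 \<and>
      pair F (complex_of_real (- q) \<odot>\<^bsub>L\<^esub> bs) = 1)"

end

(*
  The coaction is recovered from the action by duality.  Call t in B (x) P a representative of y in
  A if applying the functional <., x> to the second leg of t gives x |> y for every x.  Since the
  pairing separates Pol_q(mu), representatives are unique.  Because A is a module *-algebra, the
  elements of A that have a representative form a *-subalgebra, so it suffices to exhibit
  representatives for Z and X^*; these are the formulas of the statement, and they are correct
  because the coefficients form a matrix corepresentation that has the right values on E, F and K.
  Hence gamma exists, no presentation of B is needed, and multiplicativity, *-compatibility and the
  comodule axioms all follow by pairing both sides with U_q(mu).
*)

theory Submission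
  imports Defs
begin

section \<open>Complex algebras and linear extensions\<close>

text \<open>Faithfulness of slices is available on one leg only: nondegeneracy lets U_q(\<mu>)
  separate the points of Pol_q(\<mu>), and neither leg comes with a basis. It is transferred to B
  \<otimes> P on finite sums, by absorbing a summand whose left factor is a combination of the
  others. Representatives are sought in B \<otimes> P although the action lives on A, so invariance
  of B follows from their existence instead of being an input. Products are represented by products
  because one comultiplication governs both sides: it is dual to multiplication in Pol_q(\<mu>) and
  it splits the action on a product. Stars match because both sides twist x into S(x)^*. The stated
  formulas give the matrix of x on the invariant span of 1, X, Z, X^*. Its invariance rests on two
  cancellations: the K^{-2} terms drop out, and the factor in front of F K in X absorbs the
  \<lambda>^2 of the Casimir relation. The three Hopf algebras are treated at once through relations
  in a, b, b^*, a^* that are polynomial in \<mu>; the case \<mu> = 0 is split off only in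
  translating from the given definitions.\<close>

locale complex_algebra = ring A for A :: "(complex, 'a, 'm) module_scheme" (structure) +
  assumes smult_closed [simp, intro]: "x \<in> carrier A \<Longrightarrow> c \<odot> x \<in> carrier A"
    and smult_add_left: "x \<in> carrier A \<Longrightarrow> (c + d) \<odot> x = c \<odot> x \<oplus> d \<odot> x"
    and smult_add_right: "x \<in> carrier A \<Longrightarrow> y \<in> carrier A \<Longrightarrow> c \<odot> (x \<oplus> y) = c \<odot> x \<oplus> c \<odot> y"
    and smult_smult [simp]: "x \<in> carrier A \<Longrightarrow> c \<odot> (d \<odot> x) = (c * d) \<odot> x"
    and smult_one [simp]: "x \<in> carrier A \<Longrightarrow> 1 \<odot> x = x"
    and mult_smult_left [simp]:
      "x \<in> carrier A \<Longrightarrow> y \<in> carrier A \<Longrightarrow> (c \<odot> x) \<otimes> y = c \<odot> (x \<otimes> y)"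
    and mult_smult_right [simp]:
      "x \<in> carrier A \<Longrightarrow> y \<in> carrier A \<Longrightarrow> x \<otimes> (c \<odot> y) = c \<odot> (x \<otimes> y)"

text \<open>Involutivity of the star is kept out of the axioms: \<open>free_star_alg s\<close> is to
  be an instance for every \<open>s\<close>, and its star squares to the identity only for suitable
  \<open>s\<close>. Where a double star occurs it is computed explicitly.\<close>

locale complex_star_algebra = complex_algebra A for A :: "('a, 'm) star_alg_scheme" (structure) +
  assumes star_closed [simp, intro]: "x \<in> carrier A \<Longrightarrow> star A x \<in> carrier A"
    and star_add [simp]:
      "x \<in> carrier A \<Longrightarrow> y \<in> carrier A \<Longrightarrow> star A (x \<oplus> y) = star A x \<oplus> star A y"
    and star_mult [simp]:
      "x \<in> carrier A \<Longrightarrow> y \<in> carrier A \<Longrightarrow> star A (x \<otimes> y) = star A y \<otimes> star A x"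
    and star_smult [simp]: "x \<in> carrier A \<Longrightarrow> star A (c \<odot> x) = cnj c \<odot> star A x"
    and star_one [simp]: "star A \<one> = \<one>"

definition alg_hom ::
    "(complex, 'a, 'm) module_scheme \<Rightarrow> (complex, 'b, 'n) module_scheme \<Rightarrow> ('a \<Rightarrow> 'b) \<Rightarrow> bool" where
  "alg_hom A B f \<longleftrightarrow> f \<in> ring_hom A B \<and> (\<forall>c. \<forall>x \<in> carrier A. f (c \<odot>\<^bsub>A\<^esub> x) = c \<odot>\<^bsub>B\<^esub> f x)"

lemma alg_homD:
  assumes "alg_hom A B f"
  shows "x \<in> carrier A \<Longrightarrow> f x \<in> carrier B"
    and "x \<in> carrier A \<Longrightarrow> y \<in> carrier A \<Longrightarrow> f (x \<oplus>\<^bsub>A\<^esub> y) = f x \<oplus>\<^bsub>B\<^esub> f y"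
    and "x \<in> carrier A \<Longrightarrow> y \<in> carrier A \<Longrightarrow> f (x \<otimes>\<^bsub>A\<^esub> y) = f x \<otimes>\<^bsub>B\<^esub> f y"
    and "f \<one>\<^bsub>A\<^esub> = \<one>\<^bsub>B\<^esub>"
    and "x \<in> carrier A \<Longrightarrow> f (c \<odot>\<^bsub>A\<^esub> x) = c \<odot>\<^bsub>B\<^esub> f x"
  using assms by (auto simp: alg_hom_def ring_hom_def)

abbreviation supp :: "('k \<Rightarrow>\<^sub>0 complex) \<Rightarrow> 'k set" where
  "supp \<equiv> Poly_Mapping.keys"

abbreviation scale :: "complex \<Rightarrow> ('k \<Rightarrow>\<^sub>0 complex) \<Rightarrow> 'k \<Rightarrow>\<^sub>0 complex" where
  "scale c \<equiv> Poly_Mapping.map ((*) c)"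

text \<open>Both \<open>free_eval\<close> and the map under \<open>the_elem\<close> in
  \<open>tensor_lift\<close> have this form, so one set of linearity lemmas serves presented
  algebras and tensor products.\<close>

definition lin_ext ::
    "(complex, 'a, 'm) module_scheme \<Rightarrow> ('k \<Rightarrow> 'a) \<Rightarrow> ('k \<Rightarrow>\<^sub>0 complex) \<Rightarrow> 'a" where
  "lin_ext A \<phi> f =
     (\<Oplus>\<^bsub>A\<^esub>k\<in>supp f. Poly_Mapping.lookup f k \<odot>\<^bsub>A\<^esub> \<phi> k)"

text \<open>Compares linear maps on formal sums term by term. The bound \<open>S\<close> on the
  support is carried along because in \<open>pre_tensor\<close> the algebra laws hold only for keys
  in the product of the carriers.\<close>

lemma poly_mapping_keys_induct [consumes 1, case_names zero single add]:
  fixes f :: "'k \<Rightarrow>\<^sub>0 complex"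
  assumes "supp f \<subseteq> S" and "P 0"
    and "\<And>k c. k \<in> S \<Longrightarrow> P (Poly_Mapping.single k c)"
    and "\<And>f g. supp f \<subseteq> S \<Longrightarrow> supp g \<subseteq> S \<Longrightarrow> P f \<Longrightarrow> P g \<Longrightarrow> P (f + g)"
  shows "P f"
  using assms(1)
proof (induction f rule: update_induct)
  case const
  show ?case by (rule assms(2))
next
  case (update f a b)
  have eq: "Poly_Mapping.update a b f = Poly_Mapping.single a b + f"
    using update(1) by (intro poly_mapping_eqI)
      (auto simp: lookup_update lookup_add lookup_single in_keys_iff "when_def")
  have "supp (Poly_Mapping.update a b f) = insert a (supp f)"
    using update(2) by (simp add: keys_update)
  with update(4) have "a \<in> S" "supp f \<subseteq> S" by auto
  with update show ?case by (simp add: eq assms(3,4))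
qed

lemma keys_single_subset: "k \<in> S \<Longrightarrow> supp (Poly_Mapping.single k c) \<subseteq> S"
  by auto

lemma keys_add_subset:
  "supp f \<subseteq> S \<Longrightarrow> supp g \<subseteq> S \<Longrightarrow> supp (f + g) \<subseteq> S"
  using keys_add[of f g] by auto

lemma keys_map_scale: "supp (scale c f) \<subseteq> supp f"
  by (auto simp: in_keys_iff map.rep_eq "when_def")

lemma lookup_map_scale:
  "Poly_Mapping.lookup (scale c f) k = c * Poly_Mapping.lookup f k"
  by (auto simp: map.rep_eq "when_def")

context complex_algebra
begin

lemma smult_zero_left [simp]: "x \<in> carrier A \<Longrightarrow> 0 \<odot> x = \<zero>"
  using smult_add_left[of x 0 0] by simp

lemma smult_zero_right [simp]: "c \<odot> \<zero> = \<zero>"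
  using smult_smult[of \<zero> c 0] smult_zero_left[of \<zero>] by simp

lemma minus_eq_smult: "x \<in> carrier A \<Longrightarrow> \<ominus> x = (- 1) \<odot> x"
  using smult_add_left[of x "- 1" 1] by (simp add: minus_equality)

lemma a_minus_eq_smult:
  "x \<in> carrier A \<Longrightarrow> y \<in> carrier A \<Longrightarrow> x \<ominus> y = x \<oplus> (- 1) \<odot> y"
  by (simp add: a_minus_def minus_eq_smult)

text \<open>Turns a defining relation, given as a difference equal to zero, into an equation that
  can be used for rewriting. A general \<open>z\<close> is allowed since relations with more than
  two terms need the rewrite more than once.\<close>

lemma minus_eq_iff:
  assumes "x \<in> carrier A" "y \<in> carrier A" "z \<in> carrier A"
  shows "x \<ominus> y = z \<longleftrightarrow> x = y \<oplus> z"
proof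
  assume "x \<ominus> y = z"
  then have "y \<oplus> z = y \<oplus> (x \<ominus> y)" by simp
  also have "\<dots> = x" using assms by (simp add: a_minus_def a_lcomm[of y x] r_neg)
  finally show "x = y \<oplus> z" by (rule sym)
next
  assume "x = y \<oplus> z"
  with assms show "x \<ominus> y = z" by (simp add: a_minus_def a_assoc a_comm[of z] r_neg2)
qed

lemma lin_ext_closed:
  "(\<And>k. k \<in> supp f \<Longrightarrow> \<phi> k \<in> carrier A) \<Longrightarrow> lin_ext A \<phi> f \<in> carrier A"
  by (auto simp: lin_ext_def intro!: finsum_closed)

text \<open>Keys outside the support have coefficient zero, so f, g and f + g can be summed over one
  common index set.\<close>

lemma lin_ext_superset:
  assumes "finite K" "supp f \<subseteq> K" "\<And>k. k \<in> K \<Longrightarrow> \<phi> k \<in> carrier A"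
  shows "lin_ext A \<phi> f = (\<Oplus>k\<in>K. Poly_Mapping.lookup f k \<odot> \<phi> k)"
  unfolding lin_ext_def using assms
  by (intro add.finprod_mono_neutral_cong_left) (auto simp: in_keys_iff)

lemma lin_ext_zero [simp]: "lin_ext A \<phi> 0 = \<zero>"
  by (simp add: lin_ext_def)

lemma lin_ext_single [simp]:
  "\<phi> k \<in> carrier A \<Longrightarrow> lin_ext A \<phi> (Poly_Mapping.single k c) = c \<odot> \<phi> k"
  by (subst lin_ext_superset[where K = "{k}"]) auto

lemma lin_ext_add:
  assumes "supp f \<subseteq> S" "supp g \<subseteq> S" "\<And>k. k \<in> S \<Longrightarrow> \<phi> k \<in> carrier A"
  shows "lin_ext A \<phi> (f + g) = lin_ext A \<phi> f \<oplus> lin_ext A \<phi> g"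
proof -
  let ?K = "supp f \<union> supp g"
  have \<phi>: "\<And>k. k \<in> ?K \<Longrightarrow> \<phi> k \<in> carrier A" using assms by auto
  have "lin_ext A \<phi> (f + g) = (\<Oplus>k\<in>?K. Poly_Mapping.lookup (f + g) k \<odot> \<phi> k)"
    using \<phi> keys_add[of f g] by (intro lin_ext_superset) auto
  also have "\<dots> = (\<Oplus>k\<in>?K. Poly_Mapping.lookup f k \<odot> \<phi> k \<oplus> Poly_Mapping.lookup g k \<odot> \<phi> k)"
    using \<phi> by (intro finsum_cong') (auto simp: lookup_add smult_add_left)
  also have "\<dots> = lin_ext A \<phi> f \<oplus> lin_ext A \<phi> g"
  proof (subst finsum_addf)
    show "(\<Oplus>k\<in>?K. Poly_Mapping.lookup f k \<odot> \<phi> k) \<oplus> (\<Oplus>k\<in>?K. Poly_Mapping.lookup g k \<odot> \<phi> k)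
        = lin_ext A \<phi> f \<oplus> lin_ext A \<phi> g"
      using lin_ext_superset[of ?K f \<phi>] lin_ext_superset[of ?K g \<phi>] \<phi> by simp
  qed (use \<phi> in auto)
  finally show ?thesis .
qed

lemma finsum_smult:
  "finite K \<Longrightarrow> (\<And>k. k \<in> K \<Longrightarrow> \<phi> k \<in> carrier A) \<Longrightarrow>
    (\<Oplus>k\<in>K. c \<odot> \<phi> k) = c \<odot> (\<Oplus>k\<in>K. \<phi> k)"
proof (induction K rule: finite_induct)
  case (insert k K)
  have "\<phi> \<in> K \<rightarrow> carrier A" "(\<lambda>k. c \<odot> \<phi> k) \<in> K \<rightarrow> carrier A" using insert by auto
  with insert show ?case by (simp add: smult_add_right)
qed simp

lemma lin_ext_smult:
  assumes "\<And>k. k \<in> supp f \<Longrightarrow> \<phi> k \<in> carrier A"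
  shows "lin_ext A \<phi> (scale c f) = c \<odot> lin_ext A \<phi> f"
proof -
  have "lin_ext A \<phi> (scale c f) =
      (\<Oplus>k\<in>supp f. c \<odot> (Poly_Mapping.lookup f k \<odot> \<phi> k))"
    using assms keys_map_scale[of c f]
    by (subst lin_ext_superset[where K = "supp f"])
       (auto simp: lookup_map_scale intro!: finsum_cong')
  also have "\<dots> = c \<odot> lin_ext A \<phi> f"
    using assms by (subst finsum_smult) (auto simp: lin_ext_def)
  finally show ?thesis .
qed

end

lemma complex_algebra_complex_alg: "complex_algebra complex_alg"
proof -
  have "ring complex_alg"
    unfolding complex_alg_def
    by (intro ringI abelian_groupI monoidI) (auto simp: algebra_simps intro: exI[of _ "- x" for x])
  then show ?thesis
    by (intro complex_algebra.intro complex_algebra_axioms.intro)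
       (simp_all add: complex_alg_def algebra_simps)
qed

interpretation CC: complex_algebra complex_alg
  by (rule complex_algebra_complex_alg)

lemma complex_alg_simps [simp]:
  "carrier complex_alg = UNIV" "x \<otimes>\<^bsub>complex_alg\<^esub> y = x * y" "x \<oplus>\<^bsub>complex_alg\<^esub> y = x + y"
  "\<one>\<^bsub>complex_alg\<^esub> = 1" "\<zero>\<^bsub>complex_alg\<^esub> = 0" "x \<odot>\<^bsub>complex_alg\<^esub> y = x * y"
  by (simp_all add: complex_alg_def)

text \<open>
  \<open>formal A x F\<close>: \<open>x\<close> is the value of a formal linear combination of elements of \<open>A\<close>, given
  as the function \<open>F\<close> that substitutes arbitrary numbers for these elements.  It reduces linear
  identities in \<open>A\<close> to identities between complex numbers.
\<close>

definition formal ::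
    "(complex, 'a, 'm) module_scheme \<Rightarrow> 'a \<Rightarrow> (('a \<Rightarrow> complex) \<Rightarrow> complex) \<Rightarrow> bool" where
  "formal A x F \<longleftrightarrow> (\<exists>p. supp p \<subseteq> carrier A \<and> lin_ext A (\<lambda>k. k) p = x \<and>
     F = (\<lambda>\<chi>. lin_ext complex_alg \<chi> p))"

context complex_algebra
begin

lemma formal_atom: "x \<in> carrier A \<Longrightarrow> formal A x (\<lambda>\<chi>. \<chi> x)"
  unfolding formal_def by (rule exI[of _ "Poly_Mapping.single x 1"]) simp

lemma formal_zero: "formal A \<zero> (\<lambda>\<chi>. 0)"
  unfolding formal_def by (rule exI[of _ 0]) simp

lemma formal_add:
  assumes "formal A x F" "formal A y G"
  shows "formal A (x \<oplus> y) (\<lambda>\<chi>. F \<chi> + G \<chi>)"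
proof -
  obtain p r where "supp p \<subseteq> carrier A" "lin_ext A (\<lambda>k. k) p = x"
    "F = (\<lambda>\<chi>. lin_ext complex_alg \<chi> p)" "supp r \<subseteq> carrier A"
    "lin_ext A (\<lambda>k. k) r = y" "G = (\<lambda>\<chi>. lin_ext complex_alg \<chi> r)"
    using assms unfolding formal_def by blast
  then show ?thesis unfolding formal_def
    by (intro exI[of _ "p + r"])
       (simp add: lin_ext_add[of p "carrier A" r] CC.lin_ext_add[of p UNIV r] keys_add_subset)
qed

lemma formal_smult:
  assumes "formal A x F"
  shows "formal A (c \<odot> x) (\<lambda>\<chi>. c * F \<chi>)"
proof -
  obtain p where p: "supp p \<subseteq> carrier A" "lin_ext A (\<lambda>k. k) p = x"
    "F = (\<lambda>\<chi>. lin_ext complex_alg \<chi> p)"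
    using assms unfolding formal_def by blast
  have "lin_ext A (\<lambda>k. k) (scale c p) = c \<odot> x"
    using p by (subst lin_ext_smult) auto
  with p show ?thesis unfolding formal_def
    using keys_map_scale[of c p]
    by (intro exI[of _ "scale c p"]) (auto simp: CC.lin_ext_smult)
qed

lemma formal_carrier: "formal A x F \<Longrightarrow> x \<in> carrier A"
  by (auto simp: formal_def intro!: lin_ext_closed)

lemma formal_neg: "formal A x F \<Longrightarrow> formal A (\<ominus> x) (\<lambda>\<chi>. - F \<chi>)"
  using formal_smult[of x F "- 1"] by (simp add: formal_carrier minus_eq_smult)

lemma formal_minus: "formal A x F \<Longrightarrow> formal A y G \<Longrightarrow> formal A (x \<ominus> y) (\<lambda>\<chi>. F \<chi> - G \<chi>)"
  using formal_add[OF _ formal_neg, of x F y G] by (simp add: a_minus_def)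

lemmas formal_intros = formal_add formal_smult formal_minus formal_neg formal_zero formal_atom

text \<open>Taking for \<chi> the indicator function of k reads off the coefficient at k, so the two
  formal sums agree even before they are evaluated in \<open>A\<close>. As \<chi> need not be
  linear, distinct monomials behave like independent variables; any relation between them has to be
  applied beforehand.\<close>

lemma lin_eqI:
  assumes "formal A x F" "formal A y G" "\<And>\<chi>. F \<chi> = G \<chi>"
  shows "x = y"
proof -
  obtain p r where p: "supp p \<subseteq> carrier A" "lin_ext A (\<lambda>k. k) p = x"
    "F = (\<lambda>\<chi>. lin_ext complex_alg \<chi> p)" and r: "supp r \<subseteq> carrier A"
    "lin_ext A (\<lambda>k. k) r = y" "G = (\<lambda>\<chi>. lin_ext complex_alg \<chi> r)"
    using assms(1,2) unfolding formal_def by blast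
  have *: "lin_ext complex_alg (\<lambda>j. if j = k then 1 else 0) s = Poly_Mapping.lookup s k"
    for s :: "'a \<Rightarrow>\<^sub>0 complex" and k
    by (rule poly_mapping_keys_induct[of s UNIV])
       (auto simp: CC.lin_ext_add[of _ UNIV] lookup_add lookup_single "when_def")
  have "p = r"
  proof (rule poly_mapping_eqI)
    fix k
    show "Poly_Mapping.lookup p k = Poly_Mapping.lookup r k"
      using assms(3)[of "\<lambda>j. if j = k then 1 else 0"] unfolding p(3) r(3) * .
  qed
  with p(2) r(2) show ?thesis by simp
qed

lemma complex_algebra_opp: "complex_algebra (opp_alg A)"
proof -
  have "ring (opp_alg A)"
    unfolding opp_alg_def
    by (intro ringI abelian_groupI monoidI; simp add: m_assoc l_distr r_distr a_ac)
  then show ?thesis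
    by (intro complex_algebra.intro complex_algebra_axioms.intro)
       (simp_all add: opp_alg_def smult_add_left smult_add_right)
qed

lemma complex_algebra_conj: "complex_algebra (conj_alg A)"
proof -
  have "ring (conj_alg A)"
    unfolding conj_alg_def
    by (intro ringI abelian_groupI monoidI; simp add: m_assoc l_distr r_distr a_ac)
  then show ?thesis
    by (intro complex_algebra.intro complex_algebra_axioms.intro)
       (simp_all add: conj_alg_def smult_add_left smult_add_right)
qed

end

section \<open>Quotients and presented algebras\<close>

locale star_ideal = complex_star_algebra A + ideal I A for I and A (structure) +
  assumes star_mem: "x \<in> I \<Longrightarrow> star A x \<in> I"
begin

lemma smult_mem:
  assumes "x \<in> I"
  shows "c \<odot> x \<in> I"
proof -
  have "(c \<odot> \<one>) \<otimes> x \<in> I" using assms by (intro I_l_closed) auto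
  then show ?thesis using Icarr[OF assms] by simp
qed

lemma coset_eq_iff:
  "x \<in> carrier A \<Longrightarrow> y \<in> carrier A \<Longrightarrow> I +> x = I +> y \<longleftrightarrow> x \<ominus> y \<in> I"
  using quotient_eq_iff_same_a_r_cos[OF is_ideal, of x y] by simp

lemma coset_elem:
  assumes "x' \<in> I +> x" "x \<in> carrier A"
  shows "x' \<in> carrier A" "I +> x' = I +> x"
proof -
  have "I +> x = I +> x'" by (rule a_repr_independence[OF assms a_subgroup])
  then show "I +> x' = I +> x" by (rule sym)
  show "x' \<in> carrier A" using a_r_coset_subset_G[OF a_subset assms(2)] assms(1) by blast
qed

text \<open>Scalar multiple and star of a coset are defined as unions over its representatives; if
  all representatives contribute the same coset, the union is that coset.\<close>

lemma coset_congI: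
  assumes "x \<in> carrier A" "\<And>y. y \<in> carrier A \<Longrightarrow> I +> y = I +> x \<Longrightarrow> F y = F x"
  shows "(\<Union>y\<in>I +> x. F y) = F x"
proof -
  have "F y = F x" if "y \<in> I +> x" for y
    by (rule assms(2)[OF coset_elem[OF that assms(1)]])
  then have "(\<Union>y\<in>I +> x. F y) = (\<Union>y\<in>I +> x. F x)" by (rule SUP_cong[OF refl])
  also have "\<dots> = F x" using a_rcos_self[OF assms(1)] by blast
  finally show ?thesis .
qed

lemma quot_carrier: "carrier (quot_alg A I) = (\<lambda>x. I +> x) ` carrier A"
  by (auto simp: quot_alg_def FactRing_def A_RCOSETS_def')

lemma quot_mem [intro]: "x \<in> carrier A \<Longrightarrow> I +> x \<in> carrier (quot_alg A I)"
  by (auto simp: quot_carrier)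

lemma quot_mult [simp]:
  "x \<in> carrier A \<Longrightarrow> y \<in> carrier A \<Longrightarrow> (I +> x) \<otimes>\<^bsub>quot_alg A I\<^esub> (I +> y) = I +> (x \<otimes> y)"
  by (simp add: quot_alg_def FactRing_def rcoset_mult_add)

lemma quot_add [simp]:
  "x \<in> carrier A \<Longrightarrow> y \<in> carrier A \<Longrightarrow> (I +> x) \<oplus>\<^bsub>quot_alg A I\<^esub> (I +> y) = I +> (x \<oplus> y)"
  by (simp add: quot_alg_def FactRing_def a_rcos_sum)

lemma quot_one: "\<one>\<^bsub>quot_alg A I\<^esub> = I +> \<one>"
  by (simp add: quot_alg_def FactRing_def)

lemma quot_zero: "\<zero>\<^bsub>quot_alg A I\<^esub> = I +> \<zero>"
  by (simp add: quot_alg_def FactRing_def a_subset)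

lemma quot_smult [simp]:
  assumes "x \<in> carrier A"
  shows "c \<odot>\<^bsub>quot_alg A I\<^esub> (I +> x) = I +> (c \<odot> x)"
proof -
  have "I +> c \<odot> y = I +> c \<odot> x" if "y \<in> carrier A" "I +> y = I +> x" for y
  proof -
    have "c \<odot> (y \<ominus> x) \<in> I" using that assms by (intro smult_mem) (simp flip: coset_eq_iff)
    also have "c \<odot> (y \<ominus> x) = c \<odot> y \<ominus> c \<odot> x"
      using that assms by (simp add: a_minus_eq_smult smult_add_right)
    finally show ?thesis using that assms by (simp add: coset_eq_iff)
  qed
  then have "(\<Union>y\<in>I +> x. I +> c \<odot> y) = I +> c \<odot> x"
    by (intro coset_congI assms)
  then show ?thesis by (simp add: quot_alg_def)
qed

lemma quot_star [simp]:
  assumes "x \<in> carrier A"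
  shows "star (quot_alg A I) (I +> x) = I +> star A x"
proof -
  have "I +> star A y = I +> star A x" if "y \<in> carrier A" "I +> y = I +> x" for y
  proof -
    have "star A (y \<ominus> x) \<in> I" using that assms by (intro star_mem) (simp flip: coset_eq_iff)
    also have "star A (y \<ominus> x) = star A y \<ominus> star A x"
      using that assms by (simp add: a_minus_eq_smult)
    finally show ?thesis using that assms by (simp add: coset_eq_iff)
  qed
  then have "(\<Union>y\<in>I +> x. I +> star A y) = I +> star A x"
    by (intro coset_congI assms)
  then show ?thesis by (simp add: quot_alg_def)
qed

lemma quot_algebra: "complex_star_algebra (quot_alg A I)"
proof -
  have "ring (quot_alg A I)"
  proof (intro ringI abelian_groupI monoidI)
    fix x assume "x \<in> carrier (quot_alg A I)"
    then obtain y where y: "y \<in> carrier A" "x = I +> y" by (auto simp: quot_carrier)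
    then have "(I +> \<ominus> y) \<oplus>\<^bsub>quot_alg A I\<^esub> x = \<zero>\<^bsub>quot_alg A I\<^esub>"
      by (simp add: l_neg quot_zero)
    moreover have "I +> \<ominus> y \<in> carrier (quot_alg A I)" using y by (intro quot_mem) simp
    ultimately show "\<exists>y\<in>carrier (quot_alg A I). y \<oplus>\<^bsub>quot_alg A I\<^esub> x = \<zero>\<^bsub>quot_alg A I\<^esub>"
      by blast
  qed (auto simp: quot_carrier quot_one quot_zero m_assoc l_distr r_distr a_ac)
  then show ?thesis
    by (intro complex_star_algebra.intro complex_algebra.intro complex_algebra_axioms.intro
          complex_star_algebra_axioms.intro)
       (auto simp: quot_carrier quot_one smult_add_left smult_add_right)
qed

lemma quot_hom: "alg_hom A (quot_alg A I) (\<lambda>x. I +> x)"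
  by (auto simp: alg_hom_def quot_one intro!: ring_hom_memI)

end

text \<open>The preimage of a two-sided ideal under an antimultiplicative map is again a two-sided
  ideal, so star-invariance has to be checked on the generators only.\<close>

lemma (in complex_star_algebra) star_ideal_genideal:
  assumes "R \<subseteq> carrier A" "\<And>r. r \<in> R \<Longrightarrow> star A r \<in> Idl R"
  shows "star_ideal (Idl R) A"
proof -
  interpret I: ideal "Idl R" A by (rule genideal_ideal) fact
  have star_zero: "star A \<zero> = \<zero>" using star_smult[of \<zero> 0] by simp
  let ?J = "{x \<in> carrier A. star A x \<in> Idl R}"
  have neg: "star A (\<ominus> x) = \<ominus> star A x" if "x \<in> carrier A" for x
    using that by (simp add: minus_eq_smult)
  have "ideal ?J A"
  proof (rule idealI)
    show "subgroup ?J (add_monoid A)"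
      by (rule add.subgroupI) (auto simp: star_zero neg intro: exI[of _ \<zero>])
  qed (auto simp: ring_axioms I.I_l_closed I.I_r_closed)
  then have "Idl R \<subseteq> ?J"
    using assms by (intro genideal_minimal) auto
  then show ?thesis
    by (intro star_ideal.intro star_ideal_axioms.intro complex_star_algebra_axioms I.is_ideal) auto
qed

section \<open>Free algebras: evaluation homomorphism and star\<close>

lemma free_algebra_simps [simp]:
  "carrier free_algebra = UNIV" "x \<otimes>\<^bsub>free_algebra\<^esub> y = x * y" "x \<oplus>\<^bsub>free_algebra\<^esub> y = x + y"
  "\<one>\<^bsub>free_algebra\<^esub> = 1" "\<zero>\<^bsub>free_algebra\<^esub> = 0"
  by (simp_all add: free_algebra_def)

lemma free_algebra_smult: "c \<odot>\<^bsub>free_algebra\<^esub> f = Poly_Mapping.single 0 c * f"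
  by (simp add: free_algebra_def mult_map_scale_conv_mult)

text \<open>The key 0 is the empty word, so \<open>Poly_Mapping.single 0 c\<close> is the scalar c,
  which is central although the algebra is not commutative.\<close>

lemma single_zero_commute:
  "f * Poly_Mapping.single 0 c = Poly_Mapping.single 0 c * (f :: 'g free_alg)"
  by (rule poly_mapping_keys_induct[of f UNIV]) (auto simp: mult_single algebra_simps)

lemma single_mult_left_commute:
  "f * (Poly_Mapping.single 0 c * g) = Poly_Mapping.single 0 c * (f * (g :: 'g free_alg))"
  by (metis mult.assoc single_zero_commute)

lemma single_zero_mult_assoc:
  "Poly_Mapping.single 0 c * (Poly_Mapping.single 0 d * f) =
    Poly_Mapping.single 0 (c * d) * (f :: 'g free_alg)"
  by (simp add: mult_single flip: mult.assoc)

lemma complex_algebra_free: "complex_algebra (free_algebra :: (complex, 'g free_alg) module)"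
proof -
  have "ring (free_algebra :: (complex, 'g free_alg) module)"
  proof (intro ringI abelian_groupI monoidI)
    fix x :: "'g free_alg"
    show "\<exists>y\<in>carrier free_algebra. y \<oplus>\<^bsub>free_algebra\<^esub> x = \<zero>\<^bsub>free_algebra\<^esub>"
      by (rule bexI[of _ "- x"]) simp_all
  qed (simp_all add: ac_simps distrib_left distrib_right)
  then show ?thesis
    by (intro complex_algebra.intro complex_algebra_axioms.intro)
       (auto simp: free_algebra_smult distrib_left distrib_right single_add mult.assoc
          single_zero_mult_assoc intro: single_mult_left_commute)
qed

context complex_algebra
begin

abbreviation word_eval :: "('g \<Rightarrow> 'a) \<Rightarrow> 'g free_monoid \<Rightarrow> 'a" where
  "word_eval v w \<equiv> foldr (\<lambda>g x. v g \<otimes> x) (letters w) \<one>"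

lemma free_eval_eq: "free_eval A v = lin_ext A (word_eval v)"
  by (auto simp: free_eval_def lin_ext_def)

lemma word_eval_closed: "(\<And>g. v g \<in> carrier A) \<Longrightarrow> word_eval v w \<in> carrier A"
proof -
  assume v: "\<And>g. v g \<in> carrier A"
  have "foldr (\<lambda>g x. v g \<otimes> x) xs \<one> \<in> carrier A" for xs by (induction xs) (auto simp: v)
  then show ?thesis .
qed

lemma word_eval_add:
  assumes v: "\<And>g. v g \<in> carrier A"
  shows "word_eval v (u + w) = word_eval v u \<otimes> word_eval v w"
proof -
  have "foldr (\<lambda>g x. v g \<otimes> x) xs (word_eval v w) = foldr (\<lambda>g x. v g \<otimes> x) xs \<one> \<otimes> word_eval v w
      \<and> foldr (\<lambda>g x. v g \<otimes> x) xs \<one> \<in> carrier A" for xs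
    by (induction xs) (auto simp: v word_eval_closed m_assoc)
  then show ?thesis by (simp add: plus_free_monoid_def)
qed

text \<open>Multiplicativity reduces to concatenation of words: both sides are additive in each
  factor, so the right factor is decomposed first, against a single word, and then the left
  one.\<close>

lemma free_eval_hom:
  assumes v: "\<And>g. v g \<in> carrier A"
  shows "alg_hom free_algebra A (free_eval A v)"
proof -
  note wc = word_eval_closed[of v, OF v]
  have closed: "free_eval A v f \<in> carrier A" for f
    by (simp add: free_eval_eq lin_ext_closed wc)
  have add: "free_eval A v (f + g) = free_eval A v f \<oplus> free_eval A v g" for f g
    by (simp add: free_eval_eq lin_ext_add[of _ UNIV] wc)
  have single: "free_eval A v (Poly_Mapping.single w c) = c \<odot> word_eval v w" for w c
    by (simp add: free_eval_eq wc)
  have zero: "free_eval A v 0 = \<zero>" by (simp add: free_eval_eq)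
  have mult1: "free_eval A v (Poly_Mapping.single w c * g) = (c \<odot> word_eval v w) \<otimes> free_eval A v g"
    for w c g
    by (rule poly_mapping_keys_induct[of g UNIV])
       (auto simp: zero mult_single single wc word_eval_add v add distrib_left closed r_distr mult.commute)
  have "free_eval A v (f * g) = free_eval A v f \<otimes> free_eval A v g" for f g
    by (rule poly_mapping_keys_induct[of f UNIV])
       (auto simp: zero mult1 single wc add distrib_right closed l_distr)
  moreover have "free_eval A v 1 = \<one>"
    by (simp flip: single_one add: single zero_free_monoid_def)
  moreover have "free_eval A v (c \<odot>\<^bsub>free_algebra\<^esub> f) = c \<odot> free_eval A v f" for c f
    by (simp add: free_algebra_def free_eval_eq lin_ext_smult wc)
  ultimately show ?thesis
    unfolding alg_hom_def by (auto intro!: ring_hom_memI simp: closed add)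
qed

lemma free_eval_simps:
  assumes v: "\<And>g. v g \<in> carrier A"
  shows "free_eval A v f \<in> carrier A"
    and "free_eval A v (f + g) = free_eval A v f \<oplus> free_eval A v g"
    and "free_eval A v (f - g) = free_eval A v f \<ominus> free_eval A v g"
    and "free_eval A v (- f) = \<ominus> free_eval A v f"
    and "free_eval A v (f * g) = free_eval A v f \<otimes> free_eval A v g"
    and "free_eval A v 0 = \<zero>"
    and "free_eval A v 1 = \<one>"
    and "free_eval A v (Poly_Mapping.single 0 c) = c \<odot> \<one>"
    and "free_eval A v (cst r) = complex_of_real r \<odot> \<one>"
    and "free_eval A v (gen x) = v x"
proof -
  note hom = alg_homD[OF free_eval_hom[of v, OF v], simplified]
  show add: "free_eval A v (f + g) = free_eval A v f \<oplus> free_eval A v g" for f g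
    by (rule hom)
  show closed: "free_eval A v f \<in> carrier A" for f by (rule hom)
  show "free_eval A v (f * g) = free_eval A v f \<otimes> free_eval A v g" by (rule hom)
  show one: "free_eval A v 1 = \<one>" by (rule hom)
  have smult: "free_eval A v (Poly_Mapping.single 0 c * f) = c \<odot> free_eval A v f" for c f
    using hom(5)[of c f] by (simp add: free_algebra_smult)
  show single: "free_eval A v (Poly_Mapping.single 0 c) = c \<odot> \<one>" for c
    using smult[of c 1] by (simp add: one)
  then show "free_eval A v (cst r) = complex_of_real r \<odot> \<one>" by (simp add: cst_def)
  show neg: "free_eval A v (- f) = \<ominus> free_eval A v f" for f
    using smult[of "- 1" f] by (simp add: minus_eq_smult closed single_uminus)
  show "free_eval A v (f - g) = free_eval A v f \<ominus> free_eval A v g"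
    using add[of f "- g"] by (simp add: neg a_minus_def)
  show "free_eval A v 0 = \<zero>" by (simp add: free_eval_eq)
  show "free_eval A v (gen x) = v x"
    using v by (simp add: gen_def free_eval_eq)
qed

end

lemma free_star_alg_simps [simp]:
  "carrier (free_star_alg s) = UNIV" "x \<otimes>\<^bsub>free_star_alg s\<^esub> y = x * y"
  "x \<oplus>\<^bsub>free_star_alg s\<^esub> y = x + y" "\<one>\<^bsub>free_star_alg s\<^esub> = 1" "\<zero>\<^bsub>free_star_alg s\<^esub> = 0"
  "c \<odot>\<^bsub>free_star_alg s\<^esub> x = Poly_Mapping.single 0 c * x"
  by (simp_all add: free_star_alg_def module.defs star_alg.defs free_algebra_smult)

lemma free_star_eq: "star (free_star_alg s) = free_eval (conj_alg (opp_alg free_algebra)) s"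
  by (simp add: free_star_alg_def module.defs star_alg.defs)

text \<open>The star is an evaluation in the conjugate of the opposite algebra, so the universal
  property of evaluation already delivers reversed products and conjugated scalars.\<close>

lemma star_free_star_alg [simp]:
  "star (free_star_alg s) (f + g) = star (free_star_alg s) f + star (free_star_alg s) g"
  "star (free_star_alg s) (f - g) = star (free_star_alg s) f - star (free_star_alg s) g"
  "star (free_star_alg s) (f * g) = star (free_star_alg s) g * star (free_star_alg s) f"
  "star (free_star_alg s) 1 = 1"
  "star (free_star_alg s) (Poly_Mapping.single 0 c) = Poly_Mapping.single 0 (cnj c)"
  "star (free_star_alg s) (cst r) = cst r"
  "star (free_star_alg s) (gen x) = s x"
proof -
  interpret F: complex_algebra free_algebra by (rule complex_algebra_free)
  interpret O: complex_algebra "opp_alg free_algebra" by (rule F.complex_algebra_opp)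
  interpret C: complex_algebra "conj_alg (opp_alg free_algebra)" by (rule O.complex_algebra_conj)
  have [simp]: "carrier (conj_alg (opp_alg free_algebra)) = UNIV"
    "x \<otimes>\<^bsub>conj_alg (opp_alg free_algebra)\<^esub> y = y * x"
    "x \<oplus>\<^bsub>conj_alg (opp_alg free_algebra)\<^esub> y = x + y"
    "\<one>\<^bsub>conj_alg (opp_alg free_algebra)\<^esub> = 1"
    "c \<odot>\<^bsub>conj_alg (opp_alg free_algebra)\<^esub> x = Poly_Mapping.single 0 (cnj c) * x"
    for x y :: "'a free_alg" and c
    by (simp_all add: conj_alg_def opp_alg_def free_algebra_smult)
  have m: "x \<ominus>\<^bsub>conj_alg (opp_alg free_algebra)\<^esub> y = x - y" for x y :: "'a free_alg"
    by (simp add: C.a_minus_eq_smult single_uminus)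
  note e = C.free_eval_simps[of s, simplified]
  show "star (free_star_alg s) (f + g) = star (free_star_alg s) f + star (free_star_alg s) g"
    "star (free_star_alg s) (f - g) = star (free_star_alg s) f - star (free_star_alg s) g"
    "star (free_star_alg s) (f * g) = star (free_star_alg s) g * star (free_star_alg s) f"
    "star (free_star_alg s) 1 = 1"
    "star (free_star_alg s) (Poly_Mapping.single 0 c) = Poly_Mapping.single 0 (cnj c)"
    "star (free_star_alg s) (cst r) = cst r"
    "star (free_star_alg s) (gen x) = s x"
    by (simp_all add: free_star_eq e m cst_def)
qed

lemma complex_star_algebra_free:
  fixes s :: "'g \<Rightarrow> 'g free_alg"
  shows "complex_star_algebra (free_star_alg s)"
proof -
  have "ring (free_star_alg s)"
  proof (intro ringI abelian_groupI monoidI)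
    fix x :: "'g free_alg"
    show "\<exists>y\<in>carrier (free_star_alg s). y \<oplus>\<^bsub>free_star_alg s\<^esub> x = \<zero>\<^bsub>free_star_alg s\<^esub>"
      by (rule bexI[of _ "- x"]) simp_all
  qed (simp_all add: ac_simps distrib_left distrib_right)
  then show ?thesis
    by (intro complex_star_algebra.intro complex_algebra.intro complex_algebra_axioms.intro
          complex_star_algebra_axioms.intro)
       (auto simp: distrib_left distrib_right single_add mult.assoc
          single_zero_mult_assoc intro: single_mult_left_commute single_zero_commute)
qed

section \<open>Presented star-algebras and their universal property\<close>

lemma single_Nil: "Poly_Mapping.single (FM []) 1 = (1 :: 'g free_alg)"
  by (metis single_one zero_free_monoid_def)

locale star_presentation =
  fixes s :: "'g \<Rightarrow> 'g free_alg" and R :: "'g free_alg set"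
  assumes star_rels: "\<And>r. r \<in> R \<Longrightarrow> star (free_star_alg s) r \<in> Idl\<^bsub>free_star_alg s\<^esub> R"

sublocale star_presentation \<subseteq> star_ideal "Idl\<^bsub>free_star_alg s\<^esub> R" "free_star_alg s"
proof -
  interpret complex_star_algebra "free_star_alg s" by (rule complex_star_algebra_free)
  show "star_ideal (Idl\<^bsub>free_star_alg s\<^esub> R) (free_star_alg s)"
    by (rule star_ideal_genideal) (auto simp: star_rels)
qed

context star_presentation
begin

abbreviation "cls \<equiv> pcls s R"

sublocale Q: complex_star_algebra "presented s R"
  unfolding presented_def by (rule quot_algebra)

lemma cls_simps:
  "cls f \<otimes>\<^bsub>presented s R\<^esub> cls g = cls (f * g)" "cls f \<oplus>\<^bsub>presented s R\<^esub> cls g = cls (f + g)"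
  "c \<odot>\<^bsub>presented s R\<^esub> cls f = cls (Poly_Mapping.single 0 c * f)"
  "star (presented s R) (cls f) = cls (star (free_star_alg s) f)"
  "\<one>\<^bsub>presented s R\<^esub> = cls 1" "\<zero>\<^bsub>presented s R\<^esub> = cls 0"
  by (simp_all add: presented_def pcls_def quot_one quot_zero)

lemma cls_carrier [simp, intro]: "cls f \<in> carrier (presented s R)"
  by (auto simp: presented_def pcls_def)

lemma carrier_presented: "carrier (presented s R) = range cls"
  by (auto simp: presented_def pcls_def quot_carrier)

lemma cls_eq_iff: "cls f = cls g \<longleftrightarrow> f - g \<in> Idl\<^bsub>free_star_alg s\<^esub> R"
proof -
  have "f \<ominus>\<^bsub>free_star_alg s\<^esub> g = f - g" by (simp add: a_minus_eq_smult single_uminus)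
  then show ?thesis unfolding pcls_def by (subst coset_eq_iff) auto
qed

text \<open>Makes relations usable inside the quotient: evaluating a relation at the classes of the
  generators gives its own class, which is zero.\<close>

lemma cls_eq_free_eval: "cls f = free_eval (presented s R) (\<lambda>g. cls (gen g)) f"
proof (rule poly_mapping_keys_induct[of f UNIV])
  note [simp] = Q.free_eval_simps[of "\<lambda>g. cls (gen g)"]
  show "cls 0 = free_eval (presented s R) (\<lambda>g. cls (gen g)) 0" by (simp add: cls_simps)
  have *: "cls (Poly_Mapping.single (FM xs) 1) = free_eval (presented s R) (\<lambda>g. cls (gen g)) (Poly_Mapping.single (FM xs) 1)" for xs
  proof (induction xs)
    case Nil
    show ?case by (simp add: single_Nil flip: cls_simps)
  next
    case (Cons x xs)
    have "Poly_Mapping.single (FM (x # xs)) 1 = gen x * Poly_Mapping.single (FM xs) (1::complex)"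
      by (simp add: gen_def mult_single plus_free_monoid_def)
    with Cons show ?case by (simp flip: cls_simps)
  qed
  show "cls (Poly_Mapping.single w c) = free_eval (presented s R) (\<lambda>g. cls (gen g)) (Poly_Mapping.single w c)" for w c
  proof -
    have eq: "Poly_Mapping.single w c = Poly_Mapping.single 0 c * Poly_Mapping.single w 1"
      by (simp add: mult_single)
    have "cls (Poly_Mapping.single w c) = c \<odot>\<^bsub>presented s R\<^esub> cls (Poly_Mapping.single w 1)"
      by (simp add: cls_simps mult_single)
    also have "\<dots> = free_eval (presented s R) (\<lambda>g. cls (gen g)) (Poly_Mapping.single w c)"
      unfolding eq using *[of "letters w"] by simp
    finally show ?thesis .
  qed
qed (auto simp: Q.free_eval_simps simp flip: cls_simps)

lemma cls_rel: "r \<in> R \<Longrightarrow> free_eval (presented s R) (\<lambda>g. cls (gen g)) r = \<zero>\<^bsub>presented s R\<^esub>"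
  using genideal_self[of R] by (auto simp flip: cls_eq_free_eval simp: cls_simps cls_eq_iff)

lemma presented_induct [consumes 1, case_names one gen smult add mult]:
  assumes "x \<in> carrier (presented s R)"
    and "P \<one>\<^bsub>presented s R\<^esub>" "\<And>g. P (cls (gen g))"
    and "\<And>c x. x \<in> carrier (presented s R) \<Longrightarrow> P x \<Longrightarrow> P (c \<odot>\<^bsub>presented s R\<^esub> x)"
    and "\<And>x y. x \<in> carrier (presented s R) \<Longrightarrow> y \<in> carrier (presented s R) \<Longrightarrow>
      P x \<Longrightarrow> P y \<Longrightarrow> P (x \<oplus>\<^bsub>presented s R\<^esub> y)"
    and "\<And>x y. x \<in> carrier (presented s R) \<Longrightarrow> y \<in> carrier (presented s R) \<Longrightarrow>
      P x \<Longrightarrow> P y \<Longrightarrow> P (x \<otimes>\<^bsub>presented s R\<^esub> y)"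
  shows "P x"
proof -
  obtain f where x: "x = cls f" using assms(1) by (auto simp: carrier_presented)
  have word: "P (cls (Poly_Mapping.single (FM xs) 1))" for xs
  proof (induction xs)
    case Nil
    show ?case using assms(2) by (simp add: single_Nil cls_simps)
  next
    case (Cons x xs)
    have "Poly_Mapping.single (FM (x # xs)) 1 = gen x * Poly_Mapping.single (FM xs) (1::complex)"
      by (simp add: gen_def mult_single plus_free_monoid_def)
    with Cons show ?case using assms(6)[OF _ _ assms(3) Cons, of x] by (simp add: cls_simps)
  qed
  have single: "P (cls (Poly_Mapping.single w c))" for w c
    using assms(4)[OF _ word[of "letters w"], of c] by (simp add: cls_simps mult_single)
  have "P (cls f)"
    by (rule poly_mapping_keys_induct[of f UNIV])
       (use single[of 0 0] single assms(5) in \<open>auto simp flip: cls_simps\<close>)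
  then show ?thesis by (simp add: x)
qed

text \<open>The elements that \<open>v\<close> evaluates to zero form an ideal containing the
  relations. Hence evaluation is constant on each coset, and \<open>the_elem\<close> in
  \<open>pres_lift\<close> is applied to a singleton.\<close>

lemma pres_lift_cls:
  assumes "complex_algebra B" and v: "\<And>g. v g \<in> carrier B"
    and rels: "\<And>r. r \<in> R \<Longrightarrow> free_eval B v r = \<zero>\<^bsub>B\<^esub>"
  shows "pres_lift B v (cls f) = free_eval B v f"
proof -
  interpret B: complex_algebra B by fact
  note [simp] = B.free_eval_simps[of v, OF v]
  let ?K = "{f. free_eval B v f = \<zero>\<^bsub>B\<^esub>}"
  have neg: "\<ominus>\<^bsub>free_star_alg s\<^esub> f = - f" for f :: "'g free_alg"
    by (simp add: minus_eq_smult single_uminus)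
  have "ideal ?K (free_star_alg s)"
  proof (rule idealI)
    show "subgroup ?K (add_monoid (free_star_alg s))"
    proof (rule add.subgroupI)
      show "?K \<noteq> {}" using B.free_eval_simps(6)[of v, OF v] by blast
    qed (auto simp: neg)
  qed (auto simp: ring_axioms)
  then have K: "Idl\<^bsub>free_star_alg s\<^esub> R \<subseteq> ?K"
    using rels by (intro genideal_minimal) auto
  have "free_eval B v g = free_eval B v f" if "g \<in> cls f" for g
  proof -
    have "cls g = cls f" using coset_elem(2)[of g f] that by (simp add: pcls_def)
    then have "free_eval B v (g - f) = \<zero>\<^bsub>B\<^esub>" using K by (auto simp: cls_eq_iff)
    then show ?thesis by simp
  qed
  moreover have "f \<in> cls f" using a_rcos_self[of f] by (simp add: pcls_def)
  ultimately have "free_eval B v ` cls f = {free_eval B v f}" by blast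
  then show ?thesis by (simp add: pres_lift_def)
qed

lemma pres_lift_hom:
  assumes "complex_algebra B" and v: "\<And>g. v g \<in> carrier B"
    and rels: "\<And>r. r \<in> R \<Longrightarrow> free_eval B v r = \<zero>\<^bsub>B\<^esub>"
  shows "alg_hom (presented s R) B (pres_lift B v)"
proof -
  interpret B: complex_algebra B by fact
  show ?thesis
    unfolding alg_hom_def
    by (auto simp: carrier_presented cls_simps pres_lift_cls[OF assms] B.free_eval_simps[of v, OF v]
        intro!: ring_hom_memI)
qed

end

section \<open>Tensor products\<close>

definition bilinear_map ::
    "(complex, 'a, 'm) module_scheme \<Rightarrow> (complex, 'b, 'n) module_scheme \<Rightarrow>
     (complex, 'c, 'k) module_scheme \<Rightarrow> ('a \<Rightarrow> 'b \<Rightarrow> 'c) \<Rightarrow> bool" where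
  "bilinear_map A B V \<phi> \<longleftrightarrow>
     (\<forall>x \<in> carrier A. \<forall>y \<in> carrier B. \<phi> x y \<in> carrier V) \<and>
     (\<forall>x \<in> carrier A. \<forall>x' \<in> carrier A. \<forall>y \<in> carrier B. \<phi> (x \<oplus>\<^bsub>A\<^esub> x') y = \<phi> x y \<oplus>\<^bsub>V\<^esub> \<phi> x' y) \<and>
     (\<forall>x \<in> carrier A. \<forall>y \<in> carrier B. \<forall>y' \<in> carrier B. \<phi> x (y \<oplus>\<^bsub>B\<^esub> y') = \<phi> x y \<oplus>\<^bsub>V\<^esub> \<phi> x y') \<and>
     (\<forall>c. \<forall>x \<in> carrier A. \<forall>y \<in> carrier B. \<phi> (c \<odot>\<^bsub>A\<^esub> x) y = c \<odot>\<^bsub>V\<^esub> \<phi> x y) \<and>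
     (\<forall>c. \<forall>x \<in> carrier A. \<forall>y \<in> carrier B. \<phi> x (c \<odot>\<^bsub>B\<^esub> y) = c \<odot>\<^bsub>V\<^esub> \<phi> x y)"

locale tensor_product = A: complex_star_algebra A + B: complex_star_algebra B
  for A :: "('a, 'm) star_alg_scheme" and B :: "('b, 'n) star_alg_scheme"
begin

abbreviation "pt \<equiv> pre_tensor A B"
abbreviation "S \<equiv> carrier A \<times> carrier B"
abbreviation "pm \<equiv> mult (pre_tensor A B)"

lemma pre_simps [simp]:
  "carrier pt = {f. supp f \<subseteq> S}" "x \<oplus>\<^bsub>pt\<^esub> y = x + y" "\<zero>\<^bsub>pt\<^esub> = 0"
  "\<one>\<^bsub>pt\<^esub> = Poly_Mapping.single (\<one>\<^bsub>A\<^esub>, \<one>\<^bsub>B\<^esub>) 1" "c \<odot>\<^bsub>pt\<^esub> x = scale c x"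
  by (simp_all add: pre_tensor_def)

lemma pm_eq: "pm f g = (\<Sum>x\<in>supp f. \<Sum>y\<in>supp g.
        Poly_Mapping.single (fst x \<otimes>\<^bsub>A\<^esub> fst y, snd x \<otimes>\<^bsub>B\<^esub> snd y)
          (Poly_Mapping.lookup f x * Poly_Mapping.lookup g y))"
  by (simp add: pre_tensor_def)

lemma pm_single [simp]: "pm (Poly_Mapping.single x c) (Poly_Mapping.single y d) =
    Poly_Mapping.single (fst x \<otimes>\<^bsub>A\<^esub> fst y, snd x \<otimes>\<^bsub>B\<^esub> snd y) (c * d)"
  by (cases "c = 0"; cases "d = 0") (simp_all add: pm_eq)

lemma pm_zero [simp]: "pm 0 g = 0" "pm f 0 = 0"
  by (simp_all add: pm_eq)

lemma pm_add_left: "pm (f + f') g = pm f g + pm f' g"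
  unfolding pm_eq
  by (rule setsum_keys_plus_distrib) (simp_all add: distrib_right single_add sum.distrib)

lemma pm_add_right: "pm f (g + g') = pm f g + pm f g'"
  unfolding pm_eq sum.distrib[symmetric]
  by (rule sum.cong[OF refl], rule setsum_keys_plus_distrib)
     (simp_all add: distrib_left single_add)

lemma pm_closed:
  assumes "supp f \<subseteq> S" "supp g \<subseteq> S"
  shows "supp (pm f g) \<subseteq> S"
  using assms(1)
proof (induction f rule: poly_mapping_keys_induct)
  case (single x c)
  from assms(2) show ?case
  proof (induction g rule: poly_mapping_keys_induct)
    case (single y d)
    then show ?case using \<open>x \<in> S\<close> by (simp del: keys_single add: keys_single_subset mem_Times_iff)
  next
    case (add f g)
    then show ?case unfolding pm_add_right by (intro keys_add_subset)
  qed simp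
next
  case (add f g)
  then show ?case unfolding pm_add_left by (intro keys_add_subset)
qed simp

lemma pm_assoc:
  assumes "supp f \<subseteq> S" "supp g \<subseteq> S" "supp h \<subseteq> S"
  shows "pm (pm f g) h = pm f (pm g h)"
  using assms(1)
proof (induction f rule: poly_mapping_keys_induct)
  case (single x c)
  from assms(2) show ?case
  proof (induction g rule: poly_mapping_keys_induct)
    case (single y d)
    from assms(3) show ?case
    proof (induction h rule: poly_mapping_keys_induct)
      case (single z e)
      then show ?case using \<open>x \<in> S\<close> \<open>y \<in> S\<close>
        by (simp add: mem_Times_iff A.m_assoc B.m_assoc mult.assoc)
    qed (simp_all add: pm_add_right)
  qed (simp_all add: pm_add_right pm_add_left)
qed (simp_all add: pm_add_left)

definition pst :: "('a \<times> 'b \<Rightarrow>\<^sub>0 complex) \<Rightarrow> ('a \<times> 'b \<Rightarrow>\<^sub>0 complex)" where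
  "pst = star (pre_tensor A B)"

lemma pst_single [simp]:
  "pst (Poly_Mapping.single x c) = Poly_Mapping.single (star A (fst x), star B (snd x)) (cnj c)"
  by (cases "c = 0") (simp_all add: pst_def pre_tensor_def)

lemma pst_zero [simp]: "pst 0 = 0"
  by (simp add: pst_def pre_tensor_def)

lemma pst_add [simp]: "pst (f + g) = pst f + pst g"
  unfolding pst_def pre_tensor_def star_alg.simps
  by (rule setsum_keys_plus_distrib) (simp_all add: single_add)

lemma pst_minus [simp]: "pst (f - g) = pst f - pst g"
  using pst_add[of "f - g" g] by (simp add: algebra_simps)

lemma pst_closed: "supp f \<subseteq> S \<Longrightarrow> supp (pst f) \<subseteq> S"
proof (induction f rule: poly_mapping_keys_induct)
  case (single y d)
  then show ?case by (simp del: keys_single add: keys_single_subset mem_Times_iff)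
next
  case (add f g)
  then show ?case unfolding pst_add by (intro keys_add_subset)
qed simp

lemma map_add: "scale c (f + g) =
    scale c f + scale c g"
  by (rule poly_mapping_eqI) (simp add: lookup_map_scale lookup_add distrib_left)

lemma map_scale_zero [simp]: "scale c 0 = 0"
  by (rule poly_mapping_eqI) (simp add: lookup_map_scale)

lemma pm_smult:
  "pm (scale c f) g = scale c (pm f g)"
  "pm f (scale c g) = scale c (pm f g)"
proof -
  have single: "pm (scale c (Poly_Mapping.single x d)) g =
        scale c (pm (Poly_Mapping.single x d) g) \<and>
      pm (Poly_Mapping.single x d) (scale c g) =
        scale c (pm (Poly_Mapping.single x d) g)" for x d
    by (rule poly_mapping_keys_induct[of g UNIV])
       (simp_all add: map_add pm_add_right mult.assoc mult.left_commute)
  have "pm (scale c f) g = scale c (pm f g) \<and>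
      pm f (scale c g) = scale c (pm f g)"
    by (rule poly_mapping_keys_induct[of f UNIV], simp, simp, rule single)
       (simp add: map_add pm_add_left)
  then show "pm (scale c f) g = scale c (pm f g)"
    "pm f (scale c g) = scale c (pm f g)" by blast+
qed

lemma pst_mult:
  assumes "supp f \<subseteq> S" "supp g \<subseteq> S"
  shows "pst (pm f g) = pm (pst g) (pst f)"
  using assms(1)
proof (induction f rule: poly_mapping_keys_induct)
  case (single x c)
  from assms(2) show ?case
  proof (induction g rule: poly_mapping_keys_induct)
    case (single y d)
    then show ?case using \<open>x \<in> S\<close> by (simp add: mem_Times_iff mult.commute)
  qed (simp_all add: pm_add_left pm_add_right)
qed (simp_all add: pm_add_left pm_add_right)

lemma pst_smult: "pst (scale c f) = scale (cnj c) (pst f)"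
  by (rule poly_mapping_keys_induct[of f UNIV]; simp add: map_add)

lemma pm_one:
  assumes "supp f \<subseteq> S"
  shows "pm (Poly_Mapping.single (\<one>\<^bsub>A\<^esub>, \<one>\<^bsub>B\<^esub>) 1) f = f"
    "pm f (Poly_Mapping.single (\<one>\<^bsub>A\<^esub>, \<one>\<^bsub>B\<^esub>) 1) = f"
  using assms
  by (induction f rule: poly_mapping_keys_induct)
     (auto simp: pm_add_left pm_add_right)

lemma pre_tensor_algebra: "complex_star_algebra pt"
proof -
  have "ring pt"
  proof (intro ringI abelian_groupI monoidI)
    fix f assume "f \<in> carrier pt"
    then have "- f \<in> carrier pt" by (auto simp: in_keys_iff)
    moreover have "- f \<oplus>\<^bsub>pt\<^esub> f = \<zero>\<^bsub>pt\<^esub>" by simp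
    ultimately show "\<exists>g\<in>carrier pt. g \<oplus>\<^bsub>pt\<^esub> f = \<zero>\<^bsub>pt\<^esub>" by blast
  qed (simp_all add: keys_add_subset pm_closed pm_add_left pm_add_right pm_one pm_assoc ac_simps)
  moreover have "scale (c + d) f = scale c f + scale d f"
    for c d and f :: "'a \<times> 'b \<Rightarrow>\<^sub>0 complex"
    by (rule poly_mapping_eqI) (simp add: lookup_map_scale lookup_add distrib_right)
  moreover have "scale c (scale d f) = scale (c * d) f"
    "scale 1 f = f" for c d and f :: "'a \<times> 'b \<Rightarrow>\<^sub>0 complex"
    by (rule poly_mapping_eqI, simp add: lookup_map_scale mult.assoc)+
  ultimately show ?thesis
    using subset_trans[OF keys_map_scale]
    by (intro complex_star_algebra.intro complex_algebra.intro complex_algebra_axioms.intro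
          complex_star_algebra_axioms.intro)
       (simp_all add: map_add pm_smult pst_mult pst_smult pst_closed flip: pst_def)
qed

abbreviation "I \<equiv> Idl\<^bsub>pt\<^esub> (bilin_rels A B)"

sublocale PT: complex_star_algebra pt
  by (rule pre_tensor_algebra)

lemma bilin_rels_carrier: "bilin_rels A B \<subseteq> carrier pt"
proof
  have keys_diff_subset: "supp (f - g) \<subseteq> S"
    if "supp f \<subseteq> S" "supp g \<subseteq> S" for f g :: "'a \<times> 'b \<Rightarrow>\<^sub>0 complex"
    using keys_diff[of f g] that by blast
  fix r assume "r \<in> bilin_rels A B"
  then show "r \<in> carrier pt"
    unfolding bilin_rels_def Let_def
    by (elim UnE CollectE exE conjE; simp del: keys_single)
       (intro keys_diff_subset keys_single_subset; simp)+
qed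

text \<open>The star sends each bilinearity relation to one of the same kind, with starred factors
  and conjugated scalar, so the set of relations itself is invariant.\<close>

lemma bilin_rels_star: "r \<in> bilin_rels A B \<Longrightarrow> pst r \<in> bilin_rels A B"
  unfolding bilin_rels_def Let_def
  by (elim UnE CollectE exE conjE; simp) (metis A.star_closed B.star_closed)+

sublocale star_ideal I pt
  using bilin_rels_carrier bilin_rels_star PT.genideal_self[OF bilin_rels_carrier]
  by (intro PT.star_ideal_genideal) (auto simp flip: pst_def)

sublocale T: complex_star_algebra "tensor A B"
  unfolding tensor_def by (rule quot_algebra)

abbreviation "te \<equiv> tens A B"

lemma te_eq: "te x y = I +>\<^bsub>pt\<^esub> Poly_Mapping.single (x, y) 1"
  by (simp add: tens_def)

lemma single_mem: "x \<in> carrier A \<Longrightarrow> y \<in> carrier B \<Longrightarrow> Poly_Mapping.single (x, y) c \<in> carrier pt"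
  by auto

lemma coset_eqI: "f - g \<in> I \<Longrightarrow> f \<in> carrier pt \<Longrightarrow> g \<in> carrier pt \<Longrightarrow> I +>\<^bsub>pt\<^esub> f = I +>\<^bsub>pt\<^esub> g"
proof -
  assume *: "f - g \<in> I" "f \<in> carrier pt" "g \<in> carrier pt"
  have "scale (- 1) g = - g"
    by (rule poly_mapping_eqI) (simp add: lookup_map_scale)
  then have "f \<ominus>\<^bsub>pt\<^esub> g = f - g" using * by (simp add: PT.a_minus_eq_smult)
  with * show "I +>\<^bsub>pt\<^esub> f = I +>\<^bsub>pt\<^esub> g" by (simp add: coset_eq_iff)
qed

lemma rel_mem: "r \<in> bilin_rels A B \<Longrightarrow> r \<in> I"
  using PT.genideal_self[OF bilin_rels_carrier] by blast

lemma te_closed [simp, intro]: "x \<in> carrier A \<Longrightarrow> y \<in> carrier B \<Longrightarrow> te x y \<in> carrier (tensor A B)"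
  unfolding te_eq tensor_def by (rule quot_mem[OF single_mem])

lemma te_smult_single:
  assumes "x \<in> carrier A" "y \<in> carrier B"
  shows "c \<odot>\<^bsub>tensor A B\<^esub> te x y = I +>\<^bsub>pt\<^esub> Poly_Mapping.single (x, y) c"
  unfolding te_eq tensor_def using quot_smult[OF single_mem[OF assms], of c 1] by simp

lemma te_add_left:
  assumes "x \<in> carrier A" "x' \<in> carrier A" "y \<in> carrier B"
  shows "te (x \<oplus>\<^bsub>A\<^esub> x') y = te x y \<oplus>\<^bsub>tensor A B\<^esub> te x' y"
proof -
  have "Poly_Mapping.single (x \<oplus>\<^bsub>A\<^esub> x', y) 1 -
      (Poly_Mapping.single (x, y) 1 + Poly_Mapping.single (x', y) 1) \<in> I"
    using assms by (intro rel_mem) (auto simp: bilin_rels_def diff_diff_eq)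
  then have "I +>\<^bsub>pt\<^esub> Poly_Mapping.single (x \<oplus>\<^bsub>A\<^esub> x', y) 1 =
      I +>\<^bsub>pt\<^esub> (Poly_Mapping.single (x, y) 1 \<oplus>\<^bsub>pt\<^esub> Poly_Mapping.single (x', y) 1)"
    by (intro coset_eqI PT.a_closed single_mem) (use assms in auto)
  then show ?thesis
    unfolding te_eq tensor_def by (subst quot_add[OF single_mem single_mem]) (use assms in auto)
qed

lemma te_add_right:
  assumes "x \<in> carrier A" "y \<in> carrier B" "y' \<in> carrier B"
  shows "te x (y \<oplus>\<^bsub>B\<^esub> y') = te x y \<oplus>\<^bsub>tensor A B\<^esub> te x y'"
proof -
  have "Poly_Mapping.single (x, y \<oplus>\<^bsub>B\<^esub> y') 1 -
      (Poly_Mapping.single (x, y) 1 + Poly_Mapping.single (x, y') 1) \<in> I"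
    using assms by (intro rel_mem) (auto simp: bilin_rels_def diff_diff_eq)
  then have "I +>\<^bsub>pt\<^esub> Poly_Mapping.single (x, y \<oplus>\<^bsub>B\<^esub> y') 1 =
      I +>\<^bsub>pt\<^esub> (Poly_Mapping.single (x, y) 1 \<oplus>\<^bsub>pt\<^esub> Poly_Mapping.single (x, y') 1)"
    by (intro coset_eqI PT.a_closed single_mem) (use assms in auto)
  then show ?thesis
    unfolding te_eq tensor_def by (subst quot_add[OF single_mem single_mem]) (use assms in auto)
qed

lemma te_smult_left:
  assumes "x \<in> carrier A" "y \<in> carrier B"
  shows "te (c \<odot>\<^bsub>A\<^esub> x) y = c \<odot>\<^bsub>tensor A B\<^esub> te x y"
proof -
  have "Poly_Mapping.single (c \<odot>\<^bsub>A\<^esub> x, y) 1 - Poly_Mapping.single (x, y) c \<in> I"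
    using assms by (intro rel_mem) (auto simp: bilin_rels_def)
  then show ?thesis
    unfolding te_smult_single[OF assms] unfolding te_eq
    by (intro coset_eqI single_mem) (use assms in auto)
qed

lemma te_smult_right:
  assumes "x \<in> carrier A" "y \<in> carrier B"
  shows "te x (c \<odot>\<^bsub>B\<^esub> y) = c \<odot>\<^bsub>tensor A B\<^esub> te x y"
proof -
  have "Poly_Mapping.single (x, c \<odot>\<^bsub>B\<^esub> y) 1 - Poly_Mapping.single (x, y) c \<in> I"
    using assms by (intro rel_mem) (auto simp: bilin_rels_def)
  then show ?thesis
    unfolding te_smult_single[OF assms] unfolding te_eq
    by (intro coset_eqI single_mem) (use assms in auto)
qed

lemma te_mult:
  assumes "x \<in> carrier A" "x' \<in> carrier A" "y \<in> carrier B" "y' \<in> carrier B"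
  shows "te x y \<otimes>\<^bsub>tensor A B\<^esub> te x' y' = te (x \<otimes>\<^bsub>A\<^esub> x') (y \<otimes>\<^bsub>B\<^esub> y')"
  unfolding te_eq tensor_def using assms by (subst quot_mult[OF single_mem single_mem]) auto

lemma te_star:
  assumes "x \<in> carrier A" "y \<in> carrier B"
  shows "star (tensor A B) (te x y) = te (star A x) (star B y)"
  unfolding te_eq tensor_def using assms
  by (subst quot_star[OF single_mem]) (auto simp flip: pst_def)

lemma te_one: "\<one>\<^bsub>tensor A B\<^esub> = te \<one>\<^bsub>A\<^esub> \<one>\<^bsub>B\<^esub>"
  unfolding te_eq tensor_def by (simp add: quot_one)

lemma te_zero [simp]:
  "y \<in> carrier B \<Longrightarrow> te \<zero>\<^bsub>A\<^esub> y = \<zero>\<^bsub>tensor A B\<^esub>" "x \<in> carrier A \<Longrightarrow> te x \<zero>\<^bsub>B\<^esub> = \<zero>\<^bsub>tensor A B\<^esub>"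
  using te_smult_left[of "\<zero>\<^bsub>A\<^esub>" y 0] te_smult_right[of x "\<zero>\<^bsub>B\<^esub>" 0] by simp_all

text \<open>A coefficient can be moved into the left factor, which is why no case for scalar
  multiples appears.\<close>

lemma tensor_induct [consumes 1, case_names tens add]:
  assumes "t \<in> carrier (tensor A B)"
    and "\<And>x y. x \<in> carrier A \<Longrightarrow> y \<in> carrier B \<Longrightarrow> P (te x y)"
    and "\<And>t u. t \<in> carrier (tensor A B) \<Longrightarrow> u \<in> carrier (tensor A B) \<Longrightarrow>
      P t \<Longrightarrow> P u \<Longrightarrow> P (t \<oplus>\<^bsub>tensor A B\<^esub> u)"
  shows "P t"
proof -
  obtain f where f: "supp f \<subseteq> S" "t = I +>\<^bsub>pt\<^esub> f"
    using assms(1) by (auto simp: tensor_def quot_carrier)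
  have "P (I +>\<^bsub>pt\<^esub> f)"
    using f(1)
  proof (induction f rule: poly_mapping_keys_induct)
    case zero
    have "P (te \<zero>\<^bsub>A\<^esub> \<zero>\<^bsub>B\<^esub>)" by (rule assms(2)) auto
    then show ?case using quot_zero by (simp add: tensor_def)
  next
    case (single k c)
    then obtain x y where k: "k = (x, y)" "x \<in> carrier A" "y \<in> carrier B" by auto
    then have "P (te (c \<odot>\<^bsub>A\<^esub> x) y)" by (intro assms(2)) auto
    then show ?case using k by (simp add: te_smult_left te_smult_single)
  next
    case (add f g)
    then have "I +>\<^bsub>pt\<^esub> (f + g) = (I +>\<^bsub>pt\<^esub> f) \<oplus>\<^bsub>tensor A B\<^esub> (I +>\<^bsub>pt\<^esub> g)"
      unfolding tensor_def by (subst quot_add) auto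
    moreover have "I +>\<^bsub>pt\<^esub> f \<in> carrier (tensor A B)" "I +>\<^bsub>pt\<^esub> g \<in> carrier (tensor A B)"
      unfolding tensor_def using add by auto
    ultimately show ?case using add assms(3) by simp
  qed
  then show ?thesis by (simp add: f(2))
qed

end

section \<open>Linear maps induced by bilinear maps\<close>

locale tensor_bilinear = tensor_product A B + V: complex_algebra V
  for A :: "('a, 'm) star_alg_scheme" and B :: "('b, 'n) star_alg_scheme"
    and V :: "(complex, 'c, 'k) module_scheme" +
  fixes \<phi> :: "'a \<Rightarrow> 'b \<Rightarrow> 'c"
  assumes bilinear: "bilinear_map A B V \<phi>"
begin

abbreviation lin :: "('a \<Rightarrow> 'b \<Rightarrow> 'c) \<Rightarrow> ('a \<times> 'b \<Rightarrow>\<^sub>0 complex) \<Rightarrow> 'c" where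
  "lin \<psi> \<equiv> lin_ext V (\<lambda>p. \<psi> (fst p) (snd p))"

lemma bilinearD:
  assumes "bilinear_map A B V \<psi>"
  shows "x \<in> carrier A \<Longrightarrow> y \<in> carrier B \<Longrightarrow> \<psi> x y \<in> carrier V"
    "x \<in> carrier A \<Longrightarrow> x' \<in> carrier A \<Longrightarrow> y \<in> carrier B \<Longrightarrow> \<psi> (x \<oplus>\<^bsub>A\<^esub> x') y = \<psi> x y \<oplus>\<^bsub>V\<^esub> \<psi> x' y"
    "x \<in> carrier A \<Longrightarrow> y \<in> carrier B \<Longrightarrow> y' \<in> carrier B \<Longrightarrow> \<psi> x (y \<oplus>\<^bsub>B\<^esub> y') = \<psi> x y \<oplus>\<^bsub>V\<^esub> \<psi> x y'"
    "x \<in> carrier A \<Longrightarrow> y \<in> carrier B \<Longrightarrow> \<psi> (c \<odot>\<^bsub>A\<^esub> x) y = c \<odot>\<^bsub>V\<^esub> \<psi> x y"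
    "x \<in> carrier A \<Longrightarrow> y \<in> carrier B \<Longrightarrow> \<psi> x (c \<odot>\<^bsub>B\<^esub> y) = c \<odot>\<^bsub>V\<^esub> \<psi> x y"
  using assms unfolding bilinear_map_def by auto

lemma lin_closed: "bilinear_map A B V \<psi> \<Longrightarrow> supp f \<subseteq> S \<Longrightarrow> lin \<psi> f \<in> carrier V"
  by (rule V.lin_ext_closed) (auto simp: bilinearD)

lemma lin_add:
  "bilinear_map A B V \<psi> \<Longrightarrow> supp f \<subseteq> S \<Longrightarrow> supp g \<subseteq> S \<Longrightarrow>
    lin \<psi> (f + g) = lin \<psi> f \<oplus>\<^bsub>V\<^esub> lin \<psi> g"
  by (rule V.lin_ext_add[where S = S]) (auto simp: bilinearD)

lemma lin_single:
  "bilinear_map A B V \<psi> \<Longrightarrow> x \<in> carrier A \<Longrightarrow> y \<in> carrier B \<Longrightarrow>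
    lin \<psi> (Poly_Mapping.single (x, y) c) = c \<odot>\<^bsub>V\<^esub> \<psi> x y"
  by (subst V.lin_ext_single) (auto simp: bilinearD)

lemma lin_uminus:
  assumes "bilinear_map A B V \<psi>" "supp f \<subseteq> S"
  shows "lin \<psi> (- f) = \<ominus>\<^bsub>V\<^esub> lin \<psi> f"
proof -
  have "- f = scale (- 1) f"
    by (rule poly_mapping_eqI) (simp add: lookup_map_scale)
  then show ?thesis using assms
    by (simp add: V.minus_eq_smult lin_closed) (subst V.lin_ext_smult; force simp: bilinearD)
qed

lemma lin_diff:
  assumes "bilinear_map A B V \<psi>" "supp f \<subseteq> S" "supp g \<subseteq> S"
  shows "lin \<psi> (f - g) = lin \<psi> f \<ominus>\<^bsub>V\<^esub> lin \<psi> g"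
proof -
  have "supp (- g) \<subseteq> S" using assms(3) by (auto simp: in_keys_iff)
  then show ?thesis
    using lin_add[of \<psi> f "- g"] lin_uminus[of \<psi> g] assms by (simp add: a_minus_def)
qed

text \<open>Multiplying a formal sum by an elementary tensor amounts to translating \<psi> in both
  arguments, and the translate is bilinear again. This is the closure property behind
  \<open>lin_ideal\<close>.\<close>

lemma lin_pm:
  assumes "bilinear_map A B V \<psi>" "x \<in> carrier A" "y \<in> carrier B" "supp f \<subseteq> S"
  shows "lin \<psi> (pm (Poly_Mapping.single (x, y) c) f) =
      c \<odot>\<^bsub>V\<^esub> lin (\<lambda>u v. \<psi> (x \<otimes>\<^bsub>A\<^esub> u) (y \<otimes>\<^bsub>B\<^esub> v)) f"
    "lin \<psi> (pm f (Poly_Mapping.single (x, y) c)) =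
      c \<odot>\<^bsub>V\<^esub> lin (\<lambda>u v. \<psi> (u \<otimes>\<^bsub>A\<^esub> x) (v \<otimes>\<^bsub>B\<^esub> y)) f"
    "bilinear_map A B V (\<lambda>u v. \<psi> (x \<otimes>\<^bsub>A\<^esub> u) (y \<otimes>\<^bsub>B\<^esub> v))"
    "bilinear_map A B V (\<lambda>u v. \<psi> (u \<otimes>\<^bsub>A\<^esub> x) (v \<otimes>\<^bsub>B\<^esub> y))"
proof -
  note \<psi> = bilinearD[OF assms(1)]
  show b1: "bilinear_map A B V (\<lambda>u v. \<psi> (x \<otimes>\<^bsub>A\<^esub> u) (y \<otimes>\<^bsub>B\<^esub> v))"
    and b2: "bilinear_map A B V (\<lambda>u v. \<psi> (u \<otimes>\<^bsub>A\<^esub> x) (v \<otimes>\<^bsub>B\<^esub> y))"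
    using assms(2,3) unfolding bilinear_map_def
    by (simp_all add: \<psi> A.l_distr A.r_distr B.l_distr B.r_distr)
  have s: "supp (Poly_Mapping.single (x, y) c) \<subseteq> S"
    using assms(2,3) by (intro keys_single_subset) auto
  have "lin \<psi> (pm (Poly_Mapping.single (x, y) c) f) =
      c \<odot>\<^bsub>V\<^esub> lin (\<lambda>u v. \<psi> (x \<otimes>\<^bsub>A\<^esub> u) (y \<otimes>\<^bsub>B\<^esub> v)) f \<and>
    lin \<psi> (pm f (Poly_Mapping.single (x, y) c)) =
      c \<odot>\<^bsub>V\<^esub> lin (\<lambda>u v. \<psi> (u \<otimes>\<^bsub>A\<^esub> x) (v \<otimes>\<^bsub>B\<^esub> y)) f"
    using assms(4)
  proof (induction f rule: poly_mapping_keys_induct)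
    case (single k d)
    then obtain u v where k: "k = (u, v)" "u \<in> carrier A" "v \<in> carrier B" by auto
    then show ?case using assms(2,3)
      by (simp add: lin_single[OF assms(1)] lin_single[OF b1] lin_single[OF b2] \<psi>(1) mult.commute)
  next
    case (add f g)
    then show ?case
      by (simp add: pm_add_left pm_add_right lin_add[OF assms(1)] lin_add[OF b1] lin_add[OF b2]
          pm_closed s lin_closed[OF b1] lin_closed[OF b2] V.smult_add_right del: keys_single)
  qed simp
  then show "lin \<psi> (pm (Poly_Mapping.single (x, y) c) f) =
      c \<odot>\<^bsub>V\<^esub> lin (\<lambda>u v. \<psi> (x \<otimes>\<^bsub>A\<^esub> u) (y \<otimes>\<^bsub>B\<^esub> v)) f"
    "lin \<psi> (pm f (Poly_Mapping.single (x, y) c)) =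
      c \<odot>\<^bsub>V\<^esub> lin (\<lambda>u v. \<psi> (u \<otimes>\<^bsub>A\<^esub> x) (v \<otimes>\<^bsub>B\<^esub> y)) f" by blast+
qed

text \<open>The ideal property holds only for all bilinear maps at once, since multiplication changes \<open>\<psi>\<close>.\<close>

lemma lin_ideal:
  assumes "f \<in> I" "bilinear_map A B V \<psi>"
  shows "lin \<psi> f = \<zero>\<^bsub>V\<^esub>"
proof -
  let ?N = "{f. supp f \<subseteq> S \<and> (\<forall>\<psi>. bilinear_map A B V \<psi> \<longrightarrow> lin \<psi> f = \<zero>\<^bsub>V\<^esub>)}"
  have ideal: "ideal ?N pt"
  proof (rule idealI)
    show "subgroup ?N (add_monoid pt)"
    proof (rule PT.add.subgroupI)
      fix f assume f: "f \<in> ?N"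
      have "\<ominus>\<^bsub>pt\<^esub> f = - f"
        using f by (intro PT.minus_equality) (auto simp: in_keys_iff)
      moreover have "- f \<in> ?N" using f by (auto simp: lin_uminus in_keys_iff)
      ultimately show "\<ominus>\<^bsub>pt\<^esub> f \<in> ?N" by simp
    next
      show "?N \<noteq> {}" using V.lin_ext_zero by (auto intro: exI[of _ 0])
    next
      fix f g assume "f \<in> ?N" "g \<in> ?N"
      then show "f \<oplus>\<^bsub>pt\<^esub> g \<in> ?N" by (simp add: lin_add keys_add_subset)
    qed auto
  next
    fix f g assume f: "f \<in> ?N" and "g \<in> carrier pt"
    then have g: "supp g \<subseteq> S" and f': "supp f \<subseteq> S" by auto
    have "lin \<psi> (pm g f) = \<zero>\<^bsub>V\<^esub> \<and> lin \<psi> (pm f g) = \<zero>\<^bsub>V\<^esub>" if b: "bilinear_map A B V \<psi>" for \<psi>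
      using g
    proof (induction g rule: poly_mapping_keys_induct)
      case (single k c)
      then obtain u v where k: "k = (u, v)" "u \<in> carrier A" "v \<in> carrier B" by auto
      have "lin (\<lambda>u' v'. \<psi> (u \<otimes>\<^bsub>A\<^esub> u') (v \<otimes>\<^bsub>B\<^esub> v')) f = \<zero>\<^bsub>V\<^esub>"
        "lin (\<lambda>u' v'. \<psi> (u' \<otimes>\<^bsub>A\<^esub> u) (v' \<otimes>\<^bsub>B\<^esub> v)) f = \<zero>\<^bsub>V\<^esub>"
        using f lin_pm(3,4)[OF b k(2,3) f'] by blast+
      with lin_pm(1,2)[OF b k(2,3) f'] show ?case by (simp add: k(1))
    next
      case (add g h)
      then show ?case by (simp add: pm_add_left pm_add_right lin_add[OF b] pm_closed f')
    qed simp
    then show "g \<otimes>\<^bsub>pt\<^esub> f \<in> ?N" "f \<otimes>\<^bsub>pt\<^esub> g \<in> ?N" by (simp_all add: pm_closed f' g)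
  qed (rule PT.ring_axioms)
  have "r \<in> ?N" if r: "r \<in> bilin_rels A B" for r
  proof -
    have "lin \<psi> r = \<zero>\<^bsub>V\<^esub>" if b: "bilinear_map A B V \<psi>" for \<psi>
      using r unfolding bilin_rels_def Let_def
      by (elim UnE CollectE exE conjE)
         (simp_all add: diff_diff_eq lin_diff[OF b] lin_add[OF b] lin_single[OF b] bilinearD[OF b]
           keys_add_subset keys_single_subset V.r_neg a_minus_def V.smult_one del: keys_single)
    with r bilin_rels_carrier show ?thesis by auto
  qed
  then have "I \<subseteq> ?N" by (intro PT.genideal_minimal ideal) blast
  with assms show ?thesis by blast
qed

text \<open>Representatives of one coset differ by an element of the ideal, on which every bilinear
  evaluation vanishes; so \<open>the_elem\<close> meets a singleton.\<close>

lemma tensor_lift_coset: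
  assumes "supp f \<subseteq> S"
  shows "tensor_lift V \<phi> (I +>\<^bsub>pt\<^esub> f) = lin \<phi> f"
proof -
  have "lin \<phi> g = lin \<phi> f" if g: "g \<in> I +>\<^bsub>pt\<^esub> f" for g
  proof -
    obtain i where i: "i \<in> I" "g = i + f"
      using g unfolding a_r_coset_def r_coset_def by auto
    then have "supp i \<subseteq> S" using Icarr by auto
    with i assms show ?thesis
      by (simp add: lin_add[OF bilinear] lin_ideal[OF _ bilinear] lin_closed[OF bilinear])
  qed
  moreover have "f \<in> I +>\<^bsub>pt\<^esub> f" using a_rcos_self assms by auto
  ultimately have "lin \<phi> ` (I +>\<^bsub>pt\<^esub> f) = {lin \<phi> f}" by blast
  then show ?thesis by (simp add: tensor_lift_def lin_ext_def)
qed

lemma tensor_lift_tens [simp]: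
  "x \<in> carrier A \<Longrightarrow> y \<in> carrier B \<Longrightarrow> tensor_lift V \<phi> (te x y) = \<phi> x y"
  unfolding te_eq
  by (subst tensor_lift_coset) (auto simp: lin_single[OF bilinear] bilinearD[OF bilinear])

lemma tensor_lift_add [simp]:
  assumes "t \<in> carrier (tensor A B)" "u \<in> carrier (tensor A B)"
  shows "tensor_lift V \<phi> (t \<oplus>\<^bsub>tensor A B\<^esub> u) = tensor_lift V \<phi> t \<oplus>\<^bsub>V\<^esub> tensor_lift V \<phi> u"
proof -
  obtain f g where fg: "supp f \<subseteq> S" "t = I +>\<^bsub>pt\<^esub> f" "supp g \<subseteq> S" "u = I +>\<^bsub>pt\<^esub> g"
    using assms by (auto simp: tensor_def quot_carrier)
  then have "t \<oplus>\<^bsub>tensor A B\<^esub> u = I +>\<^bsub>pt\<^esub> (f + g)" unfolding tensor_def by simp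
  with fg show ?thesis by (simp add: tensor_lift_coset lin_add[OF bilinear] keys_add_subset)
qed

lemma tensor_lift_smult [simp]:
  assumes "t \<in> carrier (tensor A B)"
  shows "tensor_lift V \<phi> (c \<odot>\<^bsub>tensor A B\<^esub> t) = c \<odot>\<^bsub>V\<^esub> tensor_lift V \<phi> t"
proof -
  obtain f where f: "supp f \<subseteq> S" "t = I +>\<^bsub>pt\<^esub> f"
    using assms by (auto simp: tensor_def quot_carrier)
  then have "c \<odot>\<^bsub>tensor A B\<^esub> t = I +>\<^bsub>pt\<^esub> scale c f" unfolding tensor_def by simp
  moreover have "supp (scale c f) \<subseteq> S"
    by (rule subset_trans[OF keys_map_scale f(1)])
  moreover have "lin \<phi> (scale c f) = c \<odot>\<^bsub>V\<^esub> lin \<phi> f"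
    using f(1) bilinearD(1)[OF bilinear] by (intro V.lin_ext_smult) auto
  ultimately show ?thesis using f by (simp add: tensor_lift_coset)
qed

lemma tensor_lift_closed [simp]:
  "t \<in> carrier (tensor A B) \<Longrightarrow> tensor_lift V \<phi> t \<in> carrier V"
  by (induction t rule: tensor_induct) (simp_all add: bilinearD(1)[OF bilinear])

lemma tensor_lift_zero [simp]: "tensor_lift V \<phi> \<zero>\<^bsub>tensor A B\<^esub> = \<zero>\<^bsub>V\<^esub>"
  using tensor_lift_smult[of "\<zero>\<^bsub>tensor A B\<^esub>" 0] by simp

end

lemmas tensor_lift_simps = tensor_bilinear.tensor_lift_tens tensor_bilinear.tensor_lift_add
  tensor_bilinear.tensor_lift_smult tensor_bilinear.tensor_lift_closed tensor_bilinear.tensor_lift_zero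

section \<open>Slices, and separation of tensors by their slices\<close>

definition linear_functional :: "(complex, 'a, 'm) module_scheme \<Rightarrow> ('a \<Rightarrow> complex) \<Rightarrow> bool" where
  "linear_functional A \<omega> \<longleftrightarrow>
     (\<forall>x \<in> carrier A. \<forall>y \<in> carrier A. \<omega> (x \<oplus>\<^bsub>A\<^esub> y) = \<omega> x + \<omega> y) \<and>
     (\<forall>c. \<forall>x \<in> carrier A. \<omega> (c \<odot>\<^bsub>A\<^esub> x) = c * \<omega> x)"

context tensor_product
begin

lemma slice_bilinear:
  assumes "linear_functional B \<omega>"
  shows "tensor_bilinear A B A (\<lambda>y p. \<omega> p \<odot>\<^bsub>A\<^esub> y)"
proof -
  have "bilinear_map A B A (\<lambda>y p. \<omega> p \<odot>\<^bsub>A\<^esub> y)"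
    using assms unfolding bilinear_map_def linear_functional_def
    by (simp add: A.smult_add_left A.smult_add_right mult.commute)
  then show ?thesis
    by (intro tensor_bilinear.intro tensor_bilinear_axioms.intro tensor_product_axioms
        A.complex_algebra_axioms)
qed

lemma slice_simps:
  assumes "linear_functional B \<omega>"
  shows "t \<in> carrier (tensor A B) \<Longrightarrow> slice A \<omega> t \<in> carrier A"
    and "x \<in> carrier A \<Longrightarrow> y \<in> carrier B \<Longrightarrow> slice A \<omega> (te x y) = \<omega> y \<odot>\<^bsub>A\<^esub> x"
    and "t \<in> carrier (tensor A B) \<Longrightarrow> u \<in> carrier (tensor A B) \<Longrightarrow>
      slice A \<omega> (t \<oplus>\<^bsub>tensor A B\<^esub> u) = slice A \<omega> t \<oplus>\<^bsub>A\<^esub> slice A \<omega> u"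
    and "t \<in> carrier (tensor A B) \<Longrightarrow> slice A \<omega> (c \<odot>\<^bsub>tensor A B\<^esub> t) = c \<odot>\<^bsub>A\<^esub> slice A \<omega> t"
    and "slice A \<omega> \<zero>\<^bsub>tensor A B\<^esub> = \<zero>\<^bsub>A\<^esub>"
  unfolding slice_def by (simp_all add: tensor_lift_simps[OF slice_bilinear[OF assms]])

text \<open>Lists replace bases here: a tensor is written as \<open>tsum\<close> of a list of pairs,
  and the length of the list serves as the induction measure.\<close>

primrec span_list :: "'a list \<Rightarrow> 'a set" where
  "span_list [] = {\<zero>\<^bsub>A\<^esub>}"
| "span_list (b # bs) = {c \<odot>\<^bsub>A\<^esub> b \<oplus>\<^bsub>A\<^esub> x | c x. x \<in> span_list bs}"

primrec tsum :: "('a \<times> 'b) list \<Rightarrow> ('a \<times> 'b \<Rightarrow>\<^sub>0 complex) set" where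
  "tsum [] = \<zero>\<^bsub>tensor A B\<^esub>"
| "tsum (p # ps) = te (fst p) (snd p) \<oplus>\<^bsub>tensor A B\<^esub> tsum ps"

lemma tsum_closed [simp]: "set xs \<subseteq> S \<Longrightarrow> tsum xs \<in> carrier (tensor A B)"
  by (induction xs) auto

lemma tsum_append:
  "set xs \<subseteq> S \<Longrightarrow> set ys \<subseteq> S \<Longrightarrow> tsum (xs @ ys) = tsum xs \<oplus>\<^bsub>tensor A B\<^esub> tsum ys"
  by (induction xs) (auto simp: T.a_assoc)

lemma tensor_eq_tsum:
  assumes "t \<in> carrier (tensor A B)"
  obtains xs where "set xs \<subseteq> S" "t = tsum xs"
proof -
  have "\<exists>xs. set xs \<subseteq> S \<and> t = tsum xs"
    using assms
  proof (induction t rule: tensor_induct)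
    case (tens x y)
    then show ?case by (intro exI[of _ "[(x, y)]"]) simp
  next
    case (add t u)
    then obtain xs ys where "set xs \<subseteq> S" "t = tsum xs" "set ys \<subseteq> S" "u = tsum ys" by blast
    then show ?case by (intro exI[of _ "xs @ ys"]) (simp add: tsum_append)
  qed
  with that show ?thesis by blast
qed

lemma span_list_carrier: "set bs \<subseteq> carrier A \<Longrightarrow> x \<in> span_list bs \<Longrightarrow> x \<in> carrier A"
  by (induction bs arbitrary: x) auto

lemma span_list_smult: "set bs \<subseteq> carrier A \<Longrightarrow> x \<in> span_list bs \<Longrightarrow> c \<odot>\<^bsub>A\<^esub> x \<in> span_list bs"
proof (induction bs arbitrary: x)
  case (Cons b bs)
  then obtain d y where x: "x = d \<odot>\<^bsub>A\<^esub> b \<oplus>\<^bsub>A\<^esub> y" "y \<in> span_list bs" by auto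
  with Cons have "c \<odot>\<^bsub>A\<^esub> x = (c * d) \<odot>\<^bsub>A\<^esub> b \<oplus>\<^bsub>A\<^esub> c \<odot>\<^bsub>A\<^esub> y" "c \<odot>\<^bsub>A\<^esub> y \<in> span_list bs"
    using span_list_carrier[of bs y] by (simp_all add: A.smult_add_right)
  then show ?case by auto
qed simp

lemma slice_tsum_span:
  "linear_functional B \<omega> \<Longrightarrow> set xs \<subseteq> S \<Longrightarrow> slice A \<omega> (tsum xs) \<in> span_list (map fst xs)"
proof (induction xs)
  case (Cons z zs)
  then have "slice A \<omega> (tsum (z # zs)) = \<omega> (snd z) \<odot>\<^bsub>A\<^esub> fst z \<oplus>\<^bsub>A\<^esub> slice A \<omega> (tsum zs)"
    "slice A \<omega> (tsum zs) \<in> span_list (map fst zs)"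
    by (cases z; simp add: slice_simps)+
  then show ?case by auto
qed (simp add: slice_simps)

text \<open>If b is the sum of the c_i b_i, then b \<otimes> p plus the sum of the b_i \<otimes> p_i
  equals the sum of the b_i \<otimes> (p_i + c_i p): the extra summand disappears without
  lengthening the list.\<close>

lemma tsum_absorb:
  assumes "set xs \<subseteq> S" "b \<in> span_list (map fst xs)" "p \<in> carrier B"
  shows "\<exists>ys. length ys = length xs \<and> set ys \<subseteq> S \<and> te b p \<oplus>\<^bsub>tensor A B\<^esub> tsum xs = tsum ys"
  using assms
proof (induction xs arbitrary: b)
  case (Cons z xs)
  obtain b1 p1 where z: "z = (b1, p1)" "b1 \<in> carrier A" "p1 \<in> carrier B" using Cons(2) by (cases z) auto
  obtain c x where b: "b = c \<odot>\<^bsub>A\<^esub> b1 \<oplus>\<^bsub>A\<^esub> x" "x \<in> span_list (map fst xs)"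
    using Cons(3) z by auto
  obtain ys where ys: "length ys = length xs" "set ys \<subseteq> S" "te x p \<oplus>\<^bsub>tensor A B\<^esub> tsum xs = tsum ys"
    using Cons(1)[OF _ b(2) Cons(4)] Cons(2) by auto
  have x: "x \<in> carrier A" using Cons(2) by (intro span_list_carrier[OF _ b(2)]) auto
  have xs: "tsum xs \<in> carrier (tensor A B)" using Cons(2) by simp
  have "te b p \<oplus>\<^bsub>tensor A B\<^esub> tsum (z # xs) =
      (te b1 p1 \<oplus>\<^bsub>tensor A B\<^esub> te b1 (c \<odot>\<^bsub>B\<^esub> p)) \<oplus>\<^bsub>tensor A B\<^esub> (te x p \<oplus>\<^bsub>tensor A B\<^esub> tsum xs)"
    using x xs z Cons(4) by (simp add: b te_add_left te_smult_left te_smult_right T.a_ac)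
  also have "\<dots> = tsum ((b1, p1 \<oplus>\<^bsub>B\<^esub> c \<odot>\<^bsub>B\<^esub> p) # ys)"
    using z Cons(4) by (simp add: te_add_right ys(3))
  finally show ?case
    using ys z Cons(4) by (intro exI[of _ "(b1, p1 \<oplus>\<^bsub>B\<^esub> c \<odot>\<^bsub>B\<^esub> p) # ys"]) simp
qed (auto intro!: exI[of _ "[]"])

text \<open>
  Induction on the number of summands: if the first left factor lies in the span of the others,
  it can be absorbed; otherwise its right factor is annihilated by all functionals.
\<close>

lemma slice_separates:
  assumes lin: "\<And>\<omega>. \<omega> \<in> \<Omega> \<Longrightarrow> linear_functional B \<omega>"
    and sep: "\<And>y. y \<in> carrier B \<Longrightarrow> (\<And>\<omega>. \<omega> \<in> \<Omega> \<Longrightarrow> \<omega> y = 0) \<Longrightarrow> y = \<zero>\<^bsub>B\<^esub>"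
    and t: "t \<in> carrier (tensor A B)" and zero: "\<And>\<omega>. \<omega> \<in> \<Omega> \<Longrightarrow> slice A \<omega> t = \<zero>\<^bsub>A\<^esub>"
  shows "t = \<zero>\<^bsub>tensor A B\<^esub>"
proof -
  have "tsum xs = \<zero>\<^bsub>tensor A B\<^esub>"
    if "set xs \<subseteq> S" "\<And>\<omega>. \<omega> \<in> \<Omega> \<Longrightarrow> slice A \<omega> (tsum xs) = \<zero>\<^bsub>A\<^esub>" for xs
    using that
  proof (induction "length xs" arbitrary: xs rule: less_induct)
    case less
    show ?case
    proof (cases xs)
      case (Cons z zs)
      obtain b p where z: "z = (b, p)" "b \<in> carrier A" "p \<in> carrier B" and zs: "set zs \<subseteq> S"
        using less(2) Cons by (cases z) auto
      show ?thesis
      proof (cases "b \<in> span_list (map fst zs)")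
        case True
        obtain ys where "length ys = length zs" "set ys \<subseteq> S" "tsum xs = tsum ys"
          using tsum_absorb[OF zs True z(3)] Cons z by auto
        then show ?thesis using less(1)[of ys] less(3) Cons by simp
      next
        case False
        have "\<omega> p = 0" if \<omega>: "\<omega> \<in> \<Omega>" for \<omega>
        proof (rule ccontr)
          \<comment> \<open>The vanishing slice by \<omega> could then be solved for b, which would
            put b into the span of the remaining left factors.\<close>
          assume nz: "\<omega> p \<noteq> 0"
          let ?s = "slice A \<omega> (tsum zs)"
          have s: "?s \<in> carrier A" using zs by (simp add: slice_simps[OF lin[OF \<omega>]])
          have "\<omega> p \<odot>\<^bsub>A\<^esub> b \<oplus>\<^bsub>A\<^esub> ?s = \<zero>\<^bsub>A\<^esub>"
            using less(3)[OF \<omega>] zs z by (simp add: Cons slice_simps[OF lin[OF \<omega>]])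
          then have "\<omega> p \<odot>\<^bsub>A\<^esub> b = (- 1) \<odot>\<^bsub>A\<^esub> ?s"
            using s z by (metis A.minus_eq_smult A.minus_equality A.smult_closed)
          then have "(1 / \<omega> p) \<odot>\<^bsub>A\<^esub> (\<omega> p \<odot>\<^bsub>A\<^esub> b) = (1 / \<omega> p) \<odot>\<^bsub>A\<^esub> ((- 1) \<odot>\<^bsub>A\<^esub> ?s)" by simp
          then have "b = (- 1 / \<omega> p) \<odot>\<^bsub>A\<^esub> ?s" using s z nz by simp
          moreover have "set (map fst zs) \<subseteq> carrier A" using zs by auto
          ultimately show False
            using False span_list_smult slice_tsum_span[OF lin[OF \<omega>] zs] by metis
        qed
        then have "p = \<zero>\<^bsub>B\<^esub>" using sep z by blast
        then have "tsum xs = tsum zs" using zs z by (simp add: Cons)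
        then show ?thesis using less(1)[of zs] less(3) zs Cons by simp
      qed
    qed simp
  qed
  then show ?thesis using t zero by (elim tensor_eq_tsum) simp
qed

lemma slice_inject:
  assumes lin: "\<And>\<omega>. \<omega> \<in> \<Omega> \<Longrightarrow> linear_functional B \<omega>"
    and sep: "\<And>y. y \<in> carrier B \<Longrightarrow> (\<And>\<omega>. \<omega> \<in> \<Omega> \<Longrightarrow> \<omega> y = 0) \<Longrightarrow> y = \<zero>\<^bsub>B\<^esub>"
    and t: "t \<in> carrier (tensor A B)" "u \<in> carrier (tensor A B)"
    and eq: "\<And>\<omega>. \<omega> \<in> \<Omega> \<Longrightarrow> slice A \<omega> t = slice A \<omega> u"
  shows "t = u"
proof -
  have "t \<oplus>\<^bsub>tensor A B\<^esub> (- 1) \<odot>\<^bsub>tensor A B\<^esub> u = \<zero>\<^bsub>tensor A B\<^esub>"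
  proof (rule slice_separates[of \<Omega>])
    fix \<omega> assume \<omega>: "\<omega> \<in> \<Omega>"
    then show "slice A \<omega> (t \<oplus>\<^bsub>tensor A B\<^esub> (- 1) \<odot>\<^bsub>tensor A B\<^esub> u) = \<zero>\<^bsub>A\<^esub>"
      using t eq by (simp add: slice_simps[OF lin[OF \<omega>]] A.r_neg flip: A.minus_eq_smult)
  qed (use lin sep t in auto)
  with t show ?thesis by (simp flip: T.a_minus_eq_smult)
qed

end

section \<open>The algebras $U_q(\mu,\nu)$\<close>

text \<open>The relations of U_q(\<mu>,\<nu>) are stated for an arbitrary family in an arbitrary
  algebra, because they have to be verified in tensor products, opposite algebras and quotients in
  order to define comultiplication, antipode and the image in A.\<close>

definition uq_gens ::
    "(complex, 'a, 'm) module_scheme \<Rightarrow> real \<Rightarrow> real \<Rightarrow> real \<Rightarrow> (ugen \<Rightarrow> 'a) \<Rightarrow> bool" where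
  "uq_gens A q \<mu> \<nu> v \<longleftrightarrow> (\<forall>g. v g \<in> carrier A) \<and>
     v GKi \<otimes>\<^bsub>A\<^esub> v GK = \<one>\<^bsub>A\<^esub> \<and> v GK \<otimes>\<^bsub>A\<^esub> v GKi = \<one>\<^bsub>A\<^esub> \<and>
     v GK \<otimes>\<^bsub>A\<^esub> v GE = complex_of_real q \<odot>\<^bsub>A\<^esub> (v GE \<otimes>\<^bsub>A\<^esub> v GK) \<and>
     v GK \<otimes>\<^bsub>A\<^esub> v GF = complex_of_real (1 / q) \<odot>\<^bsub>A\<^esub> (v GF \<otimes>\<^bsub>A\<^esub> v GK) \<and>
     v GE \<otimes>\<^bsub>A\<^esub> v GF = v GF \<otimes>\<^bsub>A\<^esub> v GE \<oplus>\<^bsub>A\<^esub>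
       (complex_of_real (lam q * \<mu>) \<odot>\<^bsub>A\<^esub> (v GK \<otimes>\<^bsub>A\<^esub> v GK) \<oplus>\<^bsub>A\<^esub>
        complex_of_real (- lam q * \<nu>) \<odot>\<^bsub>A\<^esub> (v GKi \<otimes>\<^bsub>A\<^esub> v GKi))"

lemma (in complex_algebra) uq_gens_iff:
  assumes v: "\<And>g. v g \<in> carrier A"
  shows "uq_gens A q \<mu> \<nu> v \<longleftrightarrow> (\<forall>r \<in> u_rels q \<mu> \<nu>. free_eval A v r = \<zero>)"
  unfolding uq_gens_def u_rels_def Let_def
  by (simp add: v free_eval_simps[of v, OF v] minus_eq_iff)
     (simp add: v m_assoc a_minus_eq_smult smult_add_right)

lemma cst_simps:
  "gen g * cst c = cst c * gen g" "gen g * (cst c * f) = cst c * (gen g * f)"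
  "cst c * cst d = cst (c * d)" "cst c * (cst d * f) = cst (c * d) * f"
  "cst (- c) = - cst c" "cst 1 = 1"
proof -
  show "gen g * cst c = cst c * gen g" by (simp only: cst_def single_zero_commute)
  show "gen g * (cst c * f) = cst c * (gen g * f)" by (simp only: cst_def) (rule single_mult_left_commute)
  show "cst c * (cst d * f) = cst (c * d) * f" by (simp add: cst_def single_zero_mult_assoc)
qed (simp_all add: cst_def mult_single single_uminus)

text \<open>The star interchanges the two inverse relations, interchanges the relation for E with
  that for F up to the factors -q and -1/q, and fixes the commutator relation.\<close>

lemma u_presentation:
  assumes "q \<noteq> 0"
  shows "star_presentation u_star (u_rels q \<mu> \<nu>)"
proof -
  interpret F: complex_star_algebra "free_star_alg u_star" by (rule complex_star_algebra_free)
  let ?I = "Idl\<^bsub>free_star_alg u_star\<^esub> (u_rels q \<mu> \<nu>)"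
  interpret I: ideal ?I "free_star_alg u_star" by (rule F.genideal_ideal) simp
  have sub: "f * r \<in> ?I" if "r \<in> u_rels q \<mu> \<nu>" for f r
    using I.I_l_closed[of r f] F.genideal_self[of "u_rels q \<mu> \<nu>"] that by auto
  show ?thesis
  proof
    fix r assume r: "r \<in> u_rels q \<mu> \<nu>"
    then consider
        "r = gen GKi * gen GK - 1" | "r = gen GK * gen GKi - 1"
      | "r = gen GK * gen GE - cst q * gen GE * gen GK"
      | "r = gen GK * gen GF - cst (1 / q) * gen GF * gen GK"
      | "r = gen GE * gen GF - gen GF * gen GE -
          cst (lam q) * (cst \<mu> * gen GK * gen GK - cst \<nu> * gen GKi * gen GKi)"
      by (auto simp: u_rels_def Let_def)
    then show "star (free_star_alg u_star) r \<in> ?I"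
    proof cases
      case 1
      then show ?thesis using sub[of "gen GK * gen GKi - 1" 1] by (simp add: u_rels_def Let_def)
    next
      case 2
      then show ?thesis using sub[of "gen GKi * gen GK - 1" 1] by (simp add: u_rels_def Let_def)
    next
      case 3
      then have "star (free_star_alg u_star) r = cst (- q) * (gen GK * gen GF - cst (1 / q) * gen GF * gen GK)"
        using assms by (simp add: right_diff_distrib mult.assoc cst_simps)
      then show ?thesis using sub by (simp add: u_rels_def Let_def)
    next
      case 4
      then have "star (free_star_alg u_star) r = cst (- (1 / q)) * (gen GK * gen GE - cst q * gen GE * gen GK)"
        using assms by (simp add: right_diff_distrib mult.assoc cst_simps)
      then show ?thesis using sub by (simp add: u_rels_def Let_def)
    next
      case 5
      then have "star (free_star_alg u_star) r = 1 * r"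
        by (simp add: right_diff_distrib left_diff_distrib mult.assoc cst_simps)
      then show ?thesis using sub[OF r, of 1] by simp
    qed
  qed
qed

lemma U_star_algebra:
  assumes "q \<noteq> 0"
  shows "complex_star_algebra (U_alg q \<mu> \<nu>)"
proof -
  interpret star_presentation u_star "u_rels q \<mu> \<nu>" by (rule u_presentation) fact
  show ?thesis unfolding U_alg_def by (rule Q.complex_star_algebra_axioms)
qed

lemma U_gens:
  assumes "q \<noteq> 0"
  shows "uq_gens (U_alg q \<mu> \<nu>) q \<mu> \<nu> (U_gen q \<mu> \<nu>)"
proof -
  interpret star_presentation u_star "u_rels q \<mu> \<nu>" by (rule u_presentation) fact
  have "U_gen q \<mu> \<nu> = (\<lambda>g. cls (gen g))" by (simp add: U_gen_def fun_eq_iff)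
  then show ?thesis unfolding U_alg_def by (subst Q.uq_gens_iff) (auto simp: cls_rel)
qed

lemma U_induct [consumes 2, case_names one gen smult add mult]:
  assumes "q \<noteq> 0" "x \<in> carrier (U_alg q \<mu> \<nu>)"
    and "P \<one>\<^bsub>U_alg q \<mu> \<nu>\<^esub>" "\<And>g. P (U_gen q \<mu> \<nu> g)"
    and "\<And>c x. x \<in> carrier (U_alg q \<mu> \<nu>) \<Longrightarrow> P x \<Longrightarrow> P (c \<odot>\<^bsub>U_alg q \<mu> \<nu>\<^esub> x)"
    and "\<And>x y. x \<in> carrier (U_alg q \<mu> \<nu>) \<Longrightarrow> y \<in> carrier (U_alg q \<mu> \<nu>) \<Longrightarrow>
      P x \<Longrightarrow> P y \<Longrightarrow> P (x \<oplus>\<^bsub>U_alg q \<mu> \<nu>\<^esub> y)"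
    and "\<And>x y. x \<in> carrier (U_alg q \<mu> \<nu>) \<Longrightarrow> y \<in> carrier (U_alg q \<mu> \<nu>) \<Longrightarrow>
      P x \<Longrightarrow> P y \<Longrightarrow> P (x \<otimes>\<^bsub>U_alg q \<mu> \<nu>\<^esub> y)"
  shows "P x"
  using star_presentation.presented_induct[OF u_presentation[OF assms(1)], of x \<mu> \<nu> P] assms(2-)
  unfolding U_alg_def U_gen_def by blast

lemma U_lift:
  assumes "q \<noteq> 0" "complex_algebra B" "uq_gens B q \<mu> \<nu> v"
  shows "alg_hom (U_alg q \<mu> \<nu>) B (pres_lift B v)"
    and "pres_lift B v (U_gen q \<mu> \<nu> g) = v g"
proof -
  interpret star_presentation u_star "u_rels q \<mu> \<nu>" by (rule u_presentation) fact
  interpret B: complex_algebra B by fact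
  have v: "\<And>g. v g \<in> carrier B" using assms(3) by (simp add: uq_gens_def)
  with assms(3) have rels: "\<And>r. r \<in> u_rels q \<mu> \<nu> \<Longrightarrow> free_eval B v r = \<zero>\<^bsub>B\<^esub>"
    by (simp add: B.uq_gens_iff)
  show "alg_hom (U_alg q \<mu> \<nu>) B (pres_lift B v)"
    unfolding U_alg_def by (rule pres_lift_hom[OF assms(2) v rels])
  show "pres_lift B v (U_gen q \<mu> \<nu> g) = v g"
    unfolding U_gen_def by (subst pres_lift_cls[OF assms(2) v rels]) (simp_all add: B.free_eval_simps[of v, OF v])
qed

lemma U_star_gen:
  assumes "q \<noteq> 0"
  shows "star (U_alg q \<mu> \<nu>) (U_gen q \<mu> \<nu> GK) = U_gen q \<mu> \<nu> GK"
    "star (U_alg q \<mu> \<nu>) (U_gen q \<mu> \<nu> GKi) = U_gen q \<mu> \<nu> GKi"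
    "star (U_alg q \<mu> \<nu>) (U_gen q \<mu> \<nu> GE) = U_gen q \<mu> \<nu> GF"
    "star (U_alg q \<mu> \<nu>) (U_gen q \<mu> \<nu> GF) = U_gen q \<mu> \<nu> GE"
proof -
  interpret star_presentation u_star "u_rels q \<mu> \<nu>" by (rule u_presentation) fact
  show "star (U_alg q \<mu> \<nu>) (U_gen q \<mu> \<nu> GK) = U_gen q \<mu> \<nu> GK"
    "star (U_alg q \<mu> \<nu>) (U_gen q \<mu> \<nu> GKi) = U_gen q \<mu> \<nu> GKi"
    "star (U_alg q \<mu> \<nu>) (U_gen q \<mu> \<nu> GE) = U_gen q \<mu> \<nu> GF"
    "star (U_alg q \<mu> \<nu>) (U_gen q \<mu> \<nu> GF) = U_gen q \<mu> \<nu> GE"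
    by (simp_all add: U_alg_def U_gen_def cls_simps)
qed

text \<open>A normal ordering: F comes before E, and K and its inverse are moved to the right of
  both. The variants with a trailing \<open>y\<close> are the same rules for products nested to the
  right.\<close>

lemma (in complex_algebra) uq_gens_rules:
  assumes v: "uq_gens A q \<mu> \<nu> v" and q: "q \<noteq> 0"
  shows "v g \<in> carrier A"
    and "v GKi \<otimes> v GK = \<one>" "v GK \<otimes> v GKi = \<one>"
    and "v GK \<otimes> v GE = complex_of_real q \<odot> (v GE \<otimes> v GK)"
    and "v GK \<otimes> v GF = complex_of_real (1 / q) \<odot> (v GF \<otimes> v GK)"
    and "v GKi \<otimes> v GE = complex_of_real (1 / q) \<odot> (v GE \<otimes> v GKi)"
    and "v GKi \<otimes> v GF = complex_of_real q \<odot> (v GF \<otimes> v GKi)"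
    and "v GE \<otimes> v GF = v GF \<otimes> v GE \<oplus> (complex_of_real (lam q * \<mu>) \<odot> (v GK \<otimes> v GK) \<oplus>
        complex_of_real (- lam q * \<nu>) \<odot> (v GKi \<otimes> v GKi))"
    and "y \<in> carrier A \<Longrightarrow> v GKi \<otimes> (v GK \<otimes> y) = y"
    and "y \<in> carrier A \<Longrightarrow> v GK \<otimes> (v GKi \<otimes> y) = y"
    and "y \<in> carrier A \<Longrightarrow> v GK \<otimes> (v GE \<otimes> y) = complex_of_real q \<odot> (v GE \<otimes> (v GK \<otimes> y))"
    and "y \<in> carrier A \<Longrightarrow> v GK \<otimes> (v GF \<otimes> y) = complex_of_real (1 / q) \<odot> (v GF \<otimes> (v GK \<otimes> y))"
    and "y \<in> carrier A \<Longrightarrow> v GKi \<otimes> (v GE \<otimes> y) = complex_of_real (1 / q) \<odot> (v GE \<otimes> (v GKi \<otimes> y))"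
    and "y \<in> carrier A \<Longrightarrow> v GKi \<otimes> (v GF \<otimes> y) = complex_of_real q \<odot> (v GF \<otimes> (v GKi \<otimes> y))"
proof -
  show c: "v g \<in> carrier A" for g using v by (simp add: uq_gens_def)
  show kk: "v GKi \<otimes> v GK = \<one>" "v GK \<otimes> v GKi = \<one>"
    and ke: "v GK \<otimes> v GE = complex_of_real q \<odot> (v GE \<otimes> v GK)"
    and kf: "v GK \<otimes> v GF = complex_of_real (1 / q) \<odot> (v GF \<otimes> v GK)"
    and "v GE \<otimes> v GF = v GF \<otimes> v GE \<oplus> (complex_of_real (lam q * \<mu>) \<odot> (v GK \<otimes> v GK) \<oplus>
        complex_of_real (- lam q * \<nu>) \<odot> (v GKi \<otimes> v GKi))"
    using v by (auto simp: uq_gens_def)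
  \<comment> \<open>Multiplying K x = d x K by the inverse of K from both sides converts a
    commutation rule with K into one with its inverse.\<close>
  have *: "v GKi \<otimes> x = (1 / d) \<odot> (x \<otimes> v GKi)"
    if "v GK \<otimes> x = d \<odot> (x \<otimes> v GK)" "x \<in> carrier A" "d \<noteq> 0" for x d
  proof -
    have "v GKi \<otimes> (v GK \<otimes> x) = x"
      using c that(2) by (simp only: m_assoc[symmetric] kk l_one)
    then have "x \<otimes> v GKi = v GKi \<otimes> (v GK \<otimes> x) \<otimes> v GKi" by (simp only:)
    also have "\<dots> = v GKi \<otimes> (d \<odot> (x \<otimes> v GK)) \<otimes> v GKi" by (simp only: that(1))
    also have "\<dots> = d \<odot> (v GKi \<otimes> x)" using that c by (simp add: m_assoc kk)
    finally show ?thesis using that c by simp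
  qed
  show ke': "v GKi \<otimes> v GE = complex_of_real (1 / q) \<odot> (v GE \<otimes> v GKi)"
    using *[OF ke] q c by simp
  show kf': "v GKi \<otimes> v GF = complex_of_real q \<odot> (v GF \<otimes> v GKi)"
    using *[OF kf] q c by simp
  have assoc: "v x \<otimes> (v y \<otimes> z) = (v x \<otimes> v y) \<otimes> z" if "z \<in> carrier A" for x y z
    using that c by (simp add: m_assoc)
  assume y: "y \<in> carrier A"
  show "v GKi \<otimes> (v GK \<otimes> y) = y" "v GK \<otimes> (v GKi \<otimes> y) = y"
    "v GK \<otimes> (v GE \<otimes> y) = complex_of_real q \<odot> (v GE \<otimes> (v GK \<otimes> y))"
    "v GK \<otimes> (v GF \<otimes> y) = complex_of_real (1 / q) \<odot> (v GF \<otimes> (v GK \<otimes> y))"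
    "v GKi \<otimes> (v GE \<otimes> y) = complex_of_real (1 / q) \<odot> (v GE \<otimes> (v GKi \<otimes> y))"
    "v GKi \<otimes> (v GF \<otimes> y) = complex_of_real q \<odot> (v GF \<otimes> (v GKi \<otimes> y))"
    using y c by (simp_all add: assoc kk ke kf ke' kf')
qed

text \<open>In the commutator of the images of E and F the mixed terms cancel by q-commutation. The
  rest is \<lambda> times (\<mu> K^2 - \<upsilon> K^{-2}) \<otimes> K^2 plus \<lambda> times K^{-2}
  \<otimes> (\<upsilon> K^2 - \<nu> K^{-2}), where the two \<upsilon>-terms cancel; so the middle
  parameter is arbitrary.\<close>

lemma (in tensor_product) uq_gens_tensor:
  assumes q: "q \<noteq> 0" and x: "uq_gens A q \<mu> \<upsilon> x" and y: "uq_gens B q \<upsilon> \<nu> y"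
  shows "uq_gens (tensor A B) q \<mu> \<nu> (\<lambda>g. case g of
      GK \<Rightarrow> te (x GK) (y GK) | GKi \<Rightarrow> te (x GKi) (y GKi)
    | GE \<Rightarrow> te (x GE) (y GK) \<oplus>\<^bsub>tensor A B\<^esub> te (x GKi) (y GE)
    | GF \<Rightarrow> te (x GF) (y GK) \<oplus>\<^bsub>tensor A B\<^esub> te (x GKi) (y GF))"
proof -
  note xr = A.uq_gens_rules[OF x q] and yr = B.uq_gens_rules[OF y q]
  show ?thesis
    unfolding uq_gens_def
    apply (intro conjI allI)
         apply (simp add: xr yr split: ugen.split)
        apply (simp_all add: xr yr T.l_distr T.r_distr te_mult te_one te_smult_left te_smult_right q
            T.smult_add_right te_add_left te_add_right A.m_assoc B.m_assoc)
    \<comment> \<open>After normal ordering both sides are linear combinations of the same tensors.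
      The \<open>formal\<close> rules treat these as variables, and only an identity between scalars
      remains. All later verifications by \<open>lin_eqI\<close> follow this pattern.\<close>
    apply (rule T.lin_eqI, ((rule T.formal_intros | (simp add: xr yr; fail))+)[2], simp add: algebra_simps)
    done
qed

lemma U_tensor_product: "q \<noteq> 0 \<Longrightarrow> tensor_product (U_alg q \<mu> \<upsilon>) (U_alg q \<upsilon> \<nu>)"
  by (intro tensor_product.intro U_star_algebra)

lemma U_comul:
  fixes q \<mu> \<upsilon> \<nu> :: real
  assumes q: "q \<noteq> 0"
  defines "t \<equiv> tens (U_alg q \<mu> \<upsilon>) (U_alg q \<upsilon> \<nu>)" and "T \<equiv> tensor (U_alg q \<mu> \<upsilon>) (U_alg q \<upsilon> \<nu>)"
  shows "alg_hom (U_alg q \<mu> \<nu>) T (U_comul q \<mu> \<upsilon> \<nu>)"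
    and "U_comul q \<mu> \<upsilon> \<nu> (U_gen q \<mu> \<nu> GK) = t (U_gen q \<mu> \<upsilon> GK) (U_gen q \<upsilon> \<nu> GK)"
    and "U_comul q \<mu> \<upsilon> \<nu> (U_gen q \<mu> \<nu> GKi) = t (U_gen q \<mu> \<upsilon> GKi) (U_gen q \<upsilon> \<nu> GKi)"
    and "U_comul q \<mu> \<upsilon> \<nu> (U_gen q \<mu> \<nu> GE) = t (U_gen q \<mu> \<upsilon> GE) (U_gen q \<upsilon> \<nu> GK) \<oplus>\<^bsub>T\<^esub>
      t (U_gen q \<mu> \<upsilon> GKi) (U_gen q \<upsilon> \<nu> GE)"
    and "U_comul q \<mu> \<upsilon> \<nu> (U_gen q \<mu> \<nu> GF) = t (U_gen q \<mu> \<upsilon> GF) (U_gen q \<upsilon> \<nu> GK) \<oplus>\<^bsub>T\<^esub>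
      t (U_gen q \<mu> \<upsilon> GKi) (U_gen q \<upsilon> \<nu> GF)"
proof -
  interpret tensor_product "U_alg q \<mu> \<upsilon>" "U_alg q \<upsilon> \<nu>" by (rule U_tensor_product) fact
  note c = A.uq_gens_rules(1)[OF U_gens[OF q] q] B.uq_gens_rules(1)[OF U_gens[OF q] q]
  note g = uq_gens_tensor[OF q U_gens[OF q] U_gens[OF q]]
  have eq: "U_comul q \<mu> \<upsilon> \<nu> = pres_lift T (\<lambda>g. case g of
      GK \<Rightarrow> t (U_gen q \<mu> \<upsilon> GK) (U_gen q \<upsilon> \<nu> GK) | GKi \<Rightarrow> t (U_gen q \<mu> \<upsilon> GKi) (U_gen q \<upsilon> \<nu> GKi)
    | GE \<Rightarrow> t (U_gen q \<mu> \<upsilon> GE) (U_gen q \<upsilon> \<nu> GK) \<oplus>\<^bsub>T\<^esub> t (U_gen q \<mu> \<upsilon> GKi) (U_gen q \<upsilon> \<nu> GE)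
    | GF \<Rightarrow> t (U_gen q \<mu> \<upsilon> GF) (U_gen q \<upsilon> \<nu> GK) \<oplus>\<^bsub>T\<^esub> t (U_gen q \<mu> \<upsilon> GKi) (U_gen q \<upsilon> \<nu> GF))"
    \<comment> \<open>The value at F is defined as the star of the value at E; since K and its
      inverse are self-adjoint, this replaces E by F and leaves the other factors alone.\<close>
    unfolding U_comul_def Let_def t_def T_def by (simp add: c te_star U_star_gen q)
  note l = U_lift[OF q T.complex_algebra_axioms g, folded t_def T_def, folded eq]
  show "alg_hom (U_alg q \<mu> \<nu>) T (U_comul q \<mu> \<upsilon> \<nu>)" by (rule l(1))
  show "U_comul q \<mu> \<upsilon> \<nu> (U_gen q \<mu> \<nu> GK) = t (U_gen q \<mu> \<upsilon> GK) (U_gen q \<upsilon> \<nu> GK)"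
    "U_comul q \<mu> \<upsilon> \<nu> (U_gen q \<mu> \<nu> GKi) = t (U_gen q \<mu> \<upsilon> GKi) (U_gen q \<upsilon> \<nu> GKi)"
    "U_comul q \<mu> \<upsilon> \<nu> (U_gen q \<mu> \<nu> GE) = t (U_gen q \<mu> \<upsilon> GE) (U_gen q \<upsilon> \<nu> GK) \<oplus>\<^bsub>T\<^esub>
      t (U_gen q \<mu> \<upsilon> GKi) (U_gen q \<upsilon> \<nu> GE)"
    "U_comul q \<mu> \<upsilon> \<nu> (U_gen q \<mu> \<nu> GF) = t (U_gen q \<mu> \<upsilon> GF) (U_gen q \<upsilon> \<nu> GK) \<oplus>\<^bsub>T\<^esub>
      t (U_gen q \<mu> \<upsilon> GKi) (U_gen q \<upsilon> \<nu> GF)"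
    by (simp_all add: l(2))
qed

lemma opp_alg_simps [simp]:
  "carrier (opp_alg A) = carrier A" "x \<otimes>\<^bsub>opp_alg A\<^esub> y = y \<otimes>\<^bsub>A\<^esub> x" "x \<oplus>\<^bsub>opp_alg A\<^esub> y = x \<oplus>\<^bsub>A\<^esub> y"
  "\<one>\<^bsub>opp_alg A\<^esub> = \<one>\<^bsub>A\<^esub>" "\<zero>\<^bsub>opp_alg A\<^esub> = \<zero>\<^bsub>A\<^esub>" "c \<odot>\<^bsub>opp_alg A\<^esub> x = c \<odot>\<^bsub>A\<^esub> x"
  by (simp_all add: opp_alg_def)

text \<open>The factors -q and -1/q multiply to 1, so the commutator keeps its size. Passing to the
  opposite product changes its sign, and exchanging K with its inverse restores the sign with \<mu>
  and \<nu> exchanged.\<close>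

lemma (in complex_algebra) uq_gens_opp:
  assumes q: "q \<noteq> 0" and x: "uq_gens A q \<nu> \<mu> x"
  shows "uq_gens (opp_alg A) q \<mu> \<nu> (\<lambda>g. case g of GK \<Rightarrow> x GKi | GKi \<Rightarrow> x GK
     | GE \<Rightarrow> complex_of_real (- q) \<odot> x GE | GF \<Rightarrow> complex_of_real (- 1 / q) \<odot> x GF)"
proof -
  note xr = uq_gens_rules[OF x q]
  show ?thesis
    unfolding uq_gens_def
    apply (intro conjI allI)
         apply (simp add: xr split: ugen.split)
        apply (simp_all add: xr q smult_add_right)
    apply (rule lin_eqI, ((rule formal_intros | (simp add: xr; fail))+)[2], simp add: algebra_simps)
    done
qed

lemma U_antipode:
  assumes q: "q \<noteq> 0"
  shows "alg_hom (U_alg q \<mu> \<nu>) (opp_alg (U_alg q \<nu> \<mu>)) (U_antipode q \<mu> \<nu>)"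
    and "U_antipode q \<mu> \<nu> (U_gen q \<mu> \<nu> GK) = U_gen q \<nu> \<mu> GKi"
    and "U_antipode q \<mu> \<nu> (U_gen q \<mu> \<nu> GKi) = U_gen q \<nu> \<mu> GK"
    and "U_antipode q \<mu> \<nu> (U_gen q \<mu> \<nu> GE) = complex_of_real (- q) \<odot>\<^bsub>U_alg q \<nu> \<mu>\<^esub> U_gen q \<nu> \<mu> GE"
    and "U_antipode q \<mu> \<nu> (U_gen q \<mu> \<nu> GF) = complex_of_real (- 1 / q) \<odot>\<^bsub>U_alg q \<nu> \<mu>\<^esub> U_gen q \<nu> \<mu> GF"
proof -
  interpret A: complex_star_algebra "U_alg q \<nu> \<mu>" by (rule U_star_algebra) fact
  note l = U_lift[OF q A.complex_algebra_opp A.uq_gens_opp[OF q U_gens[OF q]]]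
  have eq: "U_antipode q \<mu> \<nu> = pres_lift (opp_alg (U_alg q \<nu> \<mu>)) (\<lambda>g. case g of
      GK \<Rightarrow> U_gen q \<nu> \<mu> GKi | GKi \<Rightarrow> U_gen q \<nu> \<mu> GK
    | GE \<Rightarrow> complex_of_real (- q) \<odot>\<^bsub>U_alg q \<nu> \<mu>\<^esub> U_gen q \<nu> \<mu> GE
    | GF \<Rightarrow> complex_of_real (- 1 / q) \<odot>\<^bsub>U_alg q \<nu> \<mu>\<^esub> U_gen q \<nu> \<mu> GF)"
    unfolding U_antipode_def Let_def ..
  show "alg_hom (U_alg q \<mu> \<nu>) (opp_alg (U_alg q \<nu> \<mu>)) (U_antipode q \<mu> \<nu>)"
    unfolding eq by (rule l(1))
  show "U_antipode q \<mu> \<nu> (U_gen q \<mu> \<nu> GK) = U_gen q \<nu> \<mu> GKi"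
    "U_antipode q \<mu> \<nu> (U_gen q \<mu> \<nu> GKi) = U_gen q \<nu> \<mu> GK"
    "U_antipode q \<mu> \<nu> (U_gen q \<mu> \<nu> GE) = complex_of_real (- q) \<odot>\<^bsub>U_alg q \<nu> \<mu>\<^esub> U_gen q \<nu> \<mu> GE"
    "U_antipode q \<mu> \<nu> (U_gen q \<mu> \<nu> GF) = complex_of_real (- 1 / q) \<odot>\<^bsub>U_alg q \<nu> \<mu>\<^esub> U_gen q \<nu> \<mu> GF"
    unfolding eq l(2) by simp_all
qed

section \<open>The Hopf algebras $\mathrm{Pol}_q(\mu)$\<close>

text \<open>
  With $c = -q\mu b^*$ and $d = a^*$ the three presentations become one presentation in
  $a, b, b^*, a^*$ that depends polynomially on \<open>\<mu>\<close>.
\<close>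

definition pq_gens ::
    "(complex, 'a, 'm) module_scheme \<Rightarrow> real \<Rightarrow> real \<Rightarrow> 'a \<Rightarrow> 'a \<Rightarrow> 'a \<Rightarrow> 'a \<Rightarrow> bool" where
  "pq_gens A q \<mu> a b bs as \<longleftrightarrow>
     a \<in> carrier A \<and> b \<in> carrier A \<and> bs \<in> carrier A \<and> as \<in> carrier A \<and>
     a \<otimes>\<^bsub>A\<^esub> b = complex_of_real q \<odot>\<^bsub>A\<^esub> (b \<otimes>\<^bsub>A\<^esub> a) \<and>
     a \<otimes>\<^bsub>A\<^esub> bs = complex_of_real q \<odot>\<^bsub>A\<^esub> (bs \<otimes>\<^bsub>A\<^esub> a) \<and>
     b \<otimes>\<^bsub>A\<^esub> as = complex_of_real q \<odot>\<^bsub>A\<^esub> (as \<otimes>\<^bsub>A\<^esub> b) \<and>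
     bs \<otimes>\<^bsub>A\<^esub> as = complex_of_real q \<odot>\<^bsub>A\<^esub> (as \<otimes>\<^bsub>A\<^esub> bs) \<and>
     b \<otimes>\<^bsub>A\<^esub> bs = bs \<otimes>\<^bsub>A\<^esub> b \<and>
     as \<otimes>\<^bsub>A\<^esub> a = \<one>\<^bsub>A\<^esub> \<oplus>\<^bsub>A\<^esub> complex_of_real (- \<mu>) \<odot>\<^bsub>A\<^esub> (bs \<otimes>\<^bsub>A\<^esub> b) \<and>
     a \<otimes>\<^bsub>A\<^esub> as = \<one>\<^bsub>A\<^esub> \<oplus>\<^bsub>A\<^esub> complex_of_real (- q\<^sup>2 * \<mu>) \<odot>\<^bsub>A\<^esub> (bs \<otimes>\<^bsub>A\<^esub> b)"

lemma pq_gensD: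
  assumes "pq_gens A q \<mu> a b bs as"
  shows "a \<in> carrier A" "b \<in> carrier A" "bs \<in> carrier A" "as \<in> carrier A"
    "a \<otimes>\<^bsub>A\<^esub> b = complex_of_real q \<odot>\<^bsub>A\<^esub> (b \<otimes>\<^bsub>A\<^esub> a)"
    "a \<otimes>\<^bsub>A\<^esub> bs = complex_of_real q \<odot>\<^bsub>A\<^esub> (bs \<otimes>\<^bsub>A\<^esub> a)"
    "b \<otimes>\<^bsub>A\<^esub> as = complex_of_real q \<odot>\<^bsub>A\<^esub> (as \<otimes>\<^bsub>A\<^esub> b)"
    "bs \<otimes>\<^bsub>A\<^esub> as = complex_of_real q \<odot>\<^bsub>A\<^esub> (as \<otimes>\<^bsub>A\<^esub> bs)"
    "b \<otimes>\<^bsub>A\<^esub> bs = bs \<otimes>\<^bsub>A\<^esub> b"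
    "as \<otimes>\<^bsub>A\<^esub> a = \<one>\<^bsub>A\<^esub> \<oplus>\<^bsub>A\<^esub> complex_of_real (- \<mu>) \<odot>\<^bsub>A\<^esub> (bs \<otimes>\<^bsub>A\<^esub> b)"
    "a \<otimes>\<^bsub>A\<^esub> as = \<one>\<^bsub>A\<^esub> \<oplus>\<^bsub>A\<^esub> complex_of_real (- q\<^sup>2 * \<mu>) \<odot>\<^bsub>A\<^esub> (bs \<otimes>\<^bsub>A\<^esub> b)"
  using assms unfolding pq_gens_def by blast+

text \<open>Inverse of the substitution c = -q\<mu> b^*: it returns values for the four letters of
  the original presentations, in which the case \<mu> = 0 is separate.\<close>

definition pol_letter :: "(complex, 'a, 'm) module_scheme \<Rightarrow> real \<Rightarrow> real \<Rightarrow>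
    'a \<Rightarrow> 'a \<Rightarrow> 'a \<Rightarrow> 'a \<Rightarrow> pgen \<Rightarrow> 'a" where
  "pol_letter A q \<mu> a b bs as g = (case g of Pa \<Rightarrow> a | Pb \<Rightarrow> b
     | Pc \<Rightarrow> (if \<mu> = 0 then bs else complex_of_real (- q * \<mu>) \<odot>\<^bsub>A\<^esub> bs) | Pd \<Rightarrow> as)"

context complex_algebra
begin

lemma smult_cancel: "d \<noteq> 0 \<Longrightarrow> x \<in> carrier A \<Longrightarrow> y \<in> carrier A \<Longrightarrow> d \<odot> x = d \<odot> y \<Longrightarrow> x = y"
  by (metis smult_smult smult_one nonzero_eq_divide_eq times_divide_eq_left mult_1)

lemma pq_gens_pol_rels:
  assumes \<mu>: "\<mu> \<in> {-1, 0, 1}" and q: "q \<noteq> 0" and p: "pq_gens A q \<mu> a b bs as"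
  shows "pol_letter A q \<mu> a b bs as g \<in> carrier A"
    and "r \<in> pol_rels q \<mu> \<Longrightarrow> free_eval A (pol_letter A q \<mu> a b bs as) r = \<zero>"
proof -
  note pr = pq_gensD[OF p]
  show c: "pol_letter A q \<mu> a b bs as g \<in> carrier A" for g
    using pr by (simp add: pol_letter_def split: pgen.split)
  define v where "v = pol_letter A q \<mu> a b bs as"
  have vc: "v g \<in> carrier A" for g unfolding v_def by (rule c)
  note e = free_eval_simps[of v, OF vc]
  have v: "v Pa = a" "v Pb = b" "v Pd = as"
    "v Pc = (if \<mu> = 0 then bs else complex_of_real (- q * \<mu>) \<odot> bs)"
    by (simp_all add: v_def pol_letter_def)
  assume r: "r \<in> pol_rels q \<mu>"
  have "free_eval A v r = \<zero>"
  proof (cases "\<mu> = 0")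
    case True
    have r': "bs \<otimes> a = complex_of_real (1 / q) \<odot> (a \<otimes> bs)" "as \<otimes> b = complex_of_real (1 / q) \<odot> (b \<otimes> as)"
      using q pr(1-4) by (simp_all add: pr(6,7))
    from r show ?thesis
      using True r' q pr(1-4)
      by (auto simp: pol_rels_def Pol0_rels_def Let_def e v pr(5-11) m_assoc minus_eq_iff)
  next
    case False
    then have "\<mu> = 1 \<or> \<mu> = - 1" using \<mu> by auto
    with r show ?thesis
      using False q pr(1-4)
      by (elim disjE; auto simp: pol_rels_def SL_rels_def Let_def e v pr(5-11) m_assoc minus_eq_iff a_ac power2_eq_square)
  qed
  then show "free_eval A (pol_letter A q \<mu> a b bs as) r = \<zero>" by (simp only: v_def)
qed

lemma pol_rels_pq_gens:
  assumes \<mu>: "\<mu> \<in> {-1, 0, 1}" and q: "q \<noteq> 0" and c: "\<And>g. v g \<in> carrier A"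
    and r: "\<And>r. r \<in> pol_rels q \<mu> \<Longrightarrow> free_eval A v r = \<zero>"
  shows "pq_gens A q \<mu> (v Pa) (v Pb)
    (if \<mu> = 0 then v Pc else complex_of_real (- \<mu> / q) \<odot> v Pc) (v Pd)"
proof -
  note e = free_eval_simps[of v, OF c]
  have r: "\<forall>r \<in> pol_rels q \<mu>. free_eval A v r = \<zero>" using r by blast
  show ?thesis
  proof (cases "\<mu> = 0")
    case True
    have *: "bs \<otimes> as = complex_of_real q \<odot> (as \<otimes> bs)" if "as \<otimes> bs = complex_of_real (1 / q) \<odot> (bs \<otimes> as)"
        "as \<in> carrier A" "bs \<in> carrier A" for as bs
      using that q by simp
    \<comment> \<open>The last two equations are the adjoints of the relations for a b and a^* b,
      which \<open>pol_rels\<close> adds for \<mu> = 0.\<close>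
    have r1: "v Pd \<otimes> v Pa = \<one>" "v Pa \<otimes> v Pd = \<one>" "v Pa \<otimes> v Pb = complex_of_real q \<odot> (v Pb \<otimes> v Pa)"
      "v Pd \<otimes> v Pb = complex_of_real (1 / q) \<odot> (v Pb \<otimes> v Pd)" "v Pb \<otimes> v Pc = v Pc \<otimes> v Pb"
      "v Pc \<otimes> v Pd = complex_of_real q \<odot> (v Pd \<otimes> v Pc)"
      "v Pc \<otimes> v Pa = complex_of_real (1 / q) \<odot> (v Pa \<otimes> v Pc)"
      using r True by (simp_all add: pol_rels_def Pol0_rels_def Let_def e c m_assoc)
    show ?thesis using r1 *[OF r1(4)] *[OF r1(7)] True c by (simp add: pq_gens_def)
  next
    case False
    then have m: "\<mu> = 1 \<or> \<mu> = - 1" using \<mu> by auto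
    have r1: "v Pa \<otimes> v Pb = complex_of_real q \<odot> (v Pb \<otimes> v Pa)"
      "v Pa \<otimes> v Pc = complex_of_real q \<odot> (v Pc \<otimes> v Pa)"
      "v Pb \<otimes> v Pd = complex_of_real q \<odot> (v Pd \<otimes> v Pb)"
      "v Pc \<otimes> v Pd = complex_of_real q \<odot> (v Pd \<otimes> v Pc)"
      "v Pb \<otimes> v Pc = v Pc \<otimes> v Pb"
      "v Pd \<otimes> v Pa = complex_of_real (1 / q) \<odot> (v Pc \<otimes> v Pb) \<oplus> \<one>"
      "v Pa \<otimes> v Pd = complex_of_real q \<odot> (v Pb \<otimes> v Pc) \<oplus> \<one>"
      using r False by (simp_all add: pol_rels_def SL_rels_def Let_def e c m_assoc minus_eq_iff)
    show ?thesis using m r1 c q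
      by (elim disjE) (simp_all add: pq_gens_def a_comm power2_eq_square)
  qed
qed

end

text \<open>For \<mu> = 0 the relations were closed under adjoints by definition, and a double
  adjoint gives back the relation. For \<mu> = 1 or -1 the adjoint of every relation is a scalar
  multiple of a relation, by \<mu>^2 = 1.\<close>

lemma pol_presentation:
  assumes \<mu>: "\<mu> \<in> {-1, 0, 1}" and q: "q \<noteq> 0"
  shows "star_presentation (pol_star q \<mu>) (pol_rels q \<mu>)"
proof -
  let ?F = "free_star_alg (pol_star q \<mu>)"
  let ?I = "Idl\<^bsub>?F\<^esub> (pol_rels q \<mu>)"
  interpret F: complex_star_algebra ?F by (rule complex_star_algebra_free)
  interpret I: ideal ?I ?F by (rule F.genideal_ideal) simp
  have mem: "f * r \<in> ?I" if "r \<in> pol_rels q \<mu>" for f r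
    using I.I_l_closed[of r f] F.genideal_self[of "pol_rels q \<mu>"] that by auto
  show ?thesis
  proof
    fix r assume r: "r \<in> pol_rels q \<mu>"
    show "star ?F r \<in> ?I"
    proof (cases "\<mu> = 0")
      case True
      have inv: "star ?F (star ?F r) = r" if "r \<in> Pol0_rels q" for r
        using that True by (auto simp: Pol0_rels_def Let_def cst_simps mult.assoc)
      have "star ?F r \<in> pol_rels q \<mu>"
        using r inv True by (auto simp: pol_rels_def)
      then show ?thesis using mem[of _ 1] by simp
    next
      case False
      have mu: "\<mu> * \<mu> = 1" using \<mu> False by auto
      from r False consider
          "r = gen Pa * gen Pb - cst q * gen Pb * gen Pa"
        | "r = gen Pa * gen Pc - cst q * gen Pc * gen Pa"
        | "r = gen Pb * gen Pd - cst q * gen Pd * gen Pb"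
        | "r = gen Pc * gen Pd - cst q * gen Pd * gen Pc"
        | "r = gen Pb * gen Pc - gen Pc * gen Pb"
        | "r = gen Pd * gen Pa - cst (1 / q) * gen Pc * gen Pb - 1"
        | "r = gen Pa * gen Pd - cst q * gen Pb * gen Pc - 1"
        by (auto simp: pol_rels_def SL_rels_def Let_def)
      then have "\<exists>c. \<exists>r'\<in>pol_rels q \<mu>. star ?F r = cst c * r'"
      proof cases
        case 1
        with q False show ?thesis
          by (intro exI[of _ "- \<mu> / q"] bexI[of _ "gen Pc * gen Pd - cst q * gen Pd * gen Pc"])
             (simp_all add: pol_rels_def SL_rels_def Let_def right_diff_distrib mult.assoc cst_simps)
      next
        case 2
        with q False show ?thesis
          by (intro exI[of _ "- q * \<mu>"] bexI[of _ "gen Pb * gen Pd - cst q * gen Pd * gen Pb"])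
             (simp_all add: pol_rels_def SL_rels_def Let_def right_diff_distrib mult.assoc cst_simps
               mult.commute[of \<mu>])
      next
        case 3
        with q False show ?thesis
          by (intro exI[of _ "- \<mu> / q"] bexI[of _ "gen Pa * gen Pc - cst q * gen Pc * gen Pa"])
             (simp_all add: pol_rels_def SL_rels_def Let_def right_diff_distrib mult.assoc cst_simps)
      next
        case 4
        with q False show ?thesis
          by (intro exI[of _ "- q * \<mu>"] bexI[of _ "gen Pa * gen Pb - cst q * gen Pb * gen Pa"])
             (simp_all add: pol_rels_def SL_rels_def Let_def right_diff_distrib mult.assoc cst_simps
               mult.commute[of \<mu>])
      next
        case 5
        with q False mu show ?thesis
          by (intro exI[of _ 1] bexI[of _ r])
             (simp_all add: pol_rels_def SL_rels_def Let_def mult.assoc cst_simps)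
      next
        case 6
        with q False mu show ?thesis
          by (intro exI[of _ 1] bexI[of _ r])
             (simp_all add: pol_rels_def SL_rels_def Let_def mult.assoc cst_simps)
      next
        case 7
        with q False mu show ?thesis
          by (intro exI[of _ 1] bexI[of _ r])
             (simp_all add: pol_rels_def SL_rels_def Let_def mult.assoc cst_simps)
      qed
      then show ?thesis using mem by fastforce
    qed
  qed
qed

text \<open>With c = -q\<mu> b^* and d = a^* the comultiplication is the matrix one for the rows (a,
  c) and (b, d). Dividing the formula for c by -q\<mu> gives the value at b^*, which still makes
  sense at \<mu> = 0, so a single computation covers all parameters.\<close>

lemma (in tensor_product) pq_gens_tensor:
  assumes x: "pq_gens A q \<mu> a b bs as" and y: "pq_gens B q \<mu> a' b' bs' as'"
  shows "pq_gens (tensor A B) q \<mu>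
    (te a a' \<oplus>\<^bsub>tensor A B\<^esub> complex_of_real (- q * \<mu>) \<odot>\<^bsub>tensor A B\<^esub> te bs b')
    (te b a' \<oplus>\<^bsub>tensor A B\<^esub> te as b')
    (te bs as' \<oplus>\<^bsub>tensor A B\<^esub> te a bs')
    (te as as' \<oplus>\<^bsub>tensor A B\<^esub> complex_of_real (- q * \<mu>) \<odot>\<^bsub>tensor A B\<^esub> te b bs')"
proof -
  note xr = pq_gensD[OF x] and yr = pq_gensD[OF y]
  show ?thesis
    unfolding pq_gens_def
    by (intro conjI; (simp add: xr(1-4) yr(1-4); fail)?;
        simp add: xr yr T.l_distr T.r_distr te_mult te_one te_smult_left te_smult_right
            T.smult_add_right te_add_left te_add_right;
        rule T.lin_eqI, ((rule T.formal_intros | (simp add: xr(1-4) yr(1-4); fail))+)[2],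
        simp add: algebra_simps power2_eq_square)
qed


lemma pol_star_algebra:
  assumes "\<mu> \<in> {-1, 0, 1}" "q \<noteq> 0"
  shows "complex_star_algebra (pol_alg q \<mu>)"
proof -
  interpret star_presentation "pol_star q \<mu>" "pol_rels q \<mu>" by (rule pol_presentation) fact+
  show ?thesis unfolding pol_alg_def by (rule Q.complex_star_algebra_axioms)
qed

lemma pol_gens:
  assumes \<mu>: "\<mu> \<in> {-1, 0, 1}" and q: "q \<noteq> 0"
  defines "P \<equiv> pol_alg q \<mu>" and "x \<equiv> pol_gen q \<mu>"
  shows "pq_gens P q \<mu> (x Pa) (x Pb) (star P (x Pb)) (x Pd)"
    and "star P (x Pa) = x Pd" "star P (x Pd) = x Pa" "star P (star P (x Pb)) = x Pb"
    and "x Pc = (if \<mu> = 0 then star P (x Pb) else complex_of_real (- q * \<mu>) \<odot>\<^bsub>P\<^esub> star P (x Pb))"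
    and "x Pc \<in> carrier P"
proof -
  interpret star_presentation "pol_star q \<mu>" "pol_rels q \<mu>" by (rule pol_presentation) fact+
  have x: "x = (\<lambda>g. cls (gen g))" by (simp add: x_def pol_gen_def fun_eq_iff)
  have P: "P = presented (pol_star q \<mu>) (pol_rels q \<mu>)" by (simp add: P_def pol_alg_def)
  show xc: "x Pc \<in> carrier P" by (simp add: x P)
  show "star P (x Pa) = x Pd" "star P (x Pd) = x Pa" by (simp_all add: x P cls_simps)
  have cst: "cls (cst c * f) = complex_of_real c \<odot>\<^bsub>P\<^esub> cls f" for c f
    by (simp add: P cst_def cls_simps)
  have bs: "star P (x Pb) = (if \<mu> = 0 then x Pc else complex_of_real (- \<mu> / q) \<odot>\<^bsub>P\<^esub> x Pc)"
    by (simp add: x P cls_simps cst_def)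
  have cs: "star P (x Pc) = (if \<mu> = 0 then x Pb else complex_of_real (- q * \<mu>) \<odot>\<^bsub>P\<^esub> x Pb)"
    by (simp add: x P cls_simps cst_def)
  \<comment> \<open>Applying the star twice to b produces the factor (-\<mu>/q) (-q\<mu>) =
    \<mu>^2.\<close>
  have mu: "\<mu> = 0 \<or> \<mu> * \<mu> = 1" using \<mu> by auto
  then have mu': "\<mu> = 0 \<or> complex_of_real \<mu> * complex_of_real \<mu> = 1"
    by (metis of_real_1 of_real_mult)
  have xb: "x Pb \<in> carrier P" by (simp add: x P)
  show "pq_gens P q \<mu> (x Pa) (x Pb) (star P (x Pb)) (x Pd)"
    unfolding bs unfolding P by (rule Q.pol_rels_pq_gens[OF \<mu> q]) (auto simp: x cls_rel)
  interpret P: complex_star_algebra P unfolding P by (rule Q.complex_star_algebra_axioms)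
  show "star P (star P (x Pb)) = x Pb"
  proof (cases "\<mu> = 0")
    case True
    show ?thesis unfolding bs if_P[OF True] cs ..
  next
    case False
    then show ?thesis using mu' q xb xc by (simp only: bs cs if_False) (simp add: cs)
  qed
  show "x Pc = (if \<mu> = 0 then star P (x Pb) else complex_of_real (- q * \<mu>) \<odot>\<^bsub>P\<^esub> star P (x Pb))"
  proof (cases "\<mu> = 0")
    case True
    show ?thesis unfolding bs if_P[OF True] ..
  next
    case False
    then show ?thesis using mu' q xb xc by (simp add: bs)
  qed
qed

text \<open>Uses b^* where the presentation has the letter c, so that inductions over Pol_q(\<mu>)
  need no case distinction on \<mu>.\<close>

lemma pol_induct [consumes 3, case_names one a b bs as smult add mult]:
  assumes \<mu>: "\<mu> \<in> {-1, 0, 1}" and q: "q \<noteq> 0" and x: "x \<in> carrier (pol_alg q \<mu>)"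
    and one: "Q \<one>\<^bsub>pol_alg q \<mu>\<^esub>" and a: "Q (pol_gen q \<mu> Pa)" and b: "Q (pol_gen q \<mu> Pb)"
    and bs: "Q (star (pol_alg q \<mu>) (pol_gen q \<mu> Pb))" and as: "Q (pol_gen q \<mu> Pd)"
    and smult: "\<And>c x. x \<in> carrier (pol_alg q \<mu>) \<Longrightarrow> Q x \<Longrightarrow> Q (c \<odot>\<^bsub>pol_alg q \<mu>\<^esub> x)"
    and add: "\<And>x y. x \<in> carrier (pol_alg q \<mu>) \<Longrightarrow> y \<in> carrier (pol_alg q \<mu>) \<Longrightarrow>
      Q x \<Longrightarrow> Q y \<Longrightarrow> Q (x \<oplus>\<^bsub>pol_alg q \<mu>\<^esub> y)"
    and mult: "\<And>x y. x \<in> carrier (pol_alg q \<mu>) \<Longrightarrow> y \<in> carrier (pol_alg q \<mu>) \<Longrightarrow>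
      Q x \<Longrightarrow> Q y \<Longrightarrow> Q (x \<otimes>\<^bsub>pol_alg q \<mu>\<^esub> y)"
  shows "Q x"
proof -
  interpret star_presentation "pol_star q \<mu>" "pol_rels q \<mu>" by (rule pol_presentation) fact+
  have "Q (pol_gen q \<mu> Pc)"
    using bs smult[OF pq_gensD(3)[OF pol_gens(1)[OF \<mu> q]] bs, of "complex_of_real (- q * \<mu>)"]
    by (metis pol_gens(5)[OF \<mu> q])
  with a b as have g: "Q (pol_gen q \<mu> g)" for g by (cases g) auto
  show ?thesis
    using x one g smult add mult unfolding pol_alg_def pol_gen_def
    by (rule presented_induct)
qed

lemma pol_lift:
  assumes \<mu>: "\<mu> \<in> {-1, 0, 1}" and q: "q \<noteq> 0" and B: "complex_algebra B"
    and p: "pq_gens B q \<mu> a b bs as"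
  defines "h \<equiv> pres_lift B (pol_letter B q \<mu> a b bs as)"
  shows "alg_hom (pol_alg q \<mu>) B h"
    and "h (pol_gen q \<mu> Pa) = a" "h (pol_gen q \<mu> Pb) = b"
    "h (star (pol_alg q \<mu>) (pol_gen q \<mu> Pb)) = bs" "h (pol_gen q \<mu> Pd) = as"
proof -
  interpret star_presentation "pol_star q \<mu>" "pol_rels q \<mu>" by (rule pol_presentation) fact+
  interpret B: complex_algebra B by fact
  note rels = B.pq_gens_pol_rels[OF \<mu> q p]
  show hom: "alg_hom (pol_alg q \<mu>) B h"
    unfolding pol_alg_def h_def by (rule pres_lift_hom[OF B rels])
  have g: "h (pol_gen q \<mu> g) = pol_letter B q \<mu> a b bs as g" for g
    unfolding h_def pol_gen_def
    by (subst pres_lift_cls[OF B rels]) (simp_all add: B.free_eval_simps rels)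
  show "h (pol_gen q \<mu> Pa) = a" "h (pol_gen q \<mu> Pb) = b" "h (pol_gen q \<mu> Pd) = as"
    by (simp_all add: g pol_letter_def)
  note bsc = pq_gensD(3)[OF pol_gens(1)[OF \<mu> q]]
  show "h (star (pol_alg q \<mu>) (pol_gen q \<mu> Pb)) = bs"
  proof (cases "\<mu> = 0")
    case True
    then have "star (pol_alg q \<mu>) (pol_gen q \<mu> Pb) = pol_gen q \<mu> Pc" by (metis pol_gens(5)[OF \<mu> q])
    then have "h (star (pol_alg q \<mu>) (pol_gen q \<mu> Pb)) = pol_letter B q \<mu> a b bs as Pc"
      by (simp only: g)
    with True show ?thesis by (simp add: pol_letter_def)
  next
    case False
    \<comment> \<open>The lift is prescribed on the letter c = -q\<mu> b^*; its value at b^* is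
      recovered by cancelling the nonzero factor.\<close>
    then have "complex_of_real (- q * \<mu>) \<odot>\<^bsub>B\<^esub> h (star (pol_alg q \<mu>) (pol_gen q \<mu> Pb)) = h (pol_gen q \<mu> Pc)"
      using alg_homD(5)[OF hom bsc] by (simp add: pol_gens(5)[OF \<mu> q])
    also have "\<dots> = complex_of_real (- q * \<mu>) \<odot>\<^bsub>B\<^esub> bs" using False by (simp add: g pol_letter_def)
    finally show ?thesis
      using False q alg_homD(1)[OF hom bsc] pq_gensD(3)[OF p] by (elim B.smult_cancel[rotated 3]) auto
  qed
qed

lemma pol_comul:
  assumes \<mu>: "\<mu> \<in> {-1, 0, 1}" and q: "q \<noteq> 0"
  defines "P \<equiv> pol_alg q \<mu>" and "a \<equiv> pol_gen q \<mu> Pa" and "b \<equiv> pol_gen q \<mu> Pb" and "as \<equiv> pol_gen q \<mu> Pd"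
  defines "bs \<equiv> star P b" and "t \<equiv> tens P P" and "T \<equiv> tensor P P"
  shows "alg_hom P T (pol_comul q \<mu>)"
    and "pol_comul q \<mu> a = t a a \<oplus>\<^bsub>T\<^esub> complex_of_real (- q * \<mu>) \<odot>\<^bsub>T\<^esub> t bs b"
    and "pol_comul q \<mu> b = t b a \<oplus>\<^bsub>T\<^esub> t as b"
    and "pol_comul q \<mu> bs = t bs as \<oplus>\<^bsub>T\<^esub> t a bs"
    and "pol_comul q \<mu> as = t as as \<oplus>\<^bsub>T\<^esub> complex_of_real (- q * \<mu>) \<odot>\<^bsub>T\<^esub> t b bs"
proof -
  interpret P: complex_star_algebra P unfolding P_def by (rule pol_star_algebra) fact+
  interpret tensor_product P P ..
  note g = pol_gens[OF \<mu> q, folded P_def a_def b_def as_def bs_def]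
  note gc [simp] = pq_gensD(1-4)[OF g(1)]
  note p = pq_gens_tensor[OF g(1) g(1), folded t_def T_def]
  have tc [simp]: "\<And>x y. x \<in> carrier P \<Longrightarrow> y \<in> carrier P \<Longrightarrow> t x y \<in> carrier T" by (simp add: t_def T_def)
  \<comment> \<open>The definition distinguishes \<mu> = 0, while the family on the right does not:
    its additional terms carry the factor \<mu> and vanish in that case.\<close>
  have eq: "pol_comul q \<mu> = pres_lift T (pol_letter T q \<mu>
    (t a a \<oplus>\<^bsub>T\<^esub> complex_of_real (- q * \<mu>) \<odot>\<^bsub>T\<^esub> t bs b) (t b a \<oplus>\<^bsub>T\<^esub> t as b)
    (t bs as \<oplus>\<^bsub>T\<^esub> t a bs) (t as as \<oplus>\<^bsub>T\<^esub> complex_of_real (- q * \<mu>) \<odot>\<^bsub>T\<^esub> t b bs))"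
  proof -
    have sm: "t (c \<odot>\<^bsub>P\<^esub> x) y = c \<odot>\<^bsub>T\<^esub> t x y" "t x (c \<odot>\<^bsub>P\<^esub> y) = c \<odot>\<^bsub>T\<^esub> t x y"
      if "x \<in> carrier P" "y \<in> carrier P" for c x y
      using that by (simp_all add: t_def T_def te_smult_left te_smult_right)
    have st: "star T (t x y) = t (star P x) (star P y)" if "x \<in> carrier P" "y \<in> carrier P" for x y
      using that by (simp add: t_def T_def te_star)
    have Tfacts: "star T (x \<oplus>\<^bsub>T\<^esub> y) = star T x \<oplus>\<^bsub>T\<^esub> star T y" "x \<oplus>\<^bsub>T\<^esub> y = y \<oplus>\<^bsub>T\<^esub> x"
      "c \<odot>\<^bsub>T\<^esub> (x \<oplus>\<^bsub>T\<^esub> y) = c \<odot>\<^bsub>T\<^esub> x \<oplus>\<^bsub>T\<^esub> c \<odot>\<^bsub>T\<^esub> y"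
      if "x \<in> carrier T" "y \<in> carrier T" for x y c
      using that by (simp_all add: T_def T.a_comm T.smult_add_right)
    have Tsm: "c \<odot>\<^bsub>T\<^esub> x \<in> carrier T" if "x \<in> carrier T" for c x
      using that by (simp add: T_def)
    have Tzero: "x \<oplus>\<^bsub>T\<^esub> 0 \<odot>\<^bsub>T\<^esub> y = x" if "x \<in> carrier T" "y \<in> carrier T" for x y
      using that by (simp add: T_def)
    show ?thesis
    proof (cases "\<mu> = 0")
      case True
      show ?thesis
        unfolding pol_comul_def Let_def P_def[symmetric] t_def[symmetric] T_def[symmetric]
          a_def[symmetric] b_def[symmetric] as_def[symmetric] if_P[OF True]
        using True
        by (intro arg_cong[where f = "pres_lift T"], intro ext)
           (simp add: pol_letter_def st Tfacts(1,2) Tzero g(2-4) bs_def[symmetric] split: pgen.split)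
    next
      case False
      have c: "pol_gen q \<mu> Pc = complex_of_real (- q * \<mu>) \<odot>\<^bsub>P\<^esub> bs" using False g(5) by simp
      show ?thesis
        unfolding pol_comul_def Let_def P_def[symmetric] t_def[symmetric] T_def[symmetric]
          a_def[symmetric] b_def[symmetric] as_def[symmetric] c if_not_P[OF False]
        using False
        by (intro arg_cong[where f = "pres_lift T"], intro ext)
           (simp add: pol_letter_def sm Tfacts(2,3) Tsm split: pgen.split)
    qed
  qed
  note l = pol_lift[OF \<mu> q _ p, folded eq P_def a_def b_def as_def, folded bs_def]
  have TA: "complex_algebra T" unfolding T_def by (rule T.complex_algebra_axioms)
  show "alg_hom P T (pol_comul q \<mu>)" by (rule l(1)[OF TA])
  show "pol_comul q \<mu> a = t a a \<oplus>\<^bsub>T\<^esub> complex_of_real (- q * \<mu>) \<odot>\<^bsub>T\<^esub> t bs b" by (rule l(2)[OF TA])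
  show "pol_comul q \<mu> b = t b a \<oplus>\<^bsub>T\<^esub> t as b" by (rule l(3)[OF TA])
  show "pol_comul q \<mu> bs = t bs as \<oplus>\<^bsub>T\<^esub> t a bs" by (rule l(4)[OF TA])
  show "pol_comul q \<mu> as = t as as \<oplus>\<^bsub>T\<^esub> complex_of_real (- q * \<mu>) \<odot>\<^bsub>T\<^esub> t b bs" by (rule l(5)[OF TA])
qed

lemma pol_counit:
  assumes \<mu>: "\<mu> \<in> {-1, 0, 1}" and q: "q \<noteq> 0"
  shows "alg_hom (pol_alg q \<mu>) complex_alg pol_counit"
    and "pol_counit (pol_gen q \<mu> Pa) = 1" "pol_counit (pol_gen q \<mu> Pb) = 0"
    "pol_counit (star (pol_alg q \<mu>) (pol_gen q \<mu> Pb)) = 0" "pol_counit (pol_gen q \<mu> Pd) = 1"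
proof -
  have p: "pq_gens complex_alg q \<mu> 1 0 0 1" by (simp add: pq_gens_def)
  have eq: "pol_counit = pres_lift complex_alg (pol_letter complex_alg q \<mu> 1 0 0 1)"
    unfolding pol_counit_def
    by (intro arg_cong[where f = "pres_lift complex_alg"] ext)
       (simp add: pol_letter_def split: pgen.split)
  show "alg_hom (pol_alg q \<mu>) complex_alg pol_counit"
    "pol_counit (pol_gen q \<mu> Pa) = 1" "pol_counit (pol_gen q \<mu> Pb) = 0"
    "pol_counit (star (pol_alg q \<mu>) (pol_gen q \<mu> Pb)) = 0" "pol_counit (pol_gen q \<mu> Pd) = 1"
    unfolding eq by (rule pol_lift[OF \<mu> q complex_algebra_complex_alg p])+
qed

lemma Pol_hopf_simps [simp]:
  "carrier (Pol_hopf q \<mu>) = carrier (pol_alg q \<mu>)" "mult (Pol_hopf q \<mu>) = mult (pol_alg q \<mu>)"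
  "add (Pol_hopf q \<mu>) = add (pol_alg q \<mu>)" "one (Pol_hopf q \<mu>) = one (pol_alg q \<mu>)"
  "zero (Pol_hopf q \<mu>) = zero (pol_alg q \<mu>)" "smult (Pol_hopf q \<mu>) = smult (pol_alg q \<mu>)"
  "star (Pol_hopf q \<mu>) = star (pol_alg q \<mu>)" "comul (Pol_hopf q \<mu>) = pol_comul q \<mu>"
  "counit (Pol_hopf q \<mu>) = pol_counit"
  by (simp_all add: Pol_hopf_def star_alg.defs hopf_star_alg.defs)

lemma U_hopf_simps [simp]:
  "carrier (U_hopf q \<mu>) = carrier (U_alg q \<mu> \<mu>)" "mult (U_hopf q \<mu>) = mult (U_alg q \<mu> \<mu>)"
  "add (U_hopf q \<mu>) = add (U_alg q \<mu> \<mu>)" "one (U_hopf q \<mu>) = one (U_alg q \<mu> \<mu>)"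
  "zero (U_hopf q \<mu>) = zero (U_alg q \<mu> \<mu>)" "smult (U_hopf q \<mu>) = smult (U_alg q \<mu> \<mu>)"
  "star (U_hopf q \<mu>) = star (U_alg q \<mu> \<mu>)" "comul (U_hopf q \<mu>) = U_comul q \<mu> \<mu> \<mu>"
  "antipode (U_hopf q \<mu>) = U_antipode q \<mu> \<mu>"
  by (simp_all add: U_hopf_def star_alg.defs hopf_star_alg.defs)

text \<open>A tensor product depends only on the star-algebra fields of its factors, so the fields
  added for the Hopf structure do not affect it.\<close>

lemma tensor_Pol_hopf:
  "tensor (Pol_hopf q \<mu>) B = tensor (pol_alg q \<mu>) B" "tens (Pol_hopf q \<mu>) B = tens (pol_alg q \<mu>) B"
  "tensor B (Pol_hopf q \<mu>) = tensor B (pol_alg q \<mu>)" "tens B (Pol_hopf q \<mu>) = tens B (pol_alg q \<mu>)"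
  by (simp_all add: tensor_def tens_def pre_tensor_def bilin_rels_def fun_eq_iff)

section \<open>The action on $A_{\mu\nu}^\tau$\<close>

lemma alg_hom_uq_gens:
  assumes "complex_algebra A" "complex_algebra B" "alg_hom A B f" "uq_gens A q \<mu> \<nu> v"
  shows "uq_gens B q \<mu> \<nu> (\<lambda>g. f (v g))"
proof -
  interpret A: complex_algebra A by fact
  interpret B: complex_algebra B by fact
  have c: "v g \<in> carrier A" for g using assms(4) by (simp add: uq_gens_def)
  note h = alg_homD[OF assms(3)]
  note rel = assms(4)[unfolded uq_gens_def]
  show ?thesis
    unfolding uq_gens_def
  proof (intro conjI allI)
    show "f (v GKi) \<otimes>\<^bsub>B\<^esub> f (v GK) = \<one>\<^bsub>B\<^esub>" "f (v GK) \<otimes>\<^bsub>B\<^esub> f (v GKi) = \<one>\<^bsub>B\<^esub>"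
      using rel c h by metis+
  qed (use rel in \<open>auto simp: c h(1) h(2,3,5)[symmetric]\<close>)
qed

lemma (in complex_star_algebra) star_subalg_algebra:
  assumes "star_subalg A S"
  shows "complex_star_algebra (A\<lparr>carrier := S\<rparr>)"
proof -
  have S: "subring S A" "\<And>c x. x \<in> S \<Longrightarrow> c \<odot> x \<in> S" "\<And>x. x \<in> S \<Longrightarrow> star A x \<in> S"
    using assms by (auto simp: star_subalg_def)
  note R = subring_is_ring[OF S(1)] and sub = subringE(1)[OF S(1)]
  with S show ?thesis
    by (intro complex_star_algebra.intro complex_algebra.intro complex_algebra_axioms.intro
          complex_star_algebra_axioms.intro)
       (auto simp: smult_add_left smult_add_right subset_iff)
qed

locale uq_action =
  fixes q \<mu> \<nu> \<tau> :: real
  assumes q0: "0 < q" and q1: "q < 1"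
begin

lemma qnz [simp]: "q \<noteq> 0" using q0 by simp

abbreviation "U \<equiv> U_alg q \<mu> \<nu>"
abbreviation "V \<equiv> U_alg q \<nu> \<mu>"
abbreviation "H \<equiv> U_alg q \<mu> \<mu>"
abbreviation "A \<equiv> A_alg q \<mu> \<nu> \<tau>"
abbreviation "\<pi> \<equiv> A_proj q \<mu> \<nu> \<tau>"

sublocale U: complex_star_algebra U by (rule U_star_algebra) simp
sublocale V: complex_star_algebra V by (rule U_star_algebra) simp
sublocale H: complex_star_algebra H by (rule U_star_algebra) simp
sublocale UV: tensor_product U V ..
sublocale HH: tensor_product H H ..

lemmas U_rules = U.uq_gens_rules[OF U_gens[OF qnz] qnz]

abbreviation "cas \<equiv> casimir q \<mu> \<nu> \<ominus>\<^bsub>U\<^esub> complex_of_real (\<tau> / q * (lam q)\<^sup>2) \<odot>\<^bsub>U\<^esub> \<one>\<^bsub>U\<^esub>"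

lemma casimir_closed [simp]: "casimir q \<mu> \<nu> \<in> carrier U"
  by (simp add: casimir_def Let_def U_rules(1))

lemma star_cas: "star U cas = cas"
  by (simp add: casimir_def Let_def U_rules(1) U.a_minus_eq_smult U_star_gen)

sublocale I: star_ideal "A_ideal q \<mu> \<nu> \<tau>" U
proof -
  have sub: "{cas} \<subseteq> carrier U" by simp
  show "star_ideal (A_ideal q \<mu> \<nu> \<tau>) U"
    unfolding A_ideal_def Let_def
  proof (rule U.star_ideal_genideal[OF sub])
    fix r assume "r \<in> {cas}"
    then have "star U r = cas" by (simp only: singleton_iff star_cas)
    then show "star U r \<in> Idl\<^bsub>U\<^esub> {cas}"
      using U.genideal_self[OF sub] by (simp only: insert_subset)
  qed
qed

sublocale A: complex_star_algebra A
  unfolding A_alg_def by (rule I.quot_algebra)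

lemma proj_hom: "alg_hom U A \<pi>"
  using I.quot_hom by (simp add: A_alg_def A_proj_def[abs_def])

lemmas proj = alg_homD[OF proj_hom]

lemma proj_star: "y \<in> carrier U \<Longrightarrow> star A (\<pi> y) = \<pi> (star U y)"
  by (simp add: A_alg_def A_proj_def)

lemma carrier_A: "carrier A = \<pi> ` carrier U"
  by (simp add: A_alg_def A_proj_def[abs_def] I.quot_carrier)

definition gen_A :: "ugen \<Rightarrow> U set" where
  "gen_A g = \<pi> (U_gen q \<mu> \<nu> g)"

lemma gen_A: "uq_gens A q \<mu> \<nu> gen_A"
  unfolding gen_A_def[abs_def]
  by (rule alg_hom_uq_gens[OF U.complex_algebra_axioms A.complex_algebra_axioms proj_hom U_gens[OF qnz]])

lemmas A_rules [simp] = A.uq_gens_rules[OF gen_A qnz]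

lemma gen_A_star [simp]:
  "star A (gen_A GK) = gen_A GK" "star A (gen_A GKi) = gen_A GKi" "star A (gen_A GE) = gen_A GF" "star A (gen_A GF) = gen_A GE"
  by (simp_all add: gen_A_def proj_star U_rules(1) U_star_gen)

lemma casimir_A:
  "gen_A GE \<otimes>\<^bsub>A\<^esub> gen_A GF = complex_of_real (\<tau> / q * (lam q)\<^sup>2) \<odot>\<^bsub>A\<^esub> \<one>\<^bsub>A\<^esub> \<oplus>\<^bsub>A\<^esub>
     (complex_of_real (- (lam q)\<^sup>2 * \<mu> / q) \<odot>\<^bsub>A\<^esub> (gen_A GK \<otimes>\<^bsub>A\<^esub> gen_A GK) \<oplus>\<^bsub>A\<^esub>
      complex_of_real (- (lam q)\<^sup>2 * q * \<nu>) \<odot>\<^bsub>A\<^esub> (gen_A GKi \<otimes>\<^bsub>A\<^esub> gen_A GKi))"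
proof -
  have "cas \<in> A_ideal q \<mu> \<nu> \<tau>"
    using U.genideal_self[of "{cas}"] by (auto simp: A_ideal_def Let_def)
  then have "\<pi> (casimir q \<mu> \<nu>) = \<pi> (complex_of_real (\<tau> / q * (lam q)\<^sup>2) \<odot>\<^bsub>U\<^esub> \<one>\<^bsub>U\<^esub>)"
    unfolding A_proj_def by (subst I.coset_eq_iff) auto
  then have *: "gen_A GE \<otimes>\<^bsub>A\<^esub> gen_A GF \<oplus>\<^bsub>A\<^esub> complex_of_real ((lam q)\<^sup>2) \<odot>\<^bsub>A\<^esub>
        (complex_of_real (\<mu> / q) \<odot>\<^bsub>A\<^esub> (gen_A GK \<otimes>\<^bsub>A\<^esub> gen_A GK) \<oplus>\<^bsub>A\<^esub>
         complex_of_real (q * \<nu>) \<odot>\<^bsub>A\<^esub> (gen_A GKi \<otimes>\<^bsub>A\<^esub> gen_A GKi)) =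
      complex_of_real (\<tau> / q * (lam q)\<^sup>2) \<odot>\<^bsub>A\<^esub> \<one>\<^bsub>A\<^esub>" (is "?e \<oplus>\<^bsub>A\<^esub> ?r = ?s")
    by (simp only: casimir_def Let_def proj U_rules(1) U.m_closed U.smult_closed U.a_closed U.one_closed gen_A_def)
  have c: "?e \<in> carrier A" "?r \<in> carrier A" "?s \<in> carrier A"
    by (intro A.m_closed A.smult_closed A.a_closed A.one_closed A_rules(1))+
  then have "?e = ?s \<oplus>\<^bsub>A\<^esub> (- 1) \<odot>\<^bsub>A\<^esub> ?r"
    unfolding *[symmetric] by (simp only: A.a_minus_eq_smult[symmetric] A.a_closed) (simp add: a_minus_def A.a_assoc A.r_neg del: A_rules(8))
  then show ?thesis
    by (simp only: A.smult_add_right A.smult_smult A.smult_closed A.m_closed A_rules(1)) (simp add: mult.assoc)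
qed

section \<open>The adjoint action on A as a module star-algebra\<close>

definition antipode_A :: "U \<Rightarrow> U set" where
  "antipode_A w = \<pi> (U_antipode q \<nu> \<mu> w)"

lemma antipode_A [simp]:
  "w \<in> carrier V \<Longrightarrow> antipode_A w \<in> carrier A"
  "w \<in> carrier V \<Longrightarrow> w' \<in> carrier V \<Longrightarrow> antipode_A (w \<oplus>\<^bsub>V\<^esub> w') = antipode_A w \<oplus>\<^bsub>A\<^esub> antipode_A w'"
  "w \<in> carrier V \<Longrightarrow> w' \<in> carrier V \<Longrightarrow> antipode_A (w \<otimes>\<^bsub>V\<^esub> w') = antipode_A w' \<otimes>\<^bsub>A\<^esub> antipode_A w"
  "antipode_A \<one>\<^bsub>V\<^esub> = \<one>\<^bsub>A\<^esub>"
  "w \<in> carrier V \<Longrightarrow> antipode_A (c \<odot>\<^bsub>V\<^esub> w) = c \<odot>\<^bsub>A\<^esub> antipode_A w"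
  using alg_homD[OF U_antipode(1)[OF qnz, of \<nu> \<mu>], simplified] by (simp_all add: antipode_A_def proj)

lemma antipode_A_gen [simp]:
  "antipode_A (U_gen q \<nu> \<mu> GK) = gen_A GKi" "antipode_A (U_gen q \<nu> \<mu> GKi) = gen_A GK"
  "antipode_A (U_gen q \<nu> \<mu> GE) = complex_of_real (- q) \<odot>\<^bsub>A\<^esub> gen_A GE"
  "antipode_A (U_gen q \<nu> \<mu> GF) = complex_of_real (- 1 / q) \<odot>\<^bsub>A\<^esub> gen_A GF"
  unfolding antipode_A_def U_antipode[OF qnz] by (simp_all add: gen_A_def proj U_rules(1))

text \<open>The two-sided multiplication u S S(w), as a function of an arbitrary tensor in
  U_q(\<mu>,\<nu>) \<otimes> U_q(\<nu>,\<mu>). Its properties can be proved on elementary tensors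
  before the comultiplication is inserted.\<close>

definition twist :: "U set \<Rightarrow> ((U \<times> U) \<Rightarrow>\<^sub>0 complex) set \<Rightarrow> U set" where
  "twist S = tensor_lift A (\<lambda>u w. \<pi> u \<otimes>\<^bsub>A\<^esub> S \<otimes>\<^bsub>A\<^esub> antipode_A w)"

lemma twist_bilinear:
  "S \<in> carrier A \<Longrightarrow> tensor_bilinear U V A (\<lambda>u w. \<pi> u \<otimes>\<^bsub>A\<^esub> S \<otimes>\<^bsub>A\<^esub> antipode_A w)"
  by (intro tensor_bilinear.intro tensor_bilinear_axioms.intro UV.tensor_product_axioms
      A.complex_algebra_axioms)
     (simp add: bilinear_map_def proj A.l_distr A.r_distr)

lemma twist [simp]:
  assumes "S \<in> carrier A"
  shows "t \<in> carrier (tensor U V) \<Longrightarrow> twist S t \<in> carrier A"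
    "u \<in> carrier U \<Longrightarrow> w \<in> carrier V \<Longrightarrow> twist S (tens U V u w) = \<pi> u \<otimes>\<^bsub>A\<^esub> (S \<otimes>\<^bsub>A\<^esub> antipode_A w)"
    "t \<in> carrier (tensor U V) \<Longrightarrow> t' \<in> carrier (tensor U V) \<Longrightarrow>
       twist S (t \<oplus>\<^bsub>tensor U V\<^esub> t') = twist S t \<oplus>\<^bsub>A\<^esub> twist S t'"
    "t \<in> carrier (tensor U V) \<Longrightarrow> twist S (c \<odot>\<^bsub>tensor U V\<^esub> t) = c \<odot>\<^bsub>A\<^esub> twist S t"
  unfolding twist_def using assms by (simp_all add: tensor_lift_simps[OF twist_bilinear[OF assms]] proj A.m_assoc)

lemma twist_linear:
  assumes "t \<in> carrier (tensor U V)" "S \<in> carrier A"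
  shows "S' \<in> carrier A \<Longrightarrow> twist (S \<oplus>\<^bsub>A\<^esub> S') t = twist S t \<oplus>\<^bsub>A\<^esub> twist S' t"
    and "twist (c \<odot>\<^bsub>A\<^esub> S) t = c \<odot>\<^bsub>A\<^esub> twist S t"
  using assms
  by (induction t rule: UV.tensor_induct)
     (simp_all add: proj A.l_distr A.r_distr A.smult_add_right A.a_ac)

lemma twist_mult_tens:
  assumes "t \<in> carrier (tensor U V)" "u \<in> carrier U" "w \<in> carrier V" "S \<in> carrier A"
  shows "twist S (tens U V u w \<otimes>\<^bsub>tensor U V\<^esub> t) = \<pi> u \<otimes>\<^bsub>A\<^esub> (twist S t \<otimes>\<^bsub>A\<^esub> antipode_A w)"
  using assms
  by (induction t rule: UV.tensor_induct)
     (simp_all add: proj A.l_distr A.r_distr UV.te_mult A.m_assoc UV.T.r_distr)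

text \<open>Because the antipode reverses products, multiplying tensors composes the two-sided
  multiplications; with the multiplicativity of the comultiplication this makes \<open>act\<close> a
  module structure.\<close>

lemma twist_mult:
  assumes "t \<in> carrier (tensor U V)" "t' \<in> carrier (tensor U V)" "S \<in> carrier A"
  shows "twist S (t \<otimes>\<^bsub>tensor U V\<^esub> t') = twist (twist S t') t"
  using assms
  by (induction t rule: UV.tensor_induct) (simp_all add: twist_mult_tens UV.T.l_distr)

definition act :: "U \<Rightarrow> U set \<Rightarrow> U set" where
  "act x S = twist S (U_comul q \<mu> \<nu> \<mu> x)"

lemmas comul_UV = alg_homD[OF U_comul(1)[OF qnz, where \<mu> = \<mu> and \<upsilon> = \<nu> and \<nu> = \<mu>]]
lemmas comul_HH = alg_homD[OF U_comul(1)[OF qnz, where \<mu> = \<mu> and \<upsilon> = \<mu> and \<nu> = \<mu>]]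

lemma act [simp]:
  assumes "S \<in> carrier A"
  shows "x \<in> carrier H \<Longrightarrow> act x S \<in> carrier A"
    "x \<in> carrier H \<Longrightarrow> x' \<in> carrier H \<Longrightarrow> act (x \<oplus>\<^bsub>H\<^esub> x') S = act x S \<oplus>\<^bsub>A\<^esub> act x' S"
    "x \<in> carrier H \<Longrightarrow> x' \<in> carrier H \<Longrightarrow> act (x \<otimes>\<^bsub>H\<^esub> x') S = act x (act x' S)"
    "x \<in> carrier H \<Longrightarrow> act (c \<odot>\<^bsub>H\<^esub> x) S = c \<odot>\<^bsub>A\<^esub> act x S"
    "act \<one>\<^bsub>H\<^esub> S = S"
  using assms by (simp_all add: act_def comul_UV twist_mult UV.te_one proj)

lemma act_linear [simp]:
  "x \<in> carrier H \<Longrightarrow> S \<in> carrier A \<Longrightarrow> S' \<in> carrier A \<Longrightarrow>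
    act x (S \<oplus>\<^bsub>A\<^esub> S') = act x S \<oplus>\<^bsub>A\<^esub> act x S'"
  "x \<in> carrier H \<Longrightarrow> S \<in> carrier A \<Longrightarrow> act x (c \<odot>\<^bsub>A\<^esub> S) = c \<odot>\<^bsub>A\<^esub> act x S"
  by (simp_all add: act_def comul_UV twist_linear)

lemma gen_closed [simp]:
  "U_gen q \<mu> \<nu> g \<in> carrier U" "U_gen q \<nu> \<mu> g \<in> carrier V" "U_gen q \<mu> \<mu> g \<in> carrier H"
  using U_gens[OF qnz] by (simp_all add: uq_gens_def)

lemma act_gen:
  assumes "S \<in> carrier A"
  shows "act (U_gen q \<mu> \<mu> GK) S = gen_A GK \<otimes>\<^bsub>A\<^esub> (S \<otimes>\<^bsub>A\<^esub> gen_A GKi)"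
    "act (U_gen q \<mu> \<mu> GKi) S = gen_A GKi \<otimes>\<^bsub>A\<^esub> (S \<otimes>\<^bsub>A\<^esub> gen_A GK)"
    "act (U_gen q \<mu> \<mu> GE) S = gen_A GE \<otimes>\<^bsub>A\<^esub> (S \<otimes>\<^bsub>A\<^esub> gen_A GKi) \<oplus>\<^bsub>A\<^esub>
      complex_of_real (- q) \<odot>\<^bsub>A\<^esub> (gen_A GKi \<otimes>\<^bsub>A\<^esub> (S \<otimes>\<^bsub>A\<^esub> gen_A GE))"
    "act (U_gen q \<mu> \<mu> GF) S = gen_A GF \<otimes>\<^bsub>A\<^esub> (S \<otimes>\<^bsub>A\<^esub> gen_A GKi) \<oplus>\<^bsub>A\<^esub>
      complex_of_real (- 1 / q) \<odot>\<^bsub>A\<^esub> (gen_A GKi \<otimes>\<^bsub>A\<^esub> (S \<otimes>\<^bsub>A\<^esub> gen_A GF))"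
  using assms by (simp_all add: act_def U_comul(2-)[OF qnz] flip: gen_A_def)

text \<open>As \<pi> is a homomorphism, the projected Miyashita-Ulbrich action of x on y depends on
  y only through \<pi> y. So every representative of the coset gives the same value, and
  \<open>the_elem\<close> is well defined.\<close>

lemma A_action_eq_act:
  assumes x: "x \<in> carrier H" and S: "S \<in> carrier A"
  shows "A_action q \<mu> \<nu> \<tau> x S = act x S"
proof -
  obtain y0 where y0: "y0 \<in> carrier U" "S = A_ideal q \<mu> \<nu> \<tau> +>\<^bsub>U\<^esub> y0"
    using S by (auto simp: carrier_A A_proj_def)
  have "\<pi> (MU_action q \<mu> \<nu> x y) = act x S" if y: "y \<in> S" for y
  proof -
    have yc: "y \<in> carrier U" "\<pi> y = S"
      using I.coset_elem[of y y0] y y0 by (auto simp: A_proj_def)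
    note sU = alg_homD[OF U_antipode(1)[OF qnz, of \<nu> \<mu>], simplified]
    interpret diag: tensor_bilinear U V U "\<lambda>u w. u \<otimes>\<^bsub>U\<^esub> y \<otimes>\<^bsub>U\<^esub> U_antipode q \<nu> \<mu> w"
      by (intro tensor_bilinear.intro tensor_bilinear_axioms.intro UV.tensor_product_axioms
          U.complex_algebra_axioms)
         (simp add: bilinear_map_def yc sU U.l_distr U.r_distr)
    have "\<pi> (tensor_lift U (\<lambda>u w. u \<otimes>\<^bsub>U\<^esub> y \<otimes>\<^bsub>U\<^esub> U_antipode q \<nu> \<mu> w) t) = twist S t"
      if "t \<in> carrier (tensor U V)" for t
      using that S by (induction t rule: UV.tensor_induct)
        (simp_all add: yc proj sU A.m_assoc flip: antipode_A_def)
    then show ?thesis using x by (simp add: MU_action_def Let_def act_def comul_UV)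
  qed
  moreover have "y0 \<in> S" using I.a_rcos_self y0 by simp
  ultimately have "(\<lambda>y. \<pi> (MU_action q \<mu> \<nu> x y)) ` S = {act x S}" by blast
  then show ?thesis by (simp add: A_action_def)
qed

definition diag :: "U set \<Rightarrow> U set \<Rightarrow> ((U \<times> U) \<Rightarrow>\<^sub>0 complex) set \<Rightarrow> U set" where
  "diag S S' = tensor_lift A (\<lambda>u w. act u S \<otimes>\<^bsub>A\<^esub> act w S')"

lemma diag_bilinear:
  "S \<in> carrier A \<Longrightarrow> S' \<in> carrier A \<Longrightarrow> tensor_bilinear H H A (\<lambda>u w. act u S \<otimes>\<^bsub>A\<^esub> act w S')"
  by (intro tensor_bilinear.intro tensor_bilinear_axioms.intro HH.tensor_product_axioms
      A.complex_algebra_axioms)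
     (simp add: bilinear_map_def A.l_distr A.r_distr)

lemma diag [simp]:
  assumes "S \<in> carrier A" "S' \<in> carrier A"
  shows "t \<in> carrier (tensor H H) \<Longrightarrow> diag S S' t \<in> carrier A"
    "u \<in> carrier H \<Longrightarrow> w \<in> carrier H \<Longrightarrow> diag S S' (tens H H u w) = act u S \<otimes>\<^bsub>A\<^esub> act w S'"
    "t \<in> carrier (tensor H H) \<Longrightarrow> t' \<in> carrier (tensor H H) \<Longrightarrow>
       diag S S' (t \<oplus>\<^bsub>tensor H H\<^esub> t') = diag S S' t \<oplus>\<^bsub>A\<^esub> diag S S' t'"
    "t \<in> carrier (tensor H H) \<Longrightarrow> diag S S' (c \<odot>\<^bsub>tensor H H\<^esub> t) = c \<odot>\<^bsub>A\<^esub> diag S S' t"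
  unfolding diag_def using assms by (simp_all add: tensor_lift_simps[OF diag_bilinear[OF assms]])

lemma diag_mult_tens:
  assumes "t \<in> carrier (tensor H H)" "u \<in> carrier H" "w \<in> carrier H" "S \<in> carrier A" "S' \<in> carrier A"
  shows "diag S S' (t \<otimes>\<^bsub>tensor H H\<^esub> tens H H u w) = diag (act u S) (act w S') t"
  using assms
  by (induction t rule: HH.tensor_induct) (simp_all add: HH.te_mult HH.T.l_distr)

text \<open>The module algebra law. For the generator E the factor -q of the antipode makes the two
  middle terms cancel by K E = q E K, and likewise for F with 1/q in place of q.\<close>

lemma act_mult:
  assumes "x \<in> carrier H" "S \<in> carrier A" "S' \<in> carrier A"
  shows "act x (S \<otimes>\<^bsub>A\<^esub> S') = diag S S' (U_comul q \<mu> \<mu> \<mu> x)"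
  using qnz assms
proof (induction x arbitrary: S S' rule: U_induct)
  case one
  then show ?case by (simp add: comul_HH HH.te_one)
next
  case (gen g)
  then have [simp]: "S \<in> carrier A" "S' \<in> carrier A" by simp_all
  show ?case
    by (cases g; simp add: U_comul(2-)[OF qnz] act_gen A.m_assoc A.l_distr A.r_distr
         A.smult_add_right A.a_assoc;
       rule A.lin_eqI, ((rule A.formal_intros | (simp; fail))+)[2], simp add: algebra_simps)
next
  case (smult c x)
  then show ?case by (simp add: comul_HH)
next
  case (add x y)
  then show ?case by (simp add: comul_HH)
next
  case (mult x y)
  \<comment> \<open>With t the comultiplication of y this is the law for x y. Stating it for all
    tensors allows the hypothesis for x to be used on one elementary tensor at a time, with the
    factors already moved by it.\<close>
  have "diag S S' (U_comul q \<mu> \<mu> \<mu> x \<otimes>\<^bsub>tensor H H\<^esub> t) = act x (diag S S' t)"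
    if "t \<in> carrier (tensor H H)" for t
    using that
    by (induction t rule: HH.tensor_induct)
       (use mult in \<open>simp_all add: diag_mult_tens comul_HH HH.T.r_distr\<close>)
  then show ?case using mult by (simp add: comul_HH)
qed

text \<open>The map sending x to S(x)^* is multiplicative and antilinear, being composed of two
  antimultiplicative maps; the law is therefore inherited by products and sums and has content only
  on the generators.\<close>

lemma act_star:
  assumes "x \<in> carrier H" "S \<in> carrier A"
  shows "act x (star A S) = star A (act (star H (U_antipode q \<mu> \<mu> x)) S)"
proof -
  note s = alg_homD[OF U_antipode(1)[OF qnz, of \<mu> \<mu>], simplified]
  show ?thesis
    using qnz assms
  proof (induction x arbitrary: S rule: U_induct)
    case one
    then show ?case by (simp add: s)
  next
    case (gen g)
    then show ?case
      by (cases g)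
         (simp_all add: U_antipode(2-)[OF qnz] U_star_gen act_gen A.m_assoc A.smult_add_right A.a_comm)
  next
    case (smult c x)
    then show ?case by (simp add: s)
  next
    case (add x y)
    then show ?case by (simp add: s)
  next
    case (mult x y)
    then show ?case by (simp add: s)
  qed
qed

end

section \<open>The pairing and the generators of $B_{\mu\nu}^\tau$\<close>

locale uq_pairing = uq_action q \<mu> \<nu> \<tau> for q \<mu> \<nu> \<tau> :: real +
  fixes pair :: "U \<Rightarrow> P \<Rightarrow> complex"
  assumes \<mu>: "\<mu> \<in> {-1, 0, 1}" and pairing: "U_Pol_pairing q \<mu> pair"
begin

abbreviation "P \<equiv> pol_alg q \<mu>"
abbreviation "a \<equiv> pol_gen q \<mu> Pa"
abbreviation "b \<equiv> pol_gen q \<mu> Pb"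
abbreviation "as \<equiv> pol_gen q \<mu> Pd"
abbreviation "bs \<equiv> star P b"
abbreviation "gen_H \<equiv> U_gen q \<mu> \<mu>"
abbreviation "r \<equiv> complex_of_real"

sublocale P: complex_star_algebra P using \<mu> by (rule pol_star_algebra) simp
sublocale PP: tensor_product P P ..

lemmas pol_facts = pol_gens[OF \<mu> qnz]
lemmas pol_rel [simp] = pq_gensD[OF pol_facts(1)]
lemmas pol_comul_gen [simp] = pol_comul(2-)[OF \<mu> qnz]
lemmas pol_comul_hom = alg_homD[OF pol_comul(1)[OF \<mu> qnz]]

lemma pairing_hopf: "hopf_star_pairing (U_hopf q \<mu>) (Pol_hopf q \<mu>) pair"
  using pairing by (simp add: U_Pol_pairing_def Let_def)

lemma pair_linear [simp]:
  "x \<in> carrier H \<Longrightarrow> x' \<in> carrier H \<Longrightarrow> y \<in> carrier P \<Longrightarrow> pair (x \<oplus>\<^bsub>H\<^esub> x') y = pair x y + pair x' y"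
  "x \<in> carrier H \<Longrightarrow> y \<in> carrier P \<Longrightarrow> y' \<in> carrier P \<Longrightarrow> pair x (y \<oplus>\<^bsub>P\<^esub> y') = pair x y + pair x y'"
  "x \<in> carrier H \<Longrightarrow> y \<in> carrier P \<Longrightarrow> pair (c \<odot>\<^bsub>H\<^esub> x) y = c * pair x y"
  "x \<in> carrier H \<Longrightarrow> y \<in> carrier P \<Longrightarrow> pair x (c \<odot>\<^bsub>P\<^esub> y) = c * pair x y"
  using pairing_hopf by (simp_all add: hopf_star_pairing_def)

lemma pair_star:
  "x \<in> carrier H \<Longrightarrow> y \<in> carrier P \<Longrightarrow> pair x (star P y) = cnj (pair (star H (U_antipode q \<mu> \<mu> x)) y)"
  using pairing_hopf by (simp add: hopf_star_pairing_def)

lemma pair_nondegenerate: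
  "y \<in> carrier P \<Longrightarrow> (\<And>x. x \<in> carrier H \<Longrightarrow> pair x y = 0) \<Longrightarrow> y = \<zero>\<^bsub>P\<^esub>"
  using pairing by (simp add: U_Pol_pairing_def Let_def nondegenerate_pairing_def)

definition pair2 :: "U \<Rightarrow> U \<Rightarrow> ((P \<times> P) \<Rightarrow>\<^sub>0 complex) set \<Rightarrow> complex" where
  "pair2 x y = tensor_lift complex_alg (\<lambda>u v. pair x u * pair y v)"

lemma pair2_bilinear:
  "x \<in> carrier H \<Longrightarrow> y \<in> carrier H \<Longrightarrow> tensor_bilinear P P complex_alg (\<lambda>u v. pair x u * pair y v)"
  by (intro tensor_bilinear.intro tensor_bilinear_axioms.intro PP.tensor_product_axioms
      complex_algebra_complex_alg)
     (simp add: bilinear_map_def algebra_simps)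

lemma pair2 [simp]:
  assumes "x \<in> carrier H" "y \<in> carrier H"
  shows "u \<in> carrier P \<Longrightarrow> w \<in> carrier P \<Longrightarrow> pair2 x y (tens P P u w) = pair x u * pair y w"
    "t \<in> carrier (tensor P P) \<Longrightarrow> t' \<in> carrier (tensor P P) \<Longrightarrow>
       pair2 x y (t \<oplus>\<^bsub>tensor P P\<^esub> t') = pair2 x y t + pair2 x y t'"
    "t \<in> carrier (tensor P P) \<Longrightarrow> pair2 x y (c \<odot>\<^bsub>tensor P P\<^esub> t) = c * pair2 x y t"
  unfolding pair2_def by (simp_all add: tensor_lift_simps[OF pair2_bilinear[OF assms]])

lemma pair_comul:
  "x \<in> carrier H \<Longrightarrow> y \<in> carrier H \<Longrightarrow> z \<in> carrier P \<Longrightarrow> pair (x \<otimes>\<^bsub>H\<^esub> y) z = pair2 x y (pol_comul q \<mu> z)"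
  using pairing_hopf by (simp add: hopf_star_pairing_def pair2_def)

definition copair :: "P \<Rightarrow> P \<Rightarrow> ((U \<times> U) \<Rightarrow>\<^sub>0 complex) set \<Rightarrow> complex" where
  "copair y z = tensor_lift complex_alg (\<lambda>u v. pair u y * pair v z)"

lemma copair_bilinear:
  "y \<in> carrier P \<Longrightarrow> z \<in> carrier P \<Longrightarrow> tensor_bilinear H H complex_alg (\<lambda>u v. pair u y * pair v z)"
  by (intro tensor_bilinear.intro tensor_bilinear_axioms.intro HH.tensor_product_axioms
      complex_algebra_complex_alg)
     (simp add: bilinear_map_def algebra_simps)

lemma copair [simp]:
  assumes "y \<in> carrier P" "z \<in> carrier P"
  shows "u \<in> carrier H \<Longrightarrow> w \<in> carrier H \<Longrightarrow> copair y z (tens H H u w) = pair u y * pair w z"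
    "t \<in> carrier (tensor H H) \<Longrightarrow> t' \<in> carrier (tensor H H) \<Longrightarrow>
       copair y z (t \<oplus>\<^bsub>tensor H H\<^esub> t') = copair y z t + copair y z t'"
    "t \<in> carrier (tensor H H) \<Longrightarrow> copair y z (c \<odot>\<^bsub>tensor H H\<^esub> t) = c * copair y z t"
  unfolding copair_def by (simp_all add: tensor_lift_simps[OF copair_bilinear[OF assms]])

lemma pair_mult:
  "x \<in> carrier H \<Longrightarrow> y \<in> carrier P \<Longrightarrow> z \<in> carrier P \<Longrightarrow>
    pair x (y \<otimes>\<^bsub>P\<^esub> z) = copair y z (U_comul q \<mu> \<mu> \<mu> x)"
  using pairing_hopf by (simp add: hopf_star_pairing_def copair_def)

lemma pair_gen_mult:
  assumes "y \<in> carrier P" "z \<in> carrier P"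
  shows "pair \<one>\<^bsub>H\<^esub> (y \<otimes>\<^bsub>P\<^esub> z) = pair \<one>\<^bsub>H\<^esub> y * pair \<one>\<^bsub>H\<^esub> z"
    "pair (gen_H GK) (y \<otimes>\<^bsub>P\<^esub> z) = pair (gen_H GK) y * pair (gen_H GK) z"
    "pair (gen_H GKi) (y \<otimes>\<^bsub>P\<^esub> z) = pair (gen_H GKi) y * pair (gen_H GKi) z"
    "pair (gen_H GE) (y \<otimes>\<^bsub>P\<^esub> z) = pair (gen_H GE) y * pair (gen_H GK) z + pair (gen_H GKi) y * pair (gen_H GE) z"
    "pair (gen_H GF) (y \<otimes>\<^bsub>P\<^esub> z) = pair (gen_H GF) y * pair (gen_H GK) z + pair (gen_H GKi) y * pair (gen_H GF) z"
  using assms by (simp_all add: pair_mult U_comul(2-)[OF qnz] comul_HH HH.te_one)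

text \<open>A name for the square root of q, so that arithmetic in the tables can proceed by the
  single relation \<open>RR\<close>.\<close>

definition R :: complex where "R = r (sqrt q)"

lemma R [simp]: "R \<noteq> 0" and RR: "R * R = r q"
  using q0 by (simp_all add: R_def flip: of_real_mult)

lemma pair_table_KEF:
  "pair (gen_H GK) a = 1 / R" "pair (gen_H GK) as = R" "pair (gen_H GK) b = 0" "pair (gen_H GK) bs = 0"
  "pair (gen_H GE) a = 0" "pair (gen_H GE) as = 0" "pair (gen_H GE) b = 1" "pair (gen_H GE) bs = 0"
  "pair (gen_H GF) a = 0" "pair (gen_H GF) as = 0" "pair (gen_H GF) b = 0" "pair (gen_H GF) bs = - 1 / r q"
proof -
  note * = pairing[unfolded U_Pol_pairing_def Let_def, simplified, unfolded pol_facts(2)]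
  show "pair (gen_H GK) a = 1 / R" "pair (gen_H GK) as = R" "pair (gen_H GK) b = 0" "pair (gen_H GK) bs = 0"
    "pair (gen_H GE) a = 0" "pair (gen_H GE) as = 0" "pair (gen_H GE) b = 1" "pair (gen_H GE) bs = 0"
    "pair (gen_H GF) a = 0" "pair (gen_H GF) as = 0" "pair (gen_H GF) b = 0"
    using * by (simp_all add: R_def)
  have "- r q * pair (gen_H GF) bs = 1" using * by (simp add: pair_linear(4)[symmetric] del: pair_linear(4))
  then have "r q * pair (gen_H GF) bs = - 1" by (metis minus_minus mult_minus_left)
  then show "pair (gen_H GF) bs = - 1 / r q" by (simp add: field_simps)
qed

lemma pair_comul_gen:
  assumes "x \<in> carrier H" "y \<in> carrier H"
  shows "pair (x \<otimes>\<^bsub>H\<^esub> y) a = pair x a * pair y a - r (q * \<mu>) * (pair x bs * pair y b)"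
    "pair (x \<otimes>\<^bsub>H\<^esub> y) b = pair x b * pair y a + pair x as * pair y b"
    "pair (x \<otimes>\<^bsub>H\<^esub> y) bs = pair x bs * pair y as + pair x a * pair y bs"
    "pair (x \<otimes>\<^bsub>H\<^esub> y) as = pair x as * pair y as - r (q * \<mu>) * (pair x b * pair y bs)"
    "pair (x \<otimes>\<^bsub>H\<^esub> y) \<one>\<^bsub>P\<^esub> = pair x \<one>\<^bsub>P\<^esub> * pair y \<one>\<^bsub>P\<^esub>"
  using assms by (simp_all add: pair_comul pol_comul_hom PP.te_one)

text \<open>The values not prescribed follow from duality: those at the unit of U from K 1 = K,
  those at the inverse of K from K K^{-1} = 1, and the pairings with the unit of Pol from a 1 = a
  and 1 a = a.\<close>

lemma pair_table:
  "pair \<one>\<^bsub>H\<^esub> a = 1" "pair \<one>\<^bsub>H\<^esub> as = 1" "pair \<one>\<^bsub>H\<^esub> b = 0" "pair \<one>\<^bsub>H\<^esub> bs = 0" "pair \<one>\<^bsub>H\<^esub> \<one>\<^bsub>P\<^esub> = 1"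
  "pair (gen_H GKi) a = R" "pair (gen_H GKi) as = 1 / R" "pair (gen_H GKi) b = 0" "pair (gen_H GKi) bs = 0"
  "pair (gen_H GK) \<one>\<^bsub>P\<^esub> = 1" "pair (gen_H GKi) \<one>\<^bsub>P\<^esub> = 1" "pair (gen_H GE) \<one>\<^bsub>P\<^esub> = 0" "pair (gen_H GF) \<one>\<^bsub>P\<^esub> = 0"
proof -
  note c = pair_comul_gen[of "gen_H GK" "\<one>\<^bsub>H\<^esub>", simplified]
  note t = pair_table_KEF
  show one: "pair \<one>\<^bsub>H\<^esub> a = 1" "pair \<one>\<^bsub>H\<^esub> as = 1" "pair \<one>\<^bsub>H\<^esub> b = 0" "pair \<one>\<^bsub>H\<^esub> bs = 0"
    using c by (simp_all add: t)
  have kk: "gen_H GK \<otimes>\<^bsub>H\<^esub> gen_H GKi = \<one>\<^bsub>H\<^esub>" using U_gens[OF qnz] by (simp add: uq_gens_def)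
  note d = pair_comul_gen[of "gen_H GK" "gen_H GKi", simplified, unfolded kk one]
  show ki: "pair (gen_H GKi) a = R" "pair (gen_H GKi) as = 1 / R" "pair (gen_H GKi) b = 0" "pair (gen_H GKi) bs = 0"
    using d by (simp_all add: t field_simps)
  note e = pair_gen_mult[of a "\<one>\<^bsub>P\<^esub>", simplified] pair_gen_mult[of "\<one>\<^bsub>P\<^esub>" a, simplified]
  show "pair \<one>\<^bsub>H\<^esub> \<one>\<^bsub>P\<^esub> = 1" using e(1) one by simp
  show k1: "pair (gen_H GK) \<one>\<^bsub>P\<^esub> = 1" "pair (gen_H GKi) \<one>\<^bsub>P\<^esub> = 1"
    using e(2,3) by (simp_all add: t ki)
  show "pair (gen_H GE) \<one>\<^bsub>P\<^esub> = 0" "pair (gen_H GF) \<one>\<^bsub>P\<^esub> = 0"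
    using e(9,10) by (simp_all add: t ki k1)
qed

section \<open>The span of 1, X, Z, X^* and its matrix coefficients\<close>

definition X where "X = B_X q \<mu> \<nu> \<tau>"
definition Z where "Z = B_Z q \<mu> \<nu> \<tau>"
definition Xs where "Xs = star A X"
definition G :: complex where "G = r (sqrt q * (1 / q - q))"

lemma X_eq: "X = G \<odot>\<^bsub>A\<^esub> (gen_A GF \<otimes>\<^bsub>A\<^esub> gen_A GK)"
  unfolding X_def B_X_def G_def gen_A_def by (simp add: proj U_rules(1))

lemma Z_eq: "Z = gen_A GK \<otimes>\<^bsub>A\<^esub> gen_A GK"
  unfolding Z_def B_Z_def gen_A_def by (simp add: proj U_rules(1))

lemma Xs_eq: "Xs = G \<odot>\<^bsub>A\<^esub> (gen_A GK \<otimes>\<^bsub>A\<^esub> gen_A GE)"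
  unfolding Xs_def X_eq by (simp add: G_def)

lemma XZ_closed [simp]: "X \<in> carrier A" "Z \<in> carrier A" "Xs \<in> carrier A"
  by (simp_all add: X_eq Z_eq Xs_eq)

definition lam2 :: complex where "lam2 = r ((lam q)\<^sup>2)"

text \<open>Explains the normalisation of X: \<open>G\<close> is the factor in front of F K, and
  since \<lambda> = q / (q^2 - 1), the product G \<lambda>^2 (1 - q^2) is q^{3/2}. This removes
  \<lambda> from the action on X and X^*.\<close>

lemma lam_scalars: "G * lam2 * (1 - r q * r q) = R * r q" "G * r q = R * (1 - r q * r q)"
proof -
  have nz: "q * q - 1 \<noteq> 0" using q0 q1 mult_strict_mono[of q 1 q 1] by simp
  have lam: "lam q = q / (q * q - 1)" using q0 nz by (simp add: lam_def field_simps)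
  have "sqrt q * (1 / q - q) * (lam q)\<^sup>2 * (1 - q * q) = sqrt q * q"
    using nz q0 unfolding lam by (simp add: divide_simps power2_eq_square) (simp add: algebra_simps)
  then have "r (sqrt q * (1 / q - q) * (lam q)\<^sup>2 * (1 - q * q)) = r (sqrt q * q)" by (rule arg_cong)
  then show "G * lam2 * (1 - r q * r q) = R * r q"
    unfolding G_def lam2_def R_def by (simp only: of_real_mult of_real_diff of_real_1)
  have "sqrt q * (1 / q - q) * q = sqrt q * (1 - q * q)" using q0 by (simp add: field_simps)
  then have "r (sqrt q * (1 / q - q) * q) = r (sqrt q * (1 - q * q))" by (rule arg_cong)
  then show "G * r q = R * (1 - r q * r q)"
    unfolding G_def R_def by (simp only: of_real_mult of_real_diff of_real_1)
qed

lemma EF_FE: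
  "gen_A GE \<otimes>\<^bsub>A\<^esub> gen_A GF = (lam2 * r (\<tau> / q)) \<odot>\<^bsub>A\<^esub> \<one>\<^bsub>A\<^esub> \<oplus>\<^bsub>A\<^esub>
     ((lam2 * r (- \<mu> / q)) \<odot>\<^bsub>A\<^esub> (gen_A GK \<otimes>\<^bsub>A\<^esub> gen_A GK) \<oplus>\<^bsub>A\<^esub> (lam2 * r (- q * \<nu>)) \<odot>\<^bsub>A\<^esub> (gen_A GKi \<otimes>\<^bsub>A\<^esub> gen_A GKi))"
  "gen_A GF \<otimes>\<^bsub>A\<^esub> gen_A GE = (lam2 * r (\<tau> / q)) \<odot>\<^bsub>A\<^esub> \<one>\<^bsub>A\<^esub> \<oplus>\<^bsub>A\<^esub>
     ((lam2 * r (- q * \<mu>)) \<odot>\<^bsub>A\<^esub> (gen_A GK \<otimes>\<^bsub>A\<^esub> gen_A GK) \<oplus>\<^bsub>A\<^esub> (lam2 * r (- \<nu> / q)) \<odot>\<^bsub>A\<^esub> (gen_A GKi \<otimes>\<^bsub>A\<^esub> gen_A GKi))"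
proof -
  have nz: "q * q - 1 \<noteq> 0" using q0 q1 mult_strict_mono[of q 1 q 1] by simp
  have lam: "lam q = q / (q * q - 1)" using q0 nz by (simp add: lam_def field_simps)
  \<comment> \<open>Both identities are instances of \<lambda>^2 (q - 1/q) = \<lambda>; they absorb
    the commutator of E and F into the Casimir expression.\<close>
  have l1: "- (lam q)\<^sup>2 * m / q - lam q * m = - (lam q)\<^sup>2 * q * m"
    "- (lam q)\<^sup>2 * q * m + lam q * m = - (lam q)\<^sup>2 * m / q" for m
    using nz q0 unfolding lam
    by (simp_all add: divide_simps power2_eq_square) (simp_all add: algebra_simps)
  show ef: "gen_A GE \<otimes>\<^bsub>A\<^esub> gen_A GF = (lam2 * r (\<tau> / q)) \<odot>\<^bsub>A\<^esub> \<one>\<^bsub>A\<^esub> \<oplus>\<^bsub>A\<^esub>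
     ((lam2 * r (- \<mu> / q)) \<odot>\<^bsub>A\<^esub> (gen_A GK \<otimes>\<^bsub>A\<^esub> gen_A GK) \<oplus>\<^bsub>A\<^esub> (lam2 * r (- q * \<nu>)) \<odot>\<^bsub>A\<^esub> (gen_A GKi \<otimes>\<^bsub>A\<^esub> gen_A GKi))"
    unfolding casimir_A lam2_def
    by (rule A.lin_eqI, ((rule A.formal_intros | (simp; fail))+)[2], simp add: algebra_simps)
  have "gen_A GF \<otimes>\<^bsub>A\<^esub> gen_A GE = gen_A GE \<otimes>\<^bsub>A\<^esub> gen_A GF \<oplus>\<^bsub>A\<^esub>
      (r (- lam q * \<mu>) \<odot>\<^bsub>A\<^esub> (gen_A GK \<otimes>\<^bsub>A\<^esub> gen_A GK) \<oplus>\<^bsub>A\<^esub> r (lam q * \<nu>) \<odot>\<^bsub>A\<^esub> (gen_A GKi \<otimes>\<^bsub>A\<^esub> gen_A GKi))"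
    unfolding A_rules(8)
    by (rule A.lin_eqI, ((rule A.formal_intros | (simp; fail))+)[2], simp add: algebra_simps)
  also have "\<dots> = (lam2 * r (\<tau> / q)) \<odot>\<^bsub>A\<^esub> \<one>\<^bsub>A\<^esub> \<oplus>\<^bsub>A\<^esub>
     (r (- (lam q)\<^sup>2 * \<mu> / q - lam q * \<mu>) \<odot>\<^bsub>A\<^esub> (gen_A GK \<otimes>\<^bsub>A\<^esub> gen_A GK) \<oplus>\<^bsub>A\<^esub>
      r (- (lam q)\<^sup>2 * q * \<nu> + lam q * \<nu>) \<odot>\<^bsub>A\<^esub> (gen_A GKi \<otimes>\<^bsub>A\<^esub> gen_A GKi))"
    unfolding ef
    by (rule A.lin_eqI, ((rule A.formal_intros | (simp; fail))+)[2], simp add: lam2_def algebra_simps)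
  finally have fe: "gen_A GF \<otimes>\<^bsub>A\<^esub> gen_A GE = (lam2 * r (\<tau> / q)) \<odot>\<^bsub>A\<^esub> \<one>\<^bsub>A\<^esub> \<oplus>\<^bsub>A\<^esub>
     (r (- (lam q)\<^sup>2 * q * \<mu>) \<odot>\<^bsub>A\<^esub> (gen_A GK \<otimes>\<^bsub>A\<^esub> gen_A GK) \<oplus>\<^bsub>A\<^esub>
      r (- (lam q)\<^sup>2 * \<nu> / q) \<odot>\<^bsub>A\<^esub> (gen_A GKi \<otimes>\<^bsub>A\<^esub> gen_A GKi))"
    unfolding l1 .
  show "gen_A GF \<otimes>\<^bsub>A\<^esub> gen_A GE = (lam2 * r (\<tau> / q)) \<odot>\<^bsub>A\<^esub> \<one>\<^bsub>A\<^esub> \<oplus>\<^bsub>A\<^esub>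
     ((lam2 * r (- q * \<mu>)) \<odot>\<^bsub>A\<^esub> (gen_A GK \<otimes>\<^bsub>A\<^esub> gen_A GK) \<oplus>\<^bsub>A\<^esub> (lam2 * r (- \<nu> / q)) \<odot>\<^bsub>A\<^esub> (gen_A GKi \<otimes>\<^bsub>A\<^esub> gen_A GKi))"
    unfolding fe lam2_def
    by (rule A.lin_eqI, ((rule A.formal_intros | (simp; fail))+)[2], simp add: algebra_simps)
qed

lemma scalar_subst: "R = (G * lam2 - r q * r q * (G * lam2)) / r q" "G = R * (1 - r q * r q) / r q"
  using lam_scalars by (simp_all add: field_simps)

text \<open>The action of E on X and that of F on X^* reduce to multiples of E F - q^2 F E. By the
  Casimir relation its K^{-2} terms, and with them \<nu>, cancel, so the span of 1, X, Z, X^* is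
  invariant.\<close>

lemma act_table:
  "act (gen_H GK) X = (1 / r q) \<odot>\<^bsub>A\<^esub> X" "act (gen_H GK) Z = Z" "act (gen_H GK) Xs = r q \<odot>\<^bsub>A\<^esub> Xs"
  "act (gen_H GKi) X = r q \<odot>\<^bsub>A\<^esub> X" "act (gen_H GKi) Z = Z" "act (gen_H GKi) Xs = (1 / r q) \<odot>\<^bsub>A\<^esub> Xs"
  "act (gen_H GE) X = (R * r \<tau>) \<odot>\<^bsub>A\<^esub> \<one>\<^bsub>A\<^esub> \<oplus>\<^bsub>A\<^esub> (- R * (1 + r q * r q) * r \<mu>) \<odot>\<^bsub>A\<^esub> Z"
  "act (gen_H GE) Z = (1 / R) \<odot>\<^bsub>A\<^esub> Xs" "act (gen_H GE) Xs = \<zero>\<^bsub>A\<^esub>"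
  "act (gen_H GF) X = \<zero>\<^bsub>A\<^esub>" "act (gen_H GF) Z = (- 1 / (r q * R)) \<odot>\<^bsub>A\<^esub> X"
  "act (gen_H GF) Xs = ((1 + r q * r q) * r \<mu> * R / r q) \<odot>\<^bsub>A\<^esub> Z \<oplus>\<^bsub>A\<^esub> (- r \<tau> * R / r q) \<odot>\<^bsub>A\<^esub> \<one>\<^bsub>A\<^esub>"
  unfolding X_eq Z_eq Xs_eq
  by (simp add: act_gen A.m_assoc A.l_distr A.r_distr A.smult_add_right A.a_assoc EF_FE del: A_rules(8);
    rule A.lin_eqI, ((rule A.formal_intros | (simp; fail))+)[2],
    ((simp add: scalar_subst(2) field_simps; fail) | (simp add: scalar_subst(1) field_simps; fail)))+

text \<open>The entries are the coefficients of the stated coaction, paired with x. The last clause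
  says that 1 is acted on by the counit, written as the pairing with 1; it closes the system, as the
  first three clauses contain multiples of 1.\<close>

definition matrix_rep :: "U \<Rightarrow> bool" where
  "matrix_rep x \<longleftrightarrow>
    act x X = (- r q * r \<mu> * pair x (b \<otimes>\<^bsub>P\<^esub> b)) \<odot>\<^bsub>A\<^esub> Xs \<oplus>\<^bsub>A\<^esub>
      ((- r q * (1 + r q * r q) * r \<mu> * pair x (b \<otimes>\<^bsub>P\<^esub> a)) \<odot>\<^bsub>A\<^esub> Z \<oplus>\<^bsub>A\<^esub>
      (pair x (a \<otimes>\<^bsub>P\<^esub> a) \<odot>\<^bsub>A\<^esub> X \<oplus>\<^bsub>A\<^esub> (r q * r \<tau> * pair x (b \<otimes>\<^bsub>P\<^esub> a)) \<odot>\<^bsub>A\<^esub> \<one>\<^bsub>A\<^esub>)) \<and>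
    act x Z = pair x (as \<otimes>\<^bsub>P\<^esub> b) \<odot>\<^bsub>A\<^esub> Xs \<oplus>\<^bsub>A\<^esub>
      ((pair x \<one>\<^bsub>P\<^esub> - (1 + r q * r q) * r \<mu> * pair x (bs \<otimes>\<^bsub>P\<^esub> b)) \<odot>\<^bsub>A\<^esub> Z \<oplus>\<^bsub>A\<^esub>
      (pair x (bs \<otimes>\<^bsub>P\<^esub> a) \<odot>\<^bsub>A\<^esub> X \<oplus>\<^bsub>A\<^esub> (r \<tau> * pair x (bs \<otimes>\<^bsub>P\<^esub> b)) \<odot>\<^bsub>A\<^esub> \<one>\<^bsub>A\<^esub>)) \<and>
    act x Xs = pair x (as \<otimes>\<^bsub>P\<^esub> as) \<odot>\<^bsub>A\<^esub> Xs \<oplus>\<^bsub>A\<^esub>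
      ((- r q * (1 + r q * r q) * r \<mu> * pair x (as \<otimes>\<^bsub>P\<^esub> bs)) \<odot>\<^bsub>A\<^esub> Z \<oplus>\<^bsub>A\<^esub>
      ((- r q * r \<mu> * pair x (bs \<otimes>\<^bsub>P\<^esub> bs)) \<odot>\<^bsub>A\<^esub> X \<oplus>\<^bsub>A\<^esub>
       (r q * r \<tau> * pair x (as \<otimes>\<^bsub>P\<^esub> bs)) \<odot>\<^bsub>A\<^esub> \<one>\<^bsub>A\<^esub>)) \<and>
    act x \<one>\<^bsub>A\<^esub> = pair x \<one>\<^bsub>P\<^esub> \<odot>\<^bsub>A\<^esub> \<one>\<^bsub>A\<^esub>"

lemma RR': "R * (R * z) = r q * z"
  by (simp only: mult.assoc[symmetric] RR)


lemma matrix_rep_GK: "matrix_rep (gen_H GK)"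
  unfolding matrix_rep_def
  by (intro conjI; simp add: act_table act_gen pair_gen_mult pair_table pair_table_KEF RR;
      rule A.lin_eqI, ((rule A.formal_intros | (simp; fail))+)[2], simp add: field_simps RR RR')

lemma matrix_rep_GKi: "matrix_rep (gen_H GKi)"
  unfolding matrix_rep_def
  by (intro conjI; simp add: act_table act_gen pair_gen_mult pair_table pair_table_KEF RR;
      rule A.lin_eqI, ((rule A.formal_intros | (simp; fail))+)[2], simp add: field_simps RR RR')
lemma matrix_rep_GE: "matrix_rep (gen_H GE)"
  unfolding matrix_rep_def
  by (intro conjI; simp add: act_table act_gen pair_gen_mult pair_table pair_table_KEF RR;
      rule A.lin_eqI, ((rule A.formal_intros | (simp; fail))+)[2], simp add: field_simps RR RR')
lemma matrix_rep_GF: "matrix_rep (gen_H GF)"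
  unfolding matrix_rep_def
  by (intro conjI; simp add: act_table act_gen pair_gen_mult pair_table pair_table_KEF RR;
      rule A.lin_eqI, ((rule A.formal_intros | (simp; fail))+)[2], simp add: field_simps RR RR')

lemma matrix_rep_gen: "matrix_rep (gen_H g)"
  by (cases g) (simp_all add: matrix_rep_GK matrix_rep_GKi matrix_rep_GE matrix_rep_GF)

text \<open>The entries form a matrix corepresentation: the pairing of x y with an entry is that of
  x and y with its comultiplication. Expanding the quadratic entries by the relations of
  Pol_q(\<mu>) gives exactly the product of the matrices of x and y.\<close>

lemma matrix_rep_mult:
  assumes [simp]: "x \<in> carrier H" "y \<in> carrier H" and x: "matrix_rep x" and y: "matrix_rep y"
  shows "matrix_rep (x \<otimes>\<^bsub>H\<^esub> y)"
proof -
  note rx = x[unfolded matrix_rep_def] and ry = y[unfolded matrix_rep_def]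
  show ?thesis
    unfolding matrix_rep_def
    by (intro conjI;
        simp add: rx ry pair_comul pol_comul_hom PP.te_mult PP.te_one PP.T.l_distr PP.T.r_distr;
        rule A.lin_eqI, ((rule A.formal_intros | (simp; fail))+)[2],
        simp add: algebra_simps power2_eq_square)
qed

lemma matrix_rep: "x \<in> carrier H \<Longrightarrow> matrix_rep x"
  using qnz
proof (induction x rule: U_induct)
  case one
  show ?case
    unfolding matrix_rep_def
    by (intro conjI; simp add: pair_gen_mult pair_table)
next
  case (gen g)
  show ?case by (rule matrix_rep_gen)
next
  case (smult c x)
  then have x: "x \<in> carrier H" and rx: "matrix_rep x" by simp_all
  show ?case
    using rx unfolding matrix_rep_def
    by (elim conjE; intro conjI; simp add: x A.smult_add_right algebra_simps)
next
  case (add x y)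
  then have x [simp]: "x \<in> carrier H" "y \<in> carrier H" and rx: "matrix_rep x" "matrix_rep y" by simp_all
  note rx' = rx[unfolded matrix_rep_def]
  show ?case
    unfolding matrix_rep_def
    by (intro conjI; simp add: rx';
        rule A.lin_eqI, ((rule A.formal_intros | (simp; fail))+)[2], simp add: algebra_simps)
qed (rule matrix_rep_mult)

end

section \<open>The coaction\<close>

context uq_pairing
begin

abbreviation "B \<equiv> B_alg q \<mu> \<nu> \<tau>"
abbreviation "KE \<equiv> \<pi> (U_gen q \<mu> \<nu> GK \<otimes>\<^bsub>U\<^esub> U_gen q \<mu> \<nu> GE)"

lemma B_simps [simp]:
  "x \<otimes>\<^bsub>B\<^esub> y = x \<otimes>\<^bsub>A\<^esub> y" "x \<oplus>\<^bsub>B\<^esub> y = x \<oplus>\<^bsub>A\<^esub> y" "\<one>\<^bsub>B\<^esub> = \<one>\<^bsub>A\<^esub>" "\<zero>\<^bsub>B\<^esub> = \<zero>\<^bsub>A\<^esub>"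
  "c \<odot>\<^bsub>B\<^esub> x = c \<odot>\<^bsub>A\<^esub> x" "star B x = star A x"
  by (simp_all add: B_alg_def generated_star_subalg_def)

lemma carrier_B: "carrier B = \<Inter>{S. star_subalg A S \<and> {Z, KE} \<subseteq> S}"
  by (simp add: B_alg_def generated_star_subalg_def Z_def)

lemma star_subalg_A: "star_subalg A (carrier A)"
  by (simp add: star_subalg_def A.carrier_is_subring)

lemma KE_eq: "KE = gen_A GK \<otimes>\<^bsub>A\<^esub> gen_A GE"
  by (simp add: gen_A_def proj)

lemma star_subalg_B: "star_subalg A (carrier B)"
proof -
  let ?F = "{S. star_subalg A S \<and> {Z, KE} \<subseteq> S}"
  have "carrier A \<in> ?F" using star_subalg_A by (simp add: KE_eq)
  then have "?F \<noteq> {}" by blast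
  then have "subring (\<Inter>?F) A" by (intro A.subring_Inter) (simp_all add: star_subalg_def)
  then show ?thesis unfolding star_subalg_def carrier_B by (auto simp: star_subalg_def)
qed

lemma B_subset: "carrier B \<subseteq> carrier A"
  using star_subalg_B subringE(1) by (auto simp: star_subalg_def)

lemma B_minimal: "star_subalg A S \<Longrightarrow> {Z, KE} \<subseteq> S \<Longrightarrow> carrier B \<subseteq> S"
  unfolding carrier_B by blast

sublocale B: complex_star_algebra B
proof -
  have "B = A\<lparr>carrier := carrier B\<rparr>"
    by (simp add: B_alg_def generated_star_subalg_def)
  with A.star_subalg_algebra[OF star_subalg_B] show "complex_star_algebra B" by metis
qed

sublocale BP: tensor_product B P ..
sublocale BPP: tensor_product B "tensor P P" ..
sublocale BP_P: tensor_product "tensor B P" P ..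

lemma B_A [simp]: "y \<in> carrier B \<Longrightarrow> y \<in> carrier A"
  using B_subset by blast

lemma gens_B [simp]: "Z \<in> carrier B" "Xs \<in> carrier B" "X \<in> carrier B"
proof -
  have ZK: "Z \<in> carrier B" "KE \<in> carrier B" unfolding carrier_B by auto
  then show "Z \<in> carrier B" by simp
  have "G \<odot>\<^bsub>B\<^esub> KE \<in> carrier B" using ZK by (intro B.smult_closed)
  then show xs: "Xs \<in> carrier B" by (simp add: Xs_eq KE_eq)
  \<comment> \<open>No involutivity of the star is among the axioms, so this is read off from the
    explicit forms of \<open>Xs\<close> and \<open>X\<close>.\<close>
  have "star A Xs = X" by (simp add: Xs_eq X_eq G_def)
  then show "X \<in> carrier B" using B.star_closed[OF xs] by simp
qed

section \<open>Separation of B \<otimes> P and B \<otimes> P \<otimes> P by the pairing\<close>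

lemma pair_functional: "x \<in> carrier H \<Longrightarrow> linear_functional P (pair x)"
  by (simp add: linear_functional_def)

lemma pair2_functional: "x \<in> carrier H \<Longrightarrow> y \<in> carrier H \<Longrightarrow> linear_functional (tensor P P) (pair2 x y)"
  by (simp add: linear_functional_def)

lemmas slice_pair [simp] = BP.slice_simps[OF pair_functional, simplified]
lemmas slice_pair2 [simp] = BPP.slice_simps[OF pair2_functional, simplified]

lemma slice_pair_inject:
  assumes "t \<in> carrier (tensor B P)" "u \<in> carrier (tensor B P)"
    and "\<And>x. x \<in> carrier H \<Longrightarrow> slice B (pair x) t = slice B (pair x) u"
  shows "t = u"
  using assms pair_functional pair_nondegenerate
  by (intro BP.slice_inject[of "pair ` carrier H"]) auto

text \<open>Slicing the second leg by y leaves an element of P whose pairing with x is the double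
  pairing of t; nondegeneracy is used once for each leg.\<close>

lemma pair2_separates:
  assumes t: "t \<in> carrier (tensor P P)"
    and zero: "\<And>x y. x \<in> carrier H \<Longrightarrow> y \<in> carrier H \<Longrightarrow> pair2 x y t = 0"
  shows "t = \<zero>\<^bsub>tensor P P\<^esub>"
proof (rule PP.slice_separates[of "pair ` carrier H"])
  fix \<omega> assume "\<omega> \<in> pair ` carrier H"
  then obtain y where y: "y \<in> carrier H" "\<omega> = pair y" by blast
  note s = PP.slice_simps[OF pair_functional[OF y(1)]]
  have "pair x (slice P (pair y) t) = pair2 x y t" if x: "x \<in> carrier H" for x
    using t by (induction t rule: PP.tensor_induct) (simp_all add: s x y)
  then have "slice P (pair y) t = \<zero>\<^bsub>P\<^esub>"
    using zero t y by (intro pair_nondegenerate) (simp_all add: s)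
  then show "slice P \<omega> t = \<zero>\<^bsub>P\<^esub>" by (simp add: y)
qed (use t pair_functional pair_nondegenerate in auto)

lemma slice_pp_inject:
  assumes "t \<in> carrier (tensor B (tensor P P))" "u \<in> carrier (tensor B (tensor P P))"
    and "\<And>x y. x \<in> carrier H \<Longrightarrow> y \<in> carrier H \<Longrightarrow> slice B (pair2 x y) t = slice B (pair2 x y) u"
  shows "t = u"
proof (rule BPP.slice_inject[of "{pair2 x y | x y. x \<in> carrier H \<and> y \<in> carrier H}"])
  fix s assume "s \<in> carrier (tensor P P)"
    and "\<And>\<omega>. \<omega> \<in> {pair2 x y | x y. x \<in> carrier H \<and> y \<in> carrier H} \<Longrightarrow> \<omega> s = 0"
  then show "s = \<zero>\<^bsub>tensor P P\<^esub>" by (intro pair2_separates) blast+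
qed (use assms pair2_functional in auto)

text \<open>The tensor is required to lie in B \<otimes> P even though y may be any element of A.
  All its slices are then in B, which later yields \<open>act_B\<close>.\<close>

definition implements :: "((U set \<times> P) \<Rightarrow>\<^sub>0 complex) set \<Rightarrow> U set \<Rightarrow> bool" where
  "implements t y \<longleftrightarrow> t \<in> carrier (tensor B P) \<and> (\<forall>x \<in> carrier H. slice B (pair x) t = act x y)"

lemma act_one: "x \<in> carrier H \<Longrightarrow> act x \<one>\<^bsub>A\<^esub> = pair x \<one>\<^bsub>P\<^esub> \<odot>\<^bsub>A\<^esub> \<one>\<^bsub>A\<^esub>"
  using matrix_rep by (simp add: matrix_rep_def)

lemma implements_one: "implements (tens B P \<one>\<^bsub>B\<^esub> \<one>\<^bsub>P\<^esub>) \<one>\<^bsub>A\<^esub>"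
  using BP.te_closed[OF B.one_closed P.one_closed] B.one_closed
  by (simp add: implements_def act_one)

lemma implements_add:
  "implements t y \<Longrightarrow> implements u z \<Longrightarrow> y \<in> carrier A \<Longrightarrow> z \<in> carrier A \<Longrightarrow>
    implements (t \<oplus>\<^bsub>tensor B P\<^esub> u) (y \<oplus>\<^bsub>A\<^esub> z)"
  by (simp add: implements_def)

lemma implements_smult:
  "implements t y \<Longrightarrow> y \<in> carrier A \<Longrightarrow> implements (c \<odot>\<^bsub>tensor B P\<^esub> t) (c \<odot>\<^bsub>A\<^esub> y)"
  by (simp add: implements_def)

lemma slice_bilinear_H:
  assumes "t \<in> carrier (tensor B P)" "u \<in> carrier (tensor B P)"
  shows "tensor_bilinear H H A (\<lambda>x x'. slice B (pair x) t \<otimes>\<^bsub>A\<^esub> slice B (pair x') u)"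
proof -
  have add: "slice B (pair (x \<oplus>\<^bsub>H\<^esub> x')) t = slice B (pair x) t \<oplus>\<^bsub>A\<^esub> slice B (pair x') t"
    and smult: "slice B (pair (c \<odot>\<^bsub>H\<^esub> x)) t = c \<odot>\<^bsub>A\<^esub> slice B (pair x) t"
    if "x \<in> carrier H" "x' \<in> carrier H" "t \<in> carrier (tensor B P)" for x x' c t
    using that(3)
    by (induction t rule: BP.tensor_induct)
       (use that(1,2) in \<open>simp_all add: A.smult_add_left A.smult_add_right A.a_ac\<close>)
  have "bilinear_map H H A (\<lambda>x x'. slice B (pair x) t \<otimes>\<^bsub>A\<^esub> slice B (pair x') u)"
    using assms by (simp add: bilinear_map_def add smult A.l_distr A.r_distr)
  then show ?thesis
    by (intro tensor_bilinear.intro tensor_bilinear_axioms.intro HH.tensor_product_axioms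
        A.complex_algebra_axioms)
qed

text \<open>On elementary tensors both sides equal the pairing of x with p p' times y z, because the
  pairing is dual to the comultiplication of x. The rest is additivity in the two tensors.\<close>

lemma slice_mult:
  assumes x: "x \<in> carrier H" and t: "t \<in> carrier (tensor B P)" and u: "u \<in> carrier (tensor B P)"
  shows "slice B (pair x) (t \<otimes>\<^bsub>tensor B P\<^esub> u) =
    tensor_lift A (\<lambda>x x'. slice B (pair x) t \<otimes>\<^bsub>A\<^esub> slice B (pair x') u) (U_comul q \<mu> \<mu> \<mu> x)"
proof -
  have D: "U_comul q \<mu> \<mu> \<mu> x \<in> carrier (tensor H H)" using x by (simp add: comul_HH)
  let ?f = "\<lambda>t u. tensor_lift A (\<lambda>x x'. slice B (pair x) t \<otimes>\<^bsub>A\<^esub> slice B (pair x') u)"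
  have lift_tens: "?f (tens B P y p) (tens B P z p') s = copair p p' s \<odot>\<^bsub>A\<^esub> (y \<otimes>\<^bsub>A\<^esub> z)"
    if "y \<in> carrier B" "z \<in> carrier B" "p \<in> carrier P" "p' \<in> carrier P" "s \<in> carrier (tensor H H)"
    for y z p p' s
  proof -
    interpret tensor_bilinear H H A "\<lambda>x x'. slice B (pair x) (tens B P y p) \<otimes>\<^bsub>A\<^esub> slice B (pair x') (tens B P z p')"
      using that by (intro slice_bilinear_H BP.te_closed)
    show ?thesis
      using that(5) by (induction s rule: HH.tensor_induct)
        (use that in \<open>simp_all add: A.smult_add_left mult.commute\<close>)
  qed
  \<comment> \<open>Here t enters through the bilinear map that is being lifted and not through the
    tensor it is applied to, so additivity needs its own induction on s.\<close>
  have add_left: "?f (t \<oplus>\<^bsub>tensor B P\<^esub> t') u s = ?f t u s \<oplus>\<^bsub>A\<^esub> ?f t' u s"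
    if c: "t \<in> carrier (tensor B P)" "t' \<in> carrier (tensor B P)" "u \<in> carrier (tensor B P)"
      "s \<in> carrier (tensor H H)" for t t' u s
  proof -
    interpret a: tensor_bilinear H H A "\<lambda>x x'. slice B (pair x) (t \<oplus>\<^bsub>tensor B P\<^esub> t') \<otimes>\<^bsub>A\<^esub> slice B (pair x') u"
      using c by (intro slice_bilinear_H BP.T.a_closed)
    interpret b: tensor_bilinear H H A "\<lambda>x x'. slice B (pair x) t \<otimes>\<^bsub>A\<^esub> slice B (pair x') u"
      using c by (intro slice_bilinear_H)
    interpret c: tensor_bilinear H H A "\<lambda>x x'. slice B (pair x) t' \<otimes>\<^bsub>A\<^esub> slice B (pair x') u"
      using c by (intro slice_bilinear_H)
    show ?thesis
      using c(4) by (induction s rule: HH.tensor_induct) (use c in \<open>simp_all add: A.l_distr A.a_ac\<close>)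
  qed
  have add_right: "?f u (t \<oplus>\<^bsub>tensor B P\<^esub> t') s = ?f u t s \<oplus>\<^bsub>A\<^esub> ?f u t' s"
    if c: "t \<in> carrier (tensor B P)" "t' \<in> carrier (tensor B P)" "u \<in> carrier (tensor B P)"
      "s \<in> carrier (tensor H H)" for t t' u s
  proof -
    interpret a: tensor_bilinear H H A "\<lambda>x x'. slice B (pair x) u \<otimes>\<^bsub>A\<^esub> slice B (pair x') (t \<oplus>\<^bsub>tensor B P\<^esub> t')"
      using c by (intro slice_bilinear_H BP.T.a_closed)
    interpret b: tensor_bilinear H H A "\<lambda>x x'. slice B (pair x) u \<otimes>\<^bsub>A\<^esub> slice B (pair x') t"
      using c by (intro slice_bilinear_H)
    interpret c: tensor_bilinear H H A "\<lambda>x x'. slice B (pair x) u \<otimes>\<^bsub>A\<^esub> slice B (pair x') t'"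
      using c by (intro slice_bilinear_H)
    show ?thesis
      using c(4) by (induction s rule: HH.tensor_induct) (use c in \<open>simp_all add: A.r_distr A.a_ac\<close>)
  qed
  show ?thesis
    using t
  proof (induction t rule: BP.tensor_induct)
    case (tens y p)
    from u show ?case
    proof (induction u rule: BP.tensor_induct)
      case tens': (tens z p')
      with tens D have "?f (tens B P y p) (tens B P z p') (U_comul q \<mu> \<mu> \<mu> x) =
          pair x (p \<otimes>\<^bsub>P\<^esub> p') \<odot>\<^bsub>A\<^esub> (y \<otimes>\<^bsub>A\<^esub> z)"
        using x by (simp only: lift_tens pair_mult)
      moreover have "y \<otimes>\<^bsub>A\<^esub> z \<in> carrier B" using B.m_closed[of y z] tens tens' by simp
      ultimately show ?case using tens tens' x by (simp add: BP.te_mult)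
    next
      case (add u u')
      with tens x D show ?case by (simp add: BP.T.r_distr add_right)
    qed
  next
    case (add t t')
    with u x D show ?case by (simp add: BP.T.l_distr add_left)
  qed
qed

text \<open>\<open>slice_mult\<close> and the module algebra law \<open>act_mult\<close> distribute
  x over the two factors by the same comultiplication.\<close>

lemma implements_mult:
  assumes "implements t y" "implements u z" "y \<in> carrier A" "z \<in> carrier A"
  shows "implements (t \<otimes>\<^bsub>tensor B P\<^esub> u) (y \<otimes>\<^bsub>A\<^esub> z)"
proof -
  have t: "t \<in> carrier (tensor B P)" "\<And>x. x \<in> carrier H \<Longrightarrow> slice B (pair x) t = act x y"
    and u: "u \<in> carrier (tensor B P)" "\<And>x. x \<in> carrier H \<Longrightarrow> slice B (pair x) u = act x z"
    using assms by (auto simp: implements_def)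
  interpret tensor_bilinear H H A "\<lambda>x x'. slice B (pair x) t \<otimes>\<^bsub>A\<^esub> slice B (pair x') u"
    using t u by (intro slice_bilinear_H)
  have "tensor_lift A (\<lambda>x x'. slice B (pair x) t \<otimes>\<^bsub>A\<^esub> slice B (pair x') u) s = diag y z s"
    if "s \<in> carrier (tensor H H)" for s
    using that by (induction s rule: HH.tensor_induct) (use assms in \<open>simp_all add: t u\<close>)
  then show ?thesis
    using t u assms by (simp add: implements_def slice_mult act_mult comul_HH)
qed

text \<open>Pairing with p^* and acting on y^* both replace x by S(x)^* and conjugate the result, so
  the two replacements agree slice by slice.\<close>

lemma implements_star:
  assumes "implements t y" "y \<in> carrier A"
  shows "implements (star (tensor B P) t) (star A y)"
proof -
  have t: "t \<in> carrier (tensor B P)" "\<And>x. x \<in> carrier H \<Longrightarrow> slice B (pair x) t = act x y"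
    using assms by (auto simp: implements_def)
  note s = alg_homD(1)[OF U_antipode(1)[OF qnz, of \<mu> \<mu>], simplified]
  have "slice B (pair x) (star (tensor B P) t) =
      star A (slice B (pair (star H (U_antipode q \<mu> \<mu> x))) t)" if x: "x \<in> carrier H" for x
    using t(1)
  proof (induction t rule: BP.tensor_induct)
    case (tens y p)
    moreover have "star A y \<in> carrier B" using B.star_closed[of y] tens by simp
    ultimately show ?case using x by (simp add: BP.te_star s pair_star)
  qed (use x in \<open>simp_all add: s\<close>)
  then show ?thesis using assms t by (simp add: implements_def s act_star)
qed

section \<open>Explicit implementers of X, Z and X^*\<close>

abbreviation "T \<equiv> tensor B P"
abbreviation "tn \<equiv> tens B P"

definition "\<gamma>X = r (- q * \<mu>) \<odot>\<^bsub>T\<^esub> tn Xs (b \<otimes>\<^bsub>P\<^esub> b) \<oplus>\<^bsub>T\<^esub> r (- q * (1 + q\<^sup>2) * \<mu>) \<odot>\<^bsub>T\<^esub> tn Z (b \<otimes>\<^bsub>P\<^esub> a)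
  \<oplus>\<^bsub>T\<^esub> tn X (a \<otimes>\<^bsub>P\<^esub> a) \<oplus>\<^bsub>T\<^esub> r (q * \<tau>) \<odot>\<^bsub>T\<^esub> tn \<one>\<^bsub>B\<^esub> (b \<otimes>\<^bsub>P\<^esub> a)"
definition "\<gamma>Z = tn Xs (as \<otimes>\<^bsub>P\<^esub> b) \<oplus>\<^bsub>T\<^esub> tn Z (\<one>\<^bsub>P\<^esub> \<ominus>\<^bsub>P\<^esub> r ((1 + q\<^sup>2) * \<mu>) \<odot>\<^bsub>P\<^esub> (bs \<otimes>\<^bsub>P\<^esub> b))
  \<oplus>\<^bsub>T\<^esub> tn X (bs \<otimes>\<^bsub>P\<^esub> a) \<oplus>\<^bsub>T\<^esub> r \<tau> \<odot>\<^bsub>T\<^esub> tn \<one>\<^bsub>B\<^esub> (bs \<otimes>\<^bsub>P\<^esub> b)"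
definition "\<gamma>Xs = tn Xs (as \<otimes>\<^bsub>P\<^esub> as) \<oplus>\<^bsub>T\<^esub> r (- q * (1 + q\<^sup>2) * \<mu>) \<odot>\<^bsub>T\<^esub> tn Z (as \<otimes>\<^bsub>P\<^esub> bs)
  \<oplus>\<^bsub>T\<^esub> r (- q * \<mu>) \<odot>\<^bsub>T\<^esub> tn X (bs \<otimes>\<^bsub>P\<^esub> bs) \<oplus>\<^bsub>T\<^esub> r (q * \<tau>) \<odot>\<^bsub>T\<^esub> tn \<one>\<^bsub>B\<^esub> (as \<otimes>\<^bsub>P\<^esub> bs)"

lemma one_B: "\<one>\<^bsub>A\<^esub> \<in> carrier B"
  using B.one_closed by simp

lemma implements_gens: "implements \<gamma>X X" "implements \<gamma>Z Z" "implements \<gamma>Xs Xs"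
  unfolding implements_def \<gamma>X_def \<gamma>Z_def \<gamma>Xs_def
  using matrix_rep[unfolded matrix_rep_def]
  by (auto simp: one_B P.a_minus_eq_smult A.a_assoc power2_eq_square mult.assoc)

lemma implements_ex: "y \<in> carrier B \<Longrightarrow> \<exists>t. implements t y"
proof -
  let ?D = "{y \<in> carrier A. \<exists>t. implements t y}"
  have neg: "\<ominus>\<^bsub>A\<^esub> y \<in> ?D" if "y \<in> ?D" for y
    using that implements_smult[of _ y "- 1"] by (auto simp: A.minus_eq_smult)
  have "subring ?D A"
    using implements_one implements_mult implements_add neg
    by (intro A.subringI) blast+
  moreover have "c \<odot>\<^bsub>A\<^esub> y \<in> ?D" "star A y \<in> ?D" if "y \<in> ?D" for c y
    using that implements_smult implements_star by blast+
  ultimately have D: "star_subalg A ?D" unfolding star_subalg_def by blast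
  \<comment> \<open>The algebra B is generated by K E rather than by X^*; the two differ by the
    factor \<open>G\<close>, which is nonzero because 1/q > q.\<close>
  have "implements ((1 / G) \<odot>\<^bsub>T\<^esub> \<gamma>Xs) ((1 / G) \<odot>\<^bsub>A\<^esub> Xs)"
    by (intro implements_smult implements_gens XZ_closed)
  moreover have "G \<noteq> 0"
  proof -
    have "q * q < 1 * 1" using q0 q1 by (intro mult_strict_mono) auto
    then have "1 / q - q > 0" using q0 by (simp add: field_simps)
    then show ?thesis using q0 by (simp add: G_def del: of_real_diff)
  qed
  ultimately have "implements ((1 / G) \<odot>\<^bsub>T\<^esub> \<gamma>Xs) KE"
    by (simp add: Xs_eq KE_eq del: A_rules(4))
  then have "{Z, KE} \<subseteq> ?D" using implements_gens by (auto simp: KE_eq)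
  then have "carrier B \<subseteq> ?D" by (rule B_minimal[OF D])
  then show "y \<in> carrier B \<Longrightarrow> \<exists>t. implements t y" by blast
qed

section \<open>The coaction as the unique implementer\<close>

definition \<gamma> where "\<gamma> y = (THE t. implements t y)"

lemma \<gamma>_eqI: "implements t y \<Longrightarrow> \<gamma> y = t"
  unfolding \<gamma>_def
  by (rule the_equality, assumption, rule slice_pair_inject) (simp_all add: implements_def)

lemma \<gamma>: "y \<in> carrier B \<Longrightarrow> implements (\<gamma> y) y"
  using implements_ex \<gamma>_eqI by metis

lemma \<gamma>_closed [simp]: "y \<in> carrier B \<Longrightarrow> \<gamma> y \<in> carrier T"
  and slice_\<gamma> [simp]: "y \<in> carrier B \<Longrightarrow> x \<in> carrier H \<Longrightarrow> slice B (pair x) (\<gamma> y) = act x y"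
  using \<gamma> by (auto simp: implements_def)

text \<open>Invariance of B under the action: the result is a slice of a tensor in B \<otimes>
  P.\<close>

lemma act_B [simp]: "x \<in> carrier H \<Longrightarrow> y \<in> carrier B \<Longrightarrow> act x y \<in> carrier B"
  using slice_pair(1)[of x "\<gamma> y"] by simp

lemma \<gamma>_hom: "star_alg_hom B T \<gamma>"
  unfolding star_alg_hom_def
proof (intro conjI allI ballI ring_hom_memI)
  show "\<gamma> \<one>\<^bsub>B\<^esub> = \<one>\<^bsub>T\<^esub>" using \<gamma>_eqI[OF implements_one] by (simp add: BP.te_one)
qed (use \<gamma> in \<open>auto intro!: \<gamma>_eqI implements_mult implements_add implements_smult implements_star\<close>)

lemma \<gamma>_add: "y \<in> carrier B \<Longrightarrow> z \<in> carrier B \<Longrightarrow> \<gamma> (y \<oplus>\<^bsub>A\<^esub> z) = \<gamma> y \<oplus>\<^bsub>T\<^esub> \<gamma> z"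
  and \<gamma>_smult: "y \<in> carrier B \<Longrightarrow> \<gamma> (c \<odot>\<^bsub>A\<^esub> y) = c \<odot>\<^bsub>T\<^esub> \<gamma> y"
  using \<gamma>_hom by (auto simp: star_alg_hom_def ring_hom_def)

text \<open>Both sides are characters of P with the same values on the generators. The counit axiom
  for \<gamma> thereby becomes the statement that the unit of U acts trivially.\<close>

lemma counit_pair: "p \<in> carrier P \<Longrightarrow> pol_counit p = pair \<one>\<^bsub>H\<^esub> p"
proof -
  note e = pol_counit[OF \<mu> qnz] and h = alg_homD[OF pol_counit(1)[OF \<mu> qnz]]
  assume "p \<in> carrier P"
  with \<mu> qnz show ?thesis
    by (induction p rule: pol_induct) (simp_all add: e h pair_table pair_gen_mult)
qed

lemma slice_counit:
  assumes "y \<in> carrier B"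
  shows "slice B pol_counit (\<gamma> y) = y"
proof -
  have f: "linear_functional P pol_counit"
    using alg_homD[OF pol_counit(1)[OF \<mu> qnz]] by (simp add: linear_functional_def)
  have "slice B pol_counit s = slice B (pair \<one>\<^bsub>H\<^esub>) s" if "s \<in> carrier T" for s
    using that by (induction s rule: BP.tensor_induct) (simp_all add: BP.slice_simps[OF f, simplified] counit_pair)
  then show ?thesis using assms by simp
qed

section \<open>Coassociativity by double slices\<close>

abbreviation "T3 \<equiv> tensor B (tensor P P)"
abbreviation "t3 \<equiv> tens B (tensor P P)"

lemma assoc_inner: "z \<in> carrier P \<Longrightarrow> tensor_bilinear B P T3 (\<lambda>x y. t3 x (tens P P y z))"
  by (intro tensor_bilinear.intro tensor_bilinear_axioms.intro BP.tensor_product_axioms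
      BPP.T.complex_algebra_axioms)
     (auto simp: bilinear_map_def BPP.te_add_left[simplified] BPP.te_add_right BPP.te_smult_left[simplified]
       BPP.te_smult_right PP.te_add_left PP.te_smult_left)

text \<open>The inner lift in \<open>tensor_assoc\<close>, with its two arguments made explicit so
  that bilinearity in s and z can be stated.\<close>

definition inner where "inner s z = tensor_lift T3 (\<lambda>x y. t3 x (tens P P y z)) s"

lemma inner:
  assumes "z \<in> carrier P"
  shows "s \<in> carrier T \<Longrightarrow> inner s z \<in> carrier T3"
    and "x \<in> carrier B \<Longrightarrow> y \<in> carrier P \<Longrightarrow> inner (tn x y) z = t3 x (tens P P y z)"
    and "s \<in> carrier T \<Longrightarrow> s' \<in> carrier T \<Longrightarrow> inner (s \<oplus>\<^bsub>T\<^esub> s') z = inner s z \<oplus>\<^bsub>T3\<^esub> inner s' z"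
    and "s \<in> carrier T \<Longrightarrow> inner (c \<odot>\<^bsub>T\<^esub> s) z = c \<odot>\<^bsub>T3\<^esub> inner s z"
  unfolding inner_def by (simp_all add: tensor_lift_simps[OF assoc_inner[OF assms]])

lemma inner_linear:
  assumes "s \<in> carrier T" "z \<in> carrier P"
  shows "z' \<in> carrier P \<Longrightarrow> inner s (z \<oplus>\<^bsub>P\<^esub> z') = inner s z \<oplus>\<^bsub>T3\<^esub> inner s z'"
    and "inner s (c \<odot>\<^bsub>P\<^esub> z) = c \<odot>\<^bsub>T3\<^esub> inner s z"
  using assms
  by (induction s rule: BP.tensor_induct)
     (simp_all add: inner PP.te_add_right PP.te_smult_right BPP.te_add_right BPP.te_smult_right
       BPP.T.smult_add_right BPP.T.a_ac)

lemma slice_inner: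
  assumes "s \<in> carrier T" "z \<in> carrier P" "x \<in> carrier H" "x' \<in> carrier H"
  shows "slice B (pair2 x x') (inner s z) = pair x' z \<odot>\<^bsub>A\<^esub> slice B (pair x) s"
  using assms
  by (induction s rule: BP.tensor_induct)
     (simp_all add: inner A.smult_add_right mult.commute)

text \<open>Sliced by x and x', the left-hand side becomes the action of x on the action of x' on y,
  and the right-hand side the action of the product x x' on y. Coassociativity is thus dual to
  associativity of the action.\<close>

lemma coassoc:
  assumes y: "y \<in> carrier B"
  shows "tensor_assoc B P P (tensor_map T P \<gamma> (\<lambda>p. p) (\<gamma> y)) =
    tensor_map B (tensor P P) (\<lambda>b. b) (pol_comul q \<mu>) (\<gamma> y)"
proof -
  interpret as: tensor_bilinear T P T3 inner
    by (intro tensor_bilinear.intro tensor_bilinear_axioms.intro BP_P.tensor_product_axioms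
        BPP.T.complex_algebra_axioms)
       (simp add: bilinear_map_def inner inner_linear)
  interpret m1: tensor_bilinear B P "tensor T P" "\<lambda>y p. tens T P (\<gamma> y) p"
    by (intro tensor_bilinear.intro tensor_bilinear_axioms.intro BP.tensor_product_axioms
        BP_P.T.complex_algebra_axioms)
       (simp add: bilinear_map_def \<gamma>_add \<gamma>_smult BP_P.te_add_left BP_P.te_add_right
         BP_P.te_smult_left BP_P.te_smult_right)
  interpret m2: tensor_bilinear B P T3 "\<lambda>y p. t3 y (pol_comul q \<mu> p)"
    by (intro tensor_bilinear.intro tensor_bilinear_axioms.intro BP.tensor_product_axioms
        BPP.T.complex_algebra_axioms)
       (simp add: bilinear_map_def pol_comul_hom BPP.te_add_left[simplified] BPP.te_add_right
         BPP.te_smult_left[simplified] BPP.te_smult_right)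
  have assoc: "tensor_assoc B P P = tensor_lift T3 inner"
    by (simp add: tensor_assoc_def Let_def inner_def[abs_def] fun_eq_iff)
  let ?l = "\<lambda>s. tensor_lift T3 inner (tensor_lift (tensor T P) (\<lambda>y p. tens T P (\<gamma> y) p) s)"
  let ?r = "\<lambda>s. tensor_lift T3 (\<lambda>y p. t3 y (pol_comul q \<mu> p)) s"
  have "?l (\<gamma> y) = ?r (\<gamma> y)"
  proof (rule slice_pp_inject)
    fix x x' assume x: "x \<in> carrier H" "x' \<in> carrier H"
    have "slice B (pair2 x x') (?l s) = act x (slice B (pair x') s)" if "s \<in> carrier T" for s
      using that by (induction s rule: BP.tensor_induct) (use x in \<open>simp_all add: slice_inner\<close>)
    moreover have "slice B (pair2 x x') (?r s) = slice B (pair (x \<otimes>\<^bsub>H\<^esub> x')) s" if "s \<in> carrier T" for s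
      using that by (induction s rule: BP.tensor_induct) (use x in \<open>simp_all add: pair_comul pol_comul_hom\<close>)
    ultimately show "slice B (pair2 x x') (?l (\<gamma> y)) = slice B (pair2 x x') (?r (\<gamma> y))"
      using x y by simp
  qed (use y in simp_all)
  then show ?thesis by (simp add: assoc tensor_map_def)
qed

lemma \<gamma>_coaction: "right_coaction B (Pol_hopf q \<mu>) \<gamma>"
  unfolding right_coaction_def
  using \<gamma>_hom coassoc slice_counit
  by (simp add: tensor_Pol_hopf tensor_map_def tensor_assoc_def Let_def)

end

theorem proposition2p10:
  fixes q \<mu> \<nu> \<tau> :: real and pair :: "U \<Rightarrow> P \<Rightarrow> complex"
  assumes "0 < q" and "q < 1"
    and "\<mu> \<in> {-1, 0, 1}" and "\<nu> \<in> {-1, 0, 1}"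
    and "U_Pol_pairing q \<mu> pair"
  shows "let B = B_alg q \<mu> \<nu> \<tau>; P = Pol_hopf q \<mu>; T = tensor B P; t = tens B P;
             r = complex_of_real;
             X = B_X q \<mu> \<nu> \<tau>; Z = B_Z q \<mu> \<nu> \<tau>; Xs = star B X;
             a = pol_gen q \<mu> Pa; b = pol_gen q \<mu> Pb; as = star P a; bs = star P b
         in \<exists>\<gamma>. right_coaction B P \<gamma> \<and>
           \<gamma> X = r (- q * \<mu>) \<odot>\<^bsub>T\<^esub> t Xs (b \<otimes>\<^bsub>P\<^esub> b)
                 \<oplus>\<^bsub>T\<^esub> r (- q * (1 + q\<^sup>2) * \<mu>) \<odot>\<^bsub>T\<^esub> t Z (b \<otimes>\<^bsub>P\<^esub> a)
                 \<oplus>\<^bsub>T\<^esub> t X (a \<otimes>\<^bsub>P\<^esub> a)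
                 \<oplus>\<^bsub>T\<^esub> r (q * \<tau>) \<odot>\<^bsub>T\<^esub> t \<one>\<^bsub>B\<^esub> (b \<otimes>\<^bsub>P\<^esub> a) \<and>
           \<gamma> Z = t Xs (as \<otimes>\<^bsub>P\<^esub> b)
                 \<oplus>\<^bsub>T\<^esub> t Z (\<one>\<^bsub>P\<^esub> \<ominus>\<^bsub>P\<^esub> r ((1 + q\<^sup>2) * \<mu>) \<odot>\<^bsub>P\<^esub> (bs \<otimes>\<^bsub>P\<^esub> b))
                 \<oplus>\<^bsub>T\<^esub> t X (bs \<otimes>\<^bsub>P\<^esub> a)
                 \<oplus>\<^bsub>T\<^esub> r \<tau> \<odot>\<^bsub>T\<^esub> t \<one>\<^bsub>B\<^esub> (bs \<otimes>\<^bsub>P\<^esub> b) \<and>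
           \<gamma> Xs = t Xs (as \<otimes>\<^bsub>P\<^esub> as)
                 \<oplus>\<^bsub>T\<^esub> r (- q * (1 + q\<^sup>2) * \<mu>) \<odot>\<^bsub>T\<^esub> t Z (as \<otimes>\<^bsub>P\<^esub> bs)
                 \<oplus>\<^bsub>T\<^esub> r (- q * \<mu>) \<odot>\<^bsub>T\<^esub> t X (bs \<otimes>\<^bsub>P\<^esub> bs)
                 \<oplus>\<^bsub>T\<^esub> r (q * \<tau>) \<odot>\<^bsub>T\<^esub> t \<one>\<^bsub>B\<^esub> (as \<otimes>\<^bsub>P\<^esub> bs) \<and>
           (\<forall>x \<in> carrier (U_hopf q \<mu>). \<forall>y \<in> carrier B.
              A_action q \<mu> \<nu> \<tau> x y = slice B (\<lambda>p. pair x p) (\<gamma> y))"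
proof -
  interpret uq_pairing q \<mu> \<nu> \<tau> pair
    using assms by unfold_locales auto
  \<comment> \<open>Subtraction is defined through inverses in the additive monoid of the record;
    the Hopf record has the same carrier, addition and zero, hence the same subtraction.\<close>
  have minus: "x \<ominus>\<^bsub>Pol_hopf q \<mu>\<^esub> y = x \<ominus>\<^bsub>P\<^esub> y" for x y
    by (simp add: a_minus_def a_inv_def m_inv_def)
  have g: "\<gamma> X = \<gamma>X" "\<gamma> Z = \<gamma>Z" "\<gamma> Xs = \<gamma>Xs"
    by (rule \<gamma>_eqI, rule implements_gens)+
  show ?thesis
    unfolding Let_def
    by (rule exI[of _ \<gamma>])
       (use \<gamma>_coaction g in \<open>simp add: tensor_Pol_hopf minus pol_facts(2) A_action_eq_act X_def[symmetric] Z_def[symmetric]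
         Xs_def[symmetric] \<gamma>X_def \<gamma>Z_def \<gamma>Xs_def\<close>)
qed

end
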